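(* Let $n\ge 2$. Let $X$ be a connected topological manifold without boundary such that $\dim(X)\geq 3$ and whose universal covering $\tilde{X}$ is contractible, and let $Q_1\in \tilde{X}$. Then the homotopy fibre $I_{i_n(X)}$ of the inclusion map $i_{n}(X):F_{n}(X) \to \prod_1^nX$ is weakly homotopy equivalent to each of the following six spaces: $\widetilde{F_{n-1}(X \setminus \bar Q_1)}$, $F_n(X)\times_{\prod_1^nX}\prod_1^n \tilde X$, $\widetilde{F_n(X)}$, $F_n^{\pi_1(X)}(\tilde X)$, $F_{n-1}(X\setminus \bar Q_1)\times_{\prod_1^{n-1}X}\prod_1^{n-1} \tilde X$ and $F_{n-1}^{\pi_1(X)}(\tilde X\setminus \pi_1(X)Q_1)$.
   Context: $F_n(X)=\{(x_1,\dots,x_n)\in\prod_1^nX\mid x_i\ne x_j\text{ for }i\ne j\}$; for a free action of a group $G$ on $X$, $F^G_n(X)=\{(x_1,\dots,x_n)\in\prod_1^nX\mid Gx_i\cap Gx_j=\emptyset\text{ for }i\ne j\}$. The group $\pi_1(X)$ acts freely on $\tilde X$ by deck transformations, $p(\tilde X):\tilde X\to X$ is the universal covering map, and $\bar Q_1\in X$ is the image of $Q_1$. $\widetilde{Z}$ denotes the universal covering space of $Z$. The spaces $F_n(X)\times_{\prod_1^nX}\prod_1^n\tilde X$ and $F_{n-1}(X\setminus\bar Q_1)\times_{\prod_1^{n-1}X}\prod_1^{n-1}\tilde X$ are the strict pull-backs of $\prod_1^n p(\tilde X)$, respectively $\prod_1^{n-1}p(\tilde X)$, along the inclusions $F_n(X)\hookrightarrow\prod_1^nX$,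 respectively $F_{n-1}(X\setminus\bar Q_1)\hookrightarrow\prod_1^{n-1}X$. The homotopy fibre of a pointed map $f:X\to (Y,y_0)$ is $I_f=\{(x,\gamma)\in X\times Y^I\mid\gamma(0)=f(x),\gamma(1)=y_0\}$. *)

theory Defs
  imports "HOL-Analysis.Analysis" "HOL-Algebra.Group_Action"
begin

definition topological_manifold :: "nat \<Rightarrow> 'a topology \<Rightarrow> bool" where
  "topological_manifold d X \<longleftrightarrow>
     Hausdorff_space X \<and> second_countable X \<and>
     (\<forall>x \<in> topspace X. \<exists>U V. openin X U \<and> x \<in> U \<and> openin (Euclidean_space d) V \<and>
        subtopology X U homeomorphic_space subtopology (Euclidean_space d) V)"


subsection \<open>Homotopy classes relative to a subset, homotopy groups, weak equivalences\<close>

text \<open>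
  Maps of pairs from \<open>(D, A)\<close> to \<open>(X, {x})\<close>, up to homotopy through such maps.
\<close>

definition rel_homotopic ::
  "'d topology \<Rightarrow> 'd set \<Rightarrow> 'a topology \<Rightarrow> 'a \<Rightarrow> ('d \<Rightarrow> 'a) \<Rightarrow> ('d \<Rightarrow> 'a) \<Rightarrow> bool" where
  "rel_homotopic D A X x = homotopic_with (\<lambda>h. h ` A \<subseteq> {x}) D X"

definition rel_class ::
  "'d topology \<Rightarrow> 'd set \<Rightarrow> 'a topology \<Rightarrow> 'a \<Rightarrow> ('d \<Rightarrow> 'a) \<Rightarrow> ('d \<Rightarrow> 'a) set" where
  "rel_class D A X x f = {g. rel_homotopic D A X x f g}"

definition rel_classes ::
  "'d topology \<Rightarrow> 'd set \<Rightarrow> 'a topology \<Rightarrow> 'a \<Rightarrow> ('d \<Rightarrow> 'a) set set" where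
  "rel_classes D A X x = rel_class D A X x ` {f. continuous_map D X f \<and> f ` A \<subseteq> {x}}"

definition cube :: "nat \<Rightarrow> (nat \<Rightarrow> real) topology" where
  "cube n = product_topology (\<lambda>_. top_of_set {0..1}) {..<n}"

definition cube_boundary :: "nat \<Rightarrow> (nat \<Rightarrow> real) set" where
  "cube_boundary n = {t \<in> topspace (cube n). \<exists>i<n. t i = 0 \<or> t i = 1}"

text \<open>
  The underlying set of the \<open>n\<close>-th homotopy group.  For \<open>n = 0\<close> the cube is a point with empty
  boundary, so this is the set of path components (in the form of classes of maps from a point),
  for every choice of \<open>x\<close>.
\<close>

definition homotopy_group_set :: "nat \<Rightarrow> 'a topology \<Rightarrow> 'a \<Rightarrow> ((nat \<Rightarrow> real) \<Rightarrow> 'a) set set" where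
  "homotopy_group_set n X x = rel_classes (cube n) (cube_boundary n) X x"

definition homotopy_group_map ::
  "nat \<Rightarrow> 'b topology \<Rightarrow> ('a \<Rightarrow> 'b) \<Rightarrow> 'a \<Rightarrow>
     ((nat \<Rightarrow> real) \<Rightarrow> 'a) set \<Rightarrow> ((nat \<Rightarrow> real) \<Rightarrow> 'b) set" where
  "homotopy_group_map n Y f x C =
     (\<Union>\<alpha>\<in>C. rel_class (cube n) (cube_boundary n) Y (f x) (f \<circ> \<alpha>))"

text \<open>
  For \<open>n \<ge> 1\<close> the induced map is a group homomorphism for every continuous \<open>f\<close>, so that it is an
  isomorphism iff it is bijective.  The last conjunct is the surjectivity on path components in the
  case that \<open>X\<close> has no points.
\<close>

definition weak_homotopy_equivalence :: "'a topology \<Rightarrow> 'b topology \<Rightarrow> ('a \<Rightarrow> 'b) \<Rightarrow> bool" where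
  "weak_homotopy_equivalence X Y f \<longleftrightarrow>
     continuous_map X Y f \<and>
     (\<forall>x \<in> topspace X. \<forall>n. bij_betw (homotopy_group_map n Y f x)
        (homotopy_group_set n X x) (homotopy_group_set n Y (f x))) \<and>
     (topspace X = {} \<longrightarrow> topspace Y = {})"

text \<open>
  Two spaces are weakly homotopy equivalent if they are connected by a zigzag of weak homotopy
  equivalences; by CW approximation, this holds iff there is a single space \<open>Z\<close> with weak homotopy
  equivalences to both.  The type of the points of \<open>Z\<close> is no restriction: one can take for \<open>Z\<close> the
  geometric realization of the singular simplicial set of \<open>X\<close>, each of whose points is given
  uniquely by a nondegenerate singular simplex, of type \<open>(nat \<Rightarrow> real) \<Rightarrow> 'a\<close>, and an interior
  point of the standard simplex, of type \<open>nat \<Rightarrow> real\<close>.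
\<close>

definition weakly_homotopy_equivalent_space :: "'a topology \<Rightarrow> 'b topology \<Rightarrow> bool" where
  "weakly_homotopy_equivalent_space X Y \<longleftrightarrow>
     (\<exists>(Z :: (((nat \<Rightarrow> real) \<Rightarrow> 'a) \<times> (nat \<Rightarrow> real)) topology) f g.
        weak_homotopy_equivalence Z X f \<and> weak_homotopy_equivalence Z Y g)"


subsection \<open>The fundamental group and universal coverings\<close>

definition path_concat :: "(real \<Rightarrow> 'a) \<Rightarrow> (real \<Rightarrow> 'a) \<Rightarrow> real \<Rightarrow> 'a" where
  "path_concat \<alpha> \<beta> = (\<lambda>t. if t \<le> 1/2 then \<alpha> (2 * t) else \<beta> (2 * t - 1))"

abbreviation loop_class :: "'a topology \<Rightarrow> 'a \<Rightarrow> (real \<Rightarrow> 'a) \<Rightarrow> (real \<Rightarrow> 'a) set" where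
  "loop_class \<equiv> rel_class (top_of_set {0..1}) {0, 1}"

definition fundamental_group :: "'a topology \<Rightarrow> 'a \<Rightarrow> (real \<Rightarrow> 'a) set monoid" where
  "fundamental_group X x =
     \<lparr>carrier = rel_classes (top_of_set {0..1}) {0, 1} X x,
      mult = (\<lambda>C D. \<Union>\<alpha>\<in>C. \<Union>\<beta>\<in>D. loop_class X x (path_concat \<alpha> \<beta>)),
      one = loop_class X x (\<lambda>_. x)\<rparr>"

definition simply_connected_space :: "'a topology \<Rightarrow> bool" where
  "simply_connected_space X \<longleftrightarrow>
     path_connected_space X \<and>
     (\<forall>x \<in> topspace X. carrier (fundamental_group X x) = {one (fundamental_group X x)})"

text \<open>The counterpart of \<^const>\<open>covering_space\<close> for abstract topologies.\<close>

definition covering_map :: "'e topology \<Rightarrow> 'a topology \<Rightarrow> ('e \<Rightarrow> 'a) \<Rightarrow> bool" where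
  "covering_map E X p \<longleftrightarrow>
     continuous_map E X p \<and> p ` topspace E = topspace X \<and>
     (\<forall>x \<in> topspace X. \<exists>U. x \<in> U \<and> openin X U \<and>
        (\<exists>\<V>. \<Union>\<V> = topspace E \<inter> p -` U \<and> (\<forall>V \<in> \<V>. openin E V) \<and> pairwise disjnt \<V> \<and>
             (\<forall>V \<in> \<V>. homeomorphic_map (subtopology E V) (subtopology X U) p)))"

definition universal_covering :: "'e topology \<Rightarrow> 'a topology \<Rightarrow> ('e \<Rightarrow> 'a) \<Rightarrow> bool" where
  "universal_covering E X p \<longleftrightarrow> covering_map E X p \<and> simply_connected_space E"

definition deck_transformations :: "'e topology \<Rightarrow> ('e \<Rightarrow> 'a) \<Rightarrow> ('e \<Rightarrow> 'e) set" where
  "deck_transformations E p =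
     {g \<in> extensional (topspace E). homeomorphic_map E E g \<and> (\<forall>z \<in> topspace E. p (g z) = p z)}"

text \<open>
  The action of \<open>fundamental_group X (p e)\<close> on the universal covering space \<open>E\<close>: a class \<open>C\<close> acts
  as the deck transformation that moves \<open>e\<close> to the end point of the lifts, starting at \<open>e\<close>, of the
  loops in \<open>C\<close>.  A loop \<open>\<alpha> \<cdot> \<beta>\<close> runs through \<open>\<alpha>\<close> first, and with this convention
  this is a left action.
\<close>

definition deck_action ::
  "'e topology \<Rightarrow> ('e \<Rightarrow> 'a) \<Rightarrow> 'e \<Rightarrow> (real \<Rightarrow> 'a) set \<Rightarrow> 'e \<Rightarrow> 'e" where
  "deck_action E p e C =
     (THE g. g \<in> deck_transformations E p \<and>
        (\<forall>\<alpha> \<in> C. \<exists>\<delta>. pathin E \<delta> \<and> (\<forall>t \<in> {0..1}. p (\<delta> t) = \<alpha> t) \<and> \<delta> 0 = e \<and> \<delta> 1 = g e))"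


subsection \<open>Configuration spaces, pull-backs and homotopy fibres\<close>

definition power_space :: "nat \<Rightarrow> 'a topology \<Rightarrow> (nat \<Rightarrow> 'a) topology" where
  "power_space n X = product_topology (\<lambda>_. X) {1..n}"

definition power_map :: "nat \<Rightarrow> ('a \<Rightarrow> 'b) \<Rightarrow> (nat \<Rightarrow> 'a) \<Rightarrow> nat \<Rightarrow> 'b" where
  "power_map n f x = (\<lambda>i\<in>{1..n}. f (x i))"

definition config_space :: "nat \<Rightarrow> 'a topology \<Rightarrow> (nat \<Rightarrow> 'a) topology" where
  "config_space n X = subtopology (power_space n X)
     {x. \<forall>i \<in> {1..n}. \<forall>j \<in> {1..n}. i \<noteq> j \<longrightarrow> x i \<noteq> x j}"

definition orbit_config_space ::
  "('g, 'm) monoid_scheme \<Rightarrow> ('g \<Rightarrow> 'a \<Rightarrow> 'a) \<Rightarrow> nat \<Rightarrow> 'a topology \<Rightarrow> (nat \<Rightarrow> 'a) topology" where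
  "orbit_config_space G \<phi> n X = subtopology (power_space n X)
     {x. \<forall>i \<in> {1..n}. \<forall>j \<in> {1..n}. i \<noteq> j \<longrightarrow> orbit G \<phi> (x i) \<inter> orbit G \<phi> (x j) = {}}"

definition pullback_space ::
  "'a topology \<Rightarrow> ('a \<Rightarrow> 'c) \<Rightarrow> 'b topology \<Rightarrow> ('b \<Rightarrow> 'c) \<Rightarrow> ('a \<times> 'b) topology" where
  "pullback_space A f B g = subtopology (prod_topology A B) {(a, b). f a = g b}"

text \<open>
  Maps are represented by functions that are undefined outside the space \<open>D\<close>.
\<close>

definition compact_open_topology :: "'d topology \<Rightarrow> 'a topology \<Rightarrow> ('d \<Rightarrow> 'a) topology" where
  "compact_open_topology D Y = topology_generated_by
     {{\<gamma> \<in> extensional (topspace D). continuous_map D Y \<gamma> \<and> \<gamma> ` K \<subseteq> U} | K U.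
        compactin D K \<and> openin Y U}"

definition homotopy_fibre ::
  "'a topology \<Rightarrow> 'b topology \<Rightarrow> 'b \<Rightarrow> ('a \<Rightarrow> 'b) \<Rightarrow> ('a \<times> (real \<Rightarrow> 'b)) topology" where
  "homotopy_fibre X Y y0 f =
     subtopology (prod_topology X (compact_open_topology (top_of_set {0..1}) Y))
       {(x, \<gamma>). \<gamma> 0 = f x \<and> \<gamma> 1 = y0}"

end

theory Submission
  imports Defs
begin

text \<open>
  Let \<open>C\<close> consist of the \<open>n\<close>-tuples in \<open>Xt\<close> whose images in \<open>X\<close> are pairwise distinct and \<open>C'\<close> of
  those with first entry \<open>Q1\<close>, which is then omitted. The deck transformations act transitively
  on the fibres of \<open>p\<close>, so \<open>C\<close> and \<open>C'\<close> are both the pull-backs and the orbit configuration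
  spaces of the statement.

  They are simply connected, hence the universal coverings of the configuration spaces: as the
  powers of \<open>Xt\<close> are contractible, every map from the boundary of a cube to \<open>C\<close> extends to the
  cube as a map to the power of \<open>Xt\<close>, and for cubes of dimension at most 2, because \<open>d \<ge> 3\<close>, it
  can be made to miss the diagonals in \<open>X\<close> by a general position argument, one pair of
  coordinates after the other.

  The inclusion of \<open>C'\<close> in \<open>C\<close> is a weak equivalence: since \<open>Xt\<close> is contractible, the first points
  of a family of configurations can be moved to \<open>Q1\<close>, and local isotopies of \<open>X\<close> drag the other
  points along (the argument of Fadell and Neuwirth).

  Finally, paths in the power of \<open>X\<close> that end at \<open>y0\<close> lift uniquely to paths in the power of \<open>Xt\<close>
  that end at a given point over \<open>y0\<close>. So \<open>I\<close> is weakly equivalent to the homotopy fibre of the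
  inclusion of \<open>C\<close> in the contractible power of \<open>Xt\<close>, and the projection from there to \<open>C\<close> has
  the lifting property for all pairs of a cube and its boundary.
\<close>

subsection \<open>Covering maps of abstract topological spaces\<close>

text \<open>One space serves as the common source for all six equivalences: the homotopy fibre
  \<open>F'\<close> of \<open>C' -> C -> Y\<close>, with \<open>Y\<close> the power of
  \<open>Xt\<close>. It maps injectively to \<open>I\<close>, because a path in \<open>Y\<close> is
  determined by its projection and its end point; so its points can be renamed to the type that the
  definition prescribes, without CW approximation.

  Apart from composition and cancellation, weak equivalences are obtained from one criterion,
  \<open>compression\<close>: a map from a cube, given with a lift over the boundary, can be
  deformed relative to the boundary until it lifts. Contractibility enters as the extension of maps
  from the boundary of a cube, homotopies being cubes of one dimension more.

  Dragging and general position take place in \<open>X\<close>, because the condition on a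
  configuration concerns the images in \<open>X\<close>; the homotopies are then lifted through the
  coverings \<open>power_map n p\<close>. \<open>X\<close> carries no smooth structure, so
  perturbations are made chart by chart, and what has been achieved is kept as an open condition on
  graphs.\<close>

lemma continuous_map_paste_closed:
  assumes "closedin X S" "closedin X T" "topspace X \<subseteq> S \<union> T"
    and "continuous_map (subtopology X S) Y f" "continuous_map (subtopology X T) Y g"
    and "\<And>x. x \<in> topspace X \<Longrightarrow> x \<in> S \<Longrightarrow> h x = f x"
    and "\<And>x. x \<in> topspace X \<Longrightarrow> x \<in> T \<Longrightarrow> h x = g x"
  shows "continuous_map X Y h"
proof (rule pasting_lemma_closed[where I = "{True, False}" and T = "\<lambda>b. if b then S else T"
      and f = "\<lambda>b. if b then f else g"])
  fix i j x
  assume "x \<in> topspace X \<inter> (if i then S else T) \<inter> (if j then S else T)"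
  then show "(if i then f else g) x = (if j then f else g) x"
    using assms(6,7)[of x] by (auto split: if_splits)
next
  fix x assume "x \<in> topspace X"
  then show "\<exists>j. j \<in> {True, False} \<and> x \<in> (if j then S else T) \<and> h x = (if j then f else g) x"
    using assms(3) assms(6,7)[of x] by (cases "x \<in> S") (auto intro: exI[of _ True] exI[of _ False])
next
  fix i :: bool
  show "closedin X (if i then S else T)" using assms(1,2) by simp
  show "continuous_map (subtopology X (if i then S else T)) Y (if i then f else g)"
    using assms(4,5) by simp
qed simp

lemma continuous_map_paste_open:
  assumes "openin X S" "openin X T" "topspace X \<subseteq> S \<union> T"
    and "continuous_map (subtopology X S) Y f" "continuous_map (subtopology X T) Y g"
    and "\<And>x. x \<in> topspace X \<Longrightarrow> x \<in> S \<Longrightarrow> h x = f x"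
    and "\<And>x. x \<in> topspace X \<Longrightarrow> x \<in> T \<Longrightarrow> h x = g x"
  shows "continuous_map X Y h"
proof (rule pasting_lemma[where I = "{True, False}" and T = "\<lambda>b. if b then S else T"
      and f = "\<lambda>b. if b then f else g"])
  fix i j x
  assume "x \<in> topspace X \<inter> (if i then S else T) \<inter> (if j then S else T)"
  then show "(if i then f else g) x = (if j then f else g) x"
    using assms(6,7)[of x] by (auto split: if_splits)
next
  fix x assume "x \<in> topspace X"
  then show "\<exists>j. j \<in> {True, False} \<and> x \<in> (if j then S else T) \<and> h x = (if j then f else g) x"
    using assms(3) assms(6,7)[of x] by (cases "x \<in> S") (auto intro: exI[of _ True] exI[of _ False])
next
  fix i :: bool
  show "openin X (if i then S else T)" using assms(1,2) by simp
  show "continuous_map (subtopology X (if i then S else T)) Y (if i then f else g)"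
    using assms(4,5) by simp
qed

lemma openin_prod_topology_box:
  assumes "openin (prod_topology X Y) W" "(x, y) \<in> W"
  obtains U V where "openin X U" "openin Y V" "x \<in> U" "y \<in> V" "U \<times> V \<subseteq> W"
proof -
  have "\<exists>U V. openin X U \<and> openin Y V \<and> x \<in> U \<and> y \<in> V \<and> U \<times> V \<subseteq> W"
    using assms(1)[unfolded openin_prod_topology_alt, rule_format, OF assms(2)] .
  then show ?thesis by (elim exE conjE) (rule that)
qed

section \<open>Evenly covered sets; lifting of homotopies and paths\<close>

lemma covering_map_continuous: "covering_map E X p \<Longrightarrow> continuous_map E X p"
  by (simp add: covering_map_def)

lemma covering_map_image: "covering_map E X p \<Longrightarrow> p ` topspace E = topspace X"
  by (simp add: covering_map_def)

lemma covering_map_sheets: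
  assumes "covering_map E X p" "x \<in> topspace X"
  obtains U \<V> where "x \<in> U" "openin X U" "\<Union>\<V> = topspace E \<inter> p -` U"
    "\<And>V. V \<in> \<V> \<Longrightarrow> openin E V" "pairwise disjnt \<V>"
    "\<And>V. V \<in> \<V> \<Longrightarrow> homeomorphic_map (subtopology E V) (subtopology X U) p"
proof -
  have "\<exists>U. x \<in> U \<and> openin X U \<and>
        (\<exists>\<V>. \<Union>\<V> = topspace E \<inter> p -` U \<and> (\<forall>V \<in> \<V>. openin E V) \<and> pairwise disjnt \<V> \<and>
             (\<forall>V \<in> \<V>. homeomorphic_map (subtopology E V) (subtopology X U) p))"
    using assms unfolding covering_map_def by blast
  then show ?thesis by (elim exE conjE) (rule that, auto)
qed

lemma homeomorphic_map_openin_inj_on: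
  assumes "homeomorphic_map (subtopology E V) (subtopology X U) p" "openin E V"
  shows "inj_on p V"
  using assms openin_subset[of E V] unfolding homeomorphic_map_def by (simp add: Int_absorb1)

lemma homeomorphic_map_openin_inverse:
  assumes "homeomorphic_map (subtopology E V) (subtopology X U) p" "openin E V" "openin X U"
  obtains g where "continuous_map (subtopology X U) E g" "\<And>u. u \<in> U \<Longrightarrow> g u \<in> V"
    "\<And>u. u \<in> U \<Longrightarrow> p (g u) = u" "\<And>v. v \<in> V \<Longrightarrow> g (p v) = v" "p ` V = U" "inj_on p V"
proof -
  have tV: "topspace (subtopology E V) = V" "topspace (subtopology X U) = U"
    using assms(2,3) openin_subset by fastforce+
  obtain g where g: "homeomorphic_maps (subtopology E V) (subtopology X U) p g"
    using assms(1) homeomorphic_map_maps by blast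
  show ?thesis
  proof (rule that)
    show "continuous_map (subtopology X U) E g"
      using g unfolding homeomorphic_maps_def continuous_map_in_subtopology by auto
    show "g u \<in> V" if "u \<in> U" for u
      using g that tV unfolding homeomorphic_maps_def continuous_map_def by blast
    show "p (g u) = u" if "u \<in> U" for u using g that tV unfolding homeomorphic_maps_def by blast
    show "g (p v) = v" if "v \<in> V" for v using g that tV unfolding homeomorphic_maps_def by blast
    show "p ` V = U" using homeomorphic_imp_surjective_map[OF assms(1)] tV by simp
    show "inj_on p V" using assms(1) tV unfolding homeomorphic_map_def by simp
  qed
qed

text \<open>The parameters where the lifts agree and those where they differ both form open sets:
  the two values lie in sheets over the same evenly covered set, and these sheets are either equal,
  with \<open>p\<close> injective there, or disjoint.\<close>

lemma covering_map_lift_unique: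
  assumes cov: "covering_map E X p" and "connected_space P"
    and f: "continuous_map P E f" and g: "continuous_map P E g"
    and pfg: "\<And>s. s \<in> topspace P \<Longrightarrow> p (f s) = p (g s)"
    and a: "a \<in> topspace P" "f a = g a" and s: "s \<in> topspace P"
  shows "f s = g s"
proof -
  let ?S = "{s \<in> topspace P. f s = g s}"
  let ?D = "{s \<in> topspace P. f s \<noteq> g s}"
  have fE: "f s \<in> topspace E" and gE: "g s \<in> topspace E" if "s \<in> topspace P" for s
    using that f g unfolding continuous_map_def by auto
  have pX: "p (f s) \<in> topspace X" if "s \<in> topspace P" for s
    using fE[OF that] covering_map_image[OF cov] by blast
  have pre: "openin P {s \<in> topspace P. f s \<in> V}" "openin P {s \<in> topspace P. g s \<in> V}"
    if "openin E V" for V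
    using that f g openin_continuous_map_preimage by blast+
  have oS: "openin P ?S"
  proof (subst openin_subopen, clarify)
    fix s assume s: "s \<in> topspace P" "f s = g s"
    obtain U \<V> where U: "p (f s) \<in> U" "openin X U" "\<Union>\<V> = topspace E \<inter> p -` U"
      "\<And>V. V \<in> \<V> \<Longrightarrow> openin E V" "pairwise disjnt \<V>"
      "\<And>V. V \<in> \<V> \<Longrightarrow> homeomorphic_map (subtopology E V) (subtopology X U) p"
      using covering_map_sheets[OF cov pX[OF s(1)]] by metis
    then obtain V where V: "V \<in> \<V>" "f s \<in> V" using fE[OF s(1)] by blast
    have "inj_on p V" using homeomorphic_map_openin_inj_on[OF U(6) U(4)] V by blast
    then have "{s \<in> topspace P. f s \<in> V} \<inter> {s \<in> topspace P. g s \<in> V} \<subseteq> ?S"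
      using pfg by (auto dest: inj_onD)
    then show "\<exists>T. openin P T \<and> s \<in> T \<and> T \<subseteq> ?S"
      by (intro exI[of _ "{s \<in> topspace P. f s \<in> V} \<inter> {s \<in> topspace P. g s \<in> V}"] conjI
          openin_Int pre U(4) V(1)) (use s V in simp_all)
  qed
  have oD: "openin P ?D"
  proof (subst openin_subopen, clarify)
    fix s assume s: "s \<in> topspace P" "f s \<noteq> g s"
    obtain U \<V> where U: "p (f s) \<in> U" "openin X U" "\<Union>\<V> = topspace E \<inter> p -` U"
      "\<And>V. V \<in> \<V> \<Longrightarrow> openin E V" "pairwise disjnt \<V>"
      "\<And>V. V \<in> \<V> \<Longrightarrow> homeomorphic_map (subtopology E V) (subtopology X U) p"
      using covering_map_sheets[OF cov pX[OF s(1)]] by metis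
    then obtain V where V: "V \<in> \<V>" "f s \<in> V" using fE[OF s(1)] by blast
    have "g s \<in> \<Union>\<V>" unfolding U(3) using U(1) gE[OF s(1)] pfg[OF s(1)] by simp
    then obtain V' where V': "V' \<in> \<V>" "g s \<in> V'" by blast
    have "inj_on p V" using homeomorphic_map_openin_inj_on[OF U(6) U(4)] V by blast
    then have "V \<noteq> V'" using s V V' pfg[OF s(1)] unfolding inj_on_def by blast
    then have "disjnt V V'" using U(5) V V' by (simp add: pairwise_def)
    then have "{s \<in> topspace P. f s \<in> V} \<inter> {s \<in> topspace P. g s \<in> V'} \<subseteq> ?D"
      by (auto simp: disjnt_def)
    then show "\<exists>T. openin P T \<and> s \<in> T \<and> T \<subseteq> ?D"
      by (intro exI[of _ "{s \<in> topspace P. f s \<in> V} \<inter> {s \<in> topspace P. g s \<in> V'}"] conjI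
          openin_Int pre U(4) V(1) V'(1)) (use s V V' in simp_all)
  qed
  have "?S \<inter> ?D = {}" "topspace P \<subseteq> ?S \<union> ?D" "?S \<noteq> {}" using a by auto
  then have "?D = {}"
    using \<open>connected_space P\<close> oS oD unfolding connected_space_def by meson
  then show ?thesis using s by auto
qed

text \<open>Time is subdivided by the Bolzano principle. On a short interval around \<open>x\<close>
  the homotopy stays, near \<open>s0\<close>, in one evenly covered set and is lifted by the inverse
  of \<open>p\<close> on one sheet.\<close>

lemma covering_map_lift_homotopy_local:
  assumes cov: "covering_map E X p"
    and h: "continuous_map (prod_topology P (top_of_set {0..1::real})) X h"
    and f: "continuous_map P E f" "\<And>s. s \<in> topspace P \<Longrightarrow> p (f s) = h (s, 0)"
    and s0: "s0 \<in> topspace P"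
  shows "\<exists>N H. openin P N \<and> s0 \<in> N \<and>
    continuous_map (prod_topology (subtopology P N) (top_of_set {0..1})) E H \<and>
    (\<forall>s\<in>N. \<forall>t\<in>{0..1}. p (H (s, t)) = h (s, t)) \<and> (\<forall>s\<in>N. H (s, 0) = f s)"
proof -
  \<comment> \<open>Quantifying over all neighbourhoods \<open>M\<close> and all initial lifts
    \<open>f\<close> makes the property additive in the interval: the lift on \<open>[b, c]\<close>
    starts from the final values of the one on \<open>[a, b]\<close>, over a smaller
    neighbourhood.\<close>
  define Pr where "Pr \<equiv> \<lambda>a b. 0 \<le> a \<longrightarrow> a \<le> b \<longrightarrow> b \<le> (1::real) \<longrightarrow>
    (\<forall>M f. openin P M \<and> s0 \<in> M \<and> continuous_map (subtopology P M) E f \<and>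
       (\<forall>s\<in>M. p (f s) = h (s, a)) \<longrightarrow>
     (\<exists>N H. openin P N \<and> s0 \<in> N \<and> N \<subseteq> M \<and>
      continuous_map (prod_topology (subtopology P N) (top_of_set {a..b})) E H \<and>
      (\<forall>s\<in>N. \<forall>t\<in>{a..b}. p (H (s, t)) = h (s, t)) \<and> (\<forall>s\<in>N. H (s, a) = f s)))"
  have "Pr 0 1"
    using zero_le_one
  proof (induction rule: Bolzano)
    case (trans a b c)
    show ?case unfolding Pr_def
    proof (intro impI allI, elim conjE)
      fix M f assume abc: "0 \<le> a" "c \<le> 1" and M: "openin P M" "s0 \<in> M"
        "continuous_map (subtopology P M) E f" "\<forall>s\<in>M. p (f s) = h (s, a)"
      obtain N1 H1 where N1: "openin P N1" "s0 \<in> N1" "N1 \<subseteq> M"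
        "continuous_map (prod_topology (subtopology P N1) (top_of_set {a..b})) E H1"
        "\<forall>s\<in>N1. \<forall>t\<in>{a..b}. p (H1 (s, t)) = h (s, t)" "\<forall>s\<in>N1. H1 (s, a) = f s"
        using trans(1)[unfolded Pr_def, rule_format, of M f] abc trans(3,4) M by auto
      have "continuous_map (subtopology P N1) E (H1 \<circ> (\<lambda>s. (s, b)))"
        by (rule continuous_map_compose[OF _ N1(4)])
          (use trans in \<open>simp add: continuous_map_pairedI\<close>)
      then obtain N2 H2 where N2: "openin P N2" "s0 \<in> N2" "N2 \<subseteq> N1"
        "continuous_map (prod_topology (subtopology P N2) (top_of_set {b..c})) E H2"
        "\<forall>s\<in>N2. \<forall>t\<in>{b..c}. p (H2 (s, t)) = h (s, t)" "\<forall>s\<in>N2. H2 (s, b) = (H1 \<circ> (\<lambda>s. (s, b))) s"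
        using trans(2)[unfolded Pr_def, rule_format, of N1 "H1 \<circ> (\<lambda>s. (s, b))"] abc trans(3,4) N1
        by (auto)
      define H where "H \<equiv> \<lambda>(s, t). if t \<le> b then H1 (s, t) else H2 (s, t)"
      let ?Q = "prod_topology (subtopology P N2) (top_of_set {a..c})"
      have 1: "continuous_map ?Q E H"
      proof (rule continuous_map_paste_closed[where S = "N2 \<times> {a..b}" and T = "N2 \<times> {b..c}" and f = H1 and g = H2])
        have N2top: "topspace (subtopology P N2) = N2" using openin_subset[OF N2(1)] by auto
        have "closedin (subtopology P N2) N2" using closedin_topspace[of "subtopology P N2"] N2top by simp
        then show "closedin ?Q (N2 \<times> {a..b})" "closedin ?Q (N2 \<times> {b..c})"
          using trans by (auto simp: closedin_prod_Times_iff intro!: closed_subset)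
        show "topspace ?Q \<subseteq> N2 \<times> {a..b} \<union> N2 \<times> {b..c}" using N2top trans by auto
        have "subtopology ?Q (N2 \<times> {a..b}) = prod_topology (subtopology P N2) (top_of_set {a..b})"
          using trans by (simp add: subtopology_Times subtopology_subtopology Int_absorb1)
        moreover have "continuous_map (prod_topology (subtopology P N2) (top_of_set {a..b})) E H1"
          using continuous_map_from_subtopology[OF N1(4), of "N2 \<times> UNIV"] \<open>N2 \<subseteq> N1\<close>
          by (simp add: subtopology_Times subtopology_subtopology Int_absorb1)
        ultimately show "continuous_map (subtopology ?Q (N2 \<times> {a..b})) E H1" by simp
        have "subtopology ?Q (N2 \<times> {b..c}) = prod_topology (subtopology P N2) (top_of_set {b..c})"
          using trans by (simp add: subtopology_Times subtopology_subtopology Int_absorb1)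
        then show "continuous_map (subtopology ?Q (N2 \<times> {b..c})) E H2" using N2(4) by simp
      qed (use N2(6) in \<open>auto simp: H_def\<close>)
      show "\<exists>N H. openin P N \<and> s0 \<in> N \<and> N \<subseteq> M \<and>
          continuous_map (prod_topology (subtopology P N) (top_of_set {a..c})) E H \<and>
          (\<forall>s\<in>N. \<forall>t\<in>{a..c}. p (H (s, t)) = h (s, t)) \<and> (\<forall>s\<in>N. H (s, a) = f s)"
        using N1 N2 1 trans(3,4) by (intro exI[of _ N2] exI[of _ H]) (auto simp: H_def)
    qed
  next
    case (local x)
    have "h (s0, x) \<in> topspace X"
      using h s0 local unfolding continuous_map_def by auto
    then obtain U \<V> where U: "h (s0, x) \<in> U" "openin X U" "\<Union>\<V> = topspace E \<inter> p -` U"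
      "\<And>V. V \<in> \<V> \<Longrightarrow> openin E V" "pairwise disjnt \<V>"
      "\<And>V. V \<in> \<V> \<Longrightarrow> homeomorphic_map (subtopology E V) (subtopology X U) p"
      using covering_map_sheets[OF cov] by metis
    have "openin (prod_topology P (top_of_set {0..1::real})) {z \<in> topspace (prod_topology P (top_of_set {0..1::real})). h z \<in> U}"
      using h U(2) openin_continuous_map_preimage by blast
    then obtain N0 T where N0: "openin P N0" "openin (top_of_set {0..1}) T" "s0 \<in> N0" "x \<in> T"
      "N0 \<times> T \<subseteq> {z \<in> topspace (prod_topology P (top_of_set {0..1::real})). h z \<in> U}"
      by (rule openin_prod_topology_box[where x = s0 and y = x]) (use s0 local U(1) in auto)
    obtain d where d: "d > 0" "ball x d \<inter> {0..1} \<subseteq> T"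
      using N0(2,4) by (metis openin_contains_ball)
    show ?case
    proof (intro exI[of _ d] conjI allI impI, fact d, unfold Pr_def, intro impI allI, elim conjE)
      fix a b M f
      assume ab: "a \<le> x" "x \<le> b" "b - a < d" "0 \<le> a" "b \<le> 1"
        and M: "openin P M" "s0 \<in> M"
        "continuous_map (subtopology P M) E f" "\<forall>s\<in>M. p (f s) = h (s, a)"
      have Mtop: "topspace (subtopology P M) = M" using openin_subset[OF M(1)] by auto
      have abT: "{a..b} \<subseteq> T"
      proof
        fix t assume "t \<in> {a..b}"
        then have "t \<in> ball x d \<inter> {0..1}" using ab by (auto simp: dist_real_def)
        then show "t \<in> T" using d by blast
      qed
      have fE: "f s \<in> topspace E" if "s \<in> M" for s using M(3) that Mtop unfolding continuous_map_def by blast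
      have "a \<in> T" using abT ab by auto
      then have "f s0 \<in> topspace E \<inter> p -` U" using N0 M fE by auto
      then obtain V where V: "V \<in> \<V>" "f s0 \<in> V" using U(3) by blast
      obtain g where g: "continuous_map (subtopology X U) E g" "\<And>u. u \<in> U \<Longrightarrow> g u \<in> V"
        "\<And>u. u \<in> U \<Longrightarrow> p (g u) = u" "\<And>v. v \<in> V \<Longrightarrow> g (p v) = v"
        using homeomorphic_map_openin_inverse[OF U(6) U(4) U(2)] V by metis
      define N where "N \<equiv> {s \<in> M. f s \<in> V} \<inter> N0"
      have "openin (subtopology P M) {s \<in> topspace (subtopology P M). f s \<in> V}"
        using M(3) U(4)[OF V(1)] openin_continuous_map_preimage by blast
      then have N: "openin P N" using M(1) N0(1) unfolding N_def Mtop
        by (simp add: openin_Int openin_open_subtopology)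
      have "continuous_map (prod_topology (subtopology P N) (top_of_set {a..b})) E (g \<circ> h)"
      proof (rule continuous_map_compose[OF _ g(1)])
        have "continuous_map (prod_topology (subtopology P N) (top_of_set {a..b})) X h"
          using continuous_map_from_subtopology[OF h, of "N \<times> {a..b}"] ab
          by (simp add: subtopology_Times subtopology_subtopology Int_absorb1)
        moreover have "h z \<in> U" if "z \<in> N \<times> {a..b}" for z using that N0(5) abT unfolding N_def by blast
        ultimately show "continuous_map (prod_topology (subtopology P N) (top_of_set {a..b})) (subtopology X U) h"
          by (auto simp: continuous_map_in_subtopology)
      qed
      moreover have "s0 \<in> N" "N \<subseteq> M" using M V N0 by (auto simp: N_def)
      moreover have "p ((g \<circ> h) (s, t)) = h (s, t)" if "s \<in> N" "t \<in> {a..b}" for s t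
      proof -
        have "(s, t) \<in> N0 \<times> T" using that abT unfolding N_def by blast
        then have "h (s, t) \<in> U" using N0(5) by blast
        then show ?thesis using g(3) by simp
      qed
      moreover have "(g \<circ> h) (s, a) = f s" if "s \<in> N" for s
        using that g M unfolding N_def by auto (metis)
      ultimately show "\<exists>N H. openin P N \<and> s0 \<in> N \<and> N \<subseteq> M \<and>
          continuous_map (prod_topology (subtopology P N) (top_of_set {a..b})) E H \<and>
          (\<forall>s\<in>N. \<forall>t\<in>{a..b}. p (H (s, t)) = h (s, t)) \<and> (\<forall>s\<in>N. H (s, a) = f s)"
        using N by blast
    qed
  qed
  then show ?thesis using f s0 unfolding Pr_def
    by (metis (no_types, lifting) openin_topspace order.refl subtopology_topspace zero_le_one)
qed

text \<open>For fixed \<open>s\<close>, two local lifts are lifts of the same path with the same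
  starting point \<open>f s\<close>, so they agree by uniqueness along the unit interval; hence the
  local lifts glue.\<close>

lemma covering_map_lift_homotopy:
  assumes cov: "covering_map E X p"
    and h: "continuous_map (prod_topology P (top_of_set {0..1::real})) X h"
    and f: "continuous_map P E f" "\<And>s. s \<in> topspace P \<Longrightarrow> p (f s) = h (s, 0)"
  obtains H where "continuous_map (prod_topology P (top_of_set {0..1::real})) E H"
    "\<And>s t. s \<in> topspace P \<Longrightarrow> t \<in> {0..1} \<Longrightarrow> p (H (s, t)) = h (s, t)"
    "\<And>s. s \<in> topspace P \<Longrightarrow> H (s, 0) = f s"
proof -
  let ?PI = "prod_topology P (top_of_set {0..1::real})"
  have "\<forall>s0\<in>topspace P. \<exists>N H. openin P N \<and> s0 \<in> N \<and>
    continuous_map (prod_topology (subtopology P N) (top_of_set {0..1})) E H \<and>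
    (\<forall>s\<in>N. \<forall>t\<in>{0..1}. p (H (s, t)) = h (s, t)) \<and> (\<forall>s\<in>N. H (s, 0) = f s)"
    using covering_map_lift_homotopy_local[OF assms] by blast
  then obtain N H where N: "\<And>s. s \<in> topspace P \<Longrightarrow> openin P (N s) \<and> s \<in> N s \<and>
    continuous_map (prod_topology (subtopology P (N s)) (top_of_set {0..1})) E (H s) \<and>
    (\<forall>s'\<in>N s. \<forall>t\<in>{0..1}. p (H s (s', t)) = h (s', t)) \<and> (\<forall>s'\<in>N s. H s (s', 0) = f s')"
    by metis
  have agree: "H s1 (s, t) = H s2 (s, t)"
    if "s1 \<in> topspace P" "s2 \<in> topspace P" "s \<in> N s1" "s \<in> N s2" "t \<in> {0..1}" for s1 s2 s t
  proof -
    have c: "continuous_map (top_of_set {0..1::real}) E (\<lambda>t. H s' (s, t))"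
      if "s' \<in> topspace P" "s \<in> N s'" for s'
    proof -
      have "continuous_map (top_of_set {0..1::real}) (prod_topology (subtopology P (N s')) (top_of_set {0..1})) (\<lambda>t. (s, t))"
        using that N openin_subset by (fastforce intro!: continuous_map_pairedI)
      then have "continuous_map (top_of_set {0..1::real}) E (H s' \<circ> (\<lambda>t. (s, t)))"
        using N[OF that(1)] continuous_map_compose by blast
      then show ?thesis by (simp add: o_def)
    qed
    show ?thesis
    proof (rule covering_map_lift_unique[OF cov _ c c, where a = 0])
      show "connected_space (top_of_set {0..1::real})" 
        by (simp add: connected_space_subtopology)
    qed (use that N in auto)
  qed
  have "continuous_map ?PI E (\<lambda>(s, t). H s (s, t))"
  proof (rule pasting_lemma[where I = "topspace P" and T = "\<lambda>s. N s \<times> {0..1}" and f = H])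
    show "openin ?PI (N s \<times> {0..1})" if "s \<in> topspace P" for s
      using N[OF that] by (auto simp: openin_prod_Times_iff)
    show "continuous_map (subtopology ?PI (N s \<times> {0..1})) E (H s)" if "s \<in> topspace P" for s
      using N[OF that] by (simp add: subtopology_Times subtopology_subtopology)
  next
    fix x assume x: "x \<in> topspace ?PI"
    then show "\<exists>j. j \<in> topspace P \<and> x \<in> N j \<times> {0..1} \<and> (case x of (s, t) \<Rightarrow> H s (s, t)) = H j x"
      using N[of "fst x"] by (intro exI[of _ "fst x"]) (auto simp: case_prod_beta)
  next
    fix i j x
    assume "i \<in> topspace P" "j \<in> topspace P" "x \<in> topspace ?PI \<inter> (N i \<times> {0..1}) \<inter> (N j \<times> {0..1})"
    then show "H i x = H j x" using agree[of i j "fst x" "snd x"] by auto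
  qed
  then show ?thesis
    by (rule that) (use N in auto)
qed

lemma continuous_map_slice_left:
  assumes "continuous_map (prod_topology A B) Y h" "a \<in> topspace A"
  shows "continuous_map B Y (\<lambda>b. h (a, b))"
proof -
  have "continuous_map B Y (h \<circ> (\<lambda>b. (a, b)))"
    by (rule continuous_map_compose[OF _ assms(1)]) (use assms(2) in \<open>simp add: continuous_map_pairedI\<close>)
  then show ?thesis by (simp add: o_def)
qed

lemma continuous_map_slice_right:
  assumes "continuous_map (prod_topology A B) Y h" "b \<in> topspace B"
  shows "continuous_map A Y (\<lambda>a. h (a, b))"
proof -
  have "continuous_map A Y (h \<circ> (\<lambda>a. (a, b)))"
    by (rule continuous_map_compose[OF _ assms(1)]) (use assms(2) in \<open>simp add: continuous_map_pairedI\<close>)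
  then show ?thesis by (simp add: o_def)
qed

lemma pathin_reparam:
  assumes "pathin X g" "continuous_on {0..1} r" "r ` {0..1} \<subseteq> {0..1}"
  shows "pathin X (\<lambda>t. g (r t))"
proof -
  have "continuous_map (top_of_set {0..1}) X (g \<circ> r)"
    by (rule continuous_map_compose[where X' = "top_of_set {0..1}"])
      (use assms in \<open>auto simp: pathin_def continuous_map_in_subtopology\<close>)
  then show ?thesis by (simp add: pathin_def o_def)
qed

lemma pathin_path_concat:
  assumes "pathin X \<alpha>" "pathin X \<beta>" "\<alpha> 1 = \<beta> 0"
  shows "pathin X (path_concat \<alpha> \<beta>)"
  unfolding pathin_def
proof (rule continuous_map_paste_closed[where S = "{0..1/2}" and T = "{1/2..1}"
      and f = "\<lambda>t. \<alpha> (2 * t)" and g = "\<lambda>t. \<beta> (2 * t - 1)"])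
  show "closedin (top_of_set {0..1}) {0..1/2::real}" "closedin (top_of_set {0..1}) {1/2..1::real}"
    by (auto intro!: closed_subset)
  have 1: "continuous_map (top_of_set {0..1/2::real}) X (\<alpha> \<circ> (\<lambda>t. 2 * t))"
    by (rule continuous_map_compose[where X' = "top_of_set {0..1}"])
      (use assms in \<open>auto simp: pathin_def continuous_map_in_subtopology intro!: continuous_intros\<close>)
  have 2: "continuous_map (top_of_set {1/2..1::real}) X (\<beta> \<circ> (\<lambda>t. 2 * t - 1))"
    by (rule continuous_map_compose[where X' = "top_of_set {0..1}"])
      (use assms in \<open>auto simp: pathin_def continuous_map_in_subtopology intro!: continuous_intros\<close>)
  have e: "{0..1} \<inter> {0..1/2::real} = {0..1/2}" "{0..1} \<inter> {1/2..1::real} = {1/2..1}" by auto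
  show "continuous_map (subtopology (top_of_set {0..1}) {0..1/2}) X (\<lambda>t. \<alpha> (2 * t))"
    "continuous_map (subtopology (top_of_set {0..1}) {1/2..1}) X (\<lambda>t. \<beta> (2 * t - 1))"
    using 1 2 by (simp_all add: subtopology_subtopology o_def e del: atLeastatMost_subset_iff)
  show "path_concat \<alpha> \<beta> x = \<beta> (2 * x - 1)" if "x \<in> {1/2..1}" for x
  proof (cases "x = 1/2")
    case True
    then have "2 * x = 1" "x \<le> 1/2" by simp_all
    then show ?thesis using assms(3) by (simp add: path_concat_def)
  qed (use that in \<open>auto simp: path_concat_def\<close>)
qed (auto simp: path_concat_def)

text \<open>A path is a homotopy parametrized by the one-point space \<open>{0}\<close>.\<close>

lemma covering_map_lift_path:
  assumes cov: "covering_map E X p" and g: "pathin X g" and e: "e \<in> topspace E" "p e = g 0"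
  obtains \<delta> where "pathin E \<delta>" "\<And>t. t \<in> {0..1} \<Longrightarrow> p (\<delta> t) = g t" "\<delta> 0 = e"
proof -
  let ?P = "top_of_set {0::real}"
  have h: "continuous_map (prod_topology ?P (top_of_set {0..1::real})) X (g \<circ> snd)"
    by (rule continuous_map_compose[OF continuous_map_snd]) (use g in \<open>simp add: pathin_def\<close>)
  obtain H where H: "continuous_map (prod_topology ?P (top_of_set {0..1::real})) E H"
    "\<And>s t. s \<in> topspace ?P \<Longrightarrow> t \<in> {0..1} \<Longrightarrow> p (H (s, t)) = (g \<circ> snd) (s, t)"
    "\<And>s. s \<in> topspace ?P \<Longrightarrow> H (s, 0) = e"
    by (rule covering_map_lift_homotopy[OF cov h, of "\<lambda>_. e"]) (use e in auto)
  show ?thesis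
    by (rule that[of "\<lambda>t. H (0, t)"]) (use H continuous_map_slice_left[OF H(1)] in \<open>auto simp: pathin_def\<close>)
qed

lemma covering_map_lift_path_unique:
  assumes cov: "covering_map E X p" and a: "pathin E a" and b: "pathin E b"
    and "\<And>t. t \<in> {0..1} \<Longrightarrow> p (a t) = p (b t)" "t0 \<in> {0..1}" "a t0 = b t0" "t \<in> {0..1}"
  shows "a t = b t"
  by (rule covering_map_lift_unique[OF cov, of "top_of_set {0..1}" a b t0 t])
    (use assms in \<open>auto simp: pathin_def connected_space_subtopology\<close>)

lemma rel_homotopic_loopD:
  assumes "rel_homotopic (top_of_set {0..1::real}) {0, 1} X x \<alpha> \<beta>"
  obtains h where "continuous_map (prod_topology (top_of_set {0..1::real}) (top_of_set {0..1::real})) X h"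
    "\<And>t. h (0, t) = \<alpha> t" "\<And>t. h (1, t) = \<beta> t"
    "\<And>s. s \<in> {0..1} \<Longrightarrow> h (s, 0) = x" "\<And>s. s \<in> {0..1} \<Longrightarrow> h (s, 1) = x"
proof -
  obtain h where h: "continuous_map (prod_topology (top_of_set {0..1::real}) (top_of_set {0..1::real})) X h"
    "\<forall>t. h (0, t) = \<alpha> t" "\<forall>t. h (1, t) = \<beta> t"
    "\<forall>s\<in>{0..1}. (\<lambda>t. h (s, t)) ` {0, 1} \<subseteq> {x}"
    using assms unfolding rel_homotopic_def homotopic_with_def by blast
  show ?thesis by (rule that[OF h(1)]) (use h(2-4) in auto)
qed

text \<open>The homotopy is lifted with starting edge constant at \<open>a 0\<close>. Its edges at
  \<open>s = 0\<close> and \<open>s = 1\<close> are then \<open>a\<close> and \<open>b\<close>, and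
  its final edge lies over the single point \<open>x\<close>, so it is constant.\<close>

lemma covering_map_lift_rel_homotopic:
  assumes cov: "covering_map E X p"
    and hom: "rel_homotopic (top_of_set {0..1::real}) {0, 1} X x \<alpha> \<beta>"
    and a: "pathin E a" "\<And>t. t \<in> {0..1} \<Longrightarrow> p (a t) = \<alpha> t"
    and b: "pathin E b" "\<And>t. t \<in> {0..1} \<Longrightarrow> p (b t) = \<beta> t"
    and ab: "a 0 = b 0"
  shows "a 1 = b 1"
proof -
  let ?I = "top_of_set {0..1::real}"
  obtain h where h: "continuous_map (prod_topology ?I ?I) X h"
    "\<And>t. h (0, t) = \<alpha> t" "\<And>t. h (1, t) = \<beta> t"
    "\<And>s. s \<in> {0..1} \<Longrightarrow> h (s, 0) = x" "\<And>s. s \<in> {0..1} \<Longrightarrow> h (s, 1) = x"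
    using rel_homotopic_loopD[OF hom] by metis
  have a0: "a 0 \<in> topspace E" using a(1) unfolding pathin_def continuous_map_def by auto
  have "p (a 0) = x" using a(2)[of 0] h(2)[of 0] h(4)[of 0] by simp
  then obtain H where H: "continuous_map (prod_topology ?I ?I) E H"
    "\<And>s t. s \<in> {0..1} \<Longrightarrow> t \<in> {0..1} \<Longrightarrow> p (H (s, t)) = h (s, t)"
    "\<And>s. s \<in> {0..1} \<Longrightarrow> H (s, 0) = a 0"
    using covering_map_lift_homotopy[OF cov h(1), of "\<lambda>_. a 0"] a0 h(4) by auto
  have p: "pathin E (\<lambda>t. H (0, t))" "pathin E (\<lambda>t. H (1, t))" "pathin E (\<lambda>s. H (s, 1))"
    using continuous_map_slice_left[OF H(1)] continuous_map_slice_right[OF H(1)]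
    by (auto simp: pathin_def)
  have H01: "H (0, 1) \<in> topspace E" using p(1) by (auto simp: pathin_def continuous_map_def)
  have "H (0, 1) = a 1"
    by (rule covering_map_lift_path_unique[OF cov p(1) a(1), of 0]) (use H a h in auto)
  moreover have "H (1, 1) = b 1"
    by (rule covering_map_lift_path_unique[OF cov p(2) b(1), of 0]) (use H b h ab in auto)
  moreover have "H (1, 1) = H (0, 1)"
    by (rule covering_map_lift_path_unique[OF cov p(3), of "\<lambda>_. H (0, 1)" 0])
      (use H(2) h(5) p(3) H01 in \<open>auto simp: pathin_def\<close>)
  ultimately show ?thesis by simp
qed

lemma simply_connected_space_loop:
  assumes "simply_connected_space Y" "pathin Y l" "l 0 = y" "l 1 = y"
  shows "rel_homotopic (top_of_set {0..1::real}) {0, 1} Y y (\<lambda>_. y) l"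
proof -
  have y: "y \<in> topspace Y" using assms(2,3) unfolding pathin_def continuous_map_def by auto
  have "rel_class (top_of_set {0..1}) {0, 1} Y y l \<in> carrier (fundamental_group Y y)"
    using assms by (auto simp: fundamental_group_def rel_classes_def pathin_def)
  then have "rel_class (top_of_set {0..1}) {0, 1} Y y l = rel_class (top_of_set {0..1}) {0, 1} Y y (\<lambda>_. y)"
    using assms(1) y by (simp add: simply_connected_space_def fundamental_group_def)
  moreover have "l \<in> rel_class (top_of_set {0..1}) {0, 1} Y y l"
    using assms by (auto simp: rel_class_def rel_homotopic_def pathin_def)
  ultimately show ?thesis by (simp add: rel_class_def)
qed

lemma rel_homotopic_compose:
  assumes "rel_homotopic D A X x \<alpha> \<beta>" "continuous_map X Y f"
  shows "rel_homotopic D A Y (f x) (f \<circ> \<alpha>) (f \<circ> \<beta>)"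
  using assms unfolding rel_homotopic_def
  by (rule homotopic_with_compose_continuous_map_left) auto

text \<open>This makes the lift in the lifting criterion independent of the chosen path. Running
  through \<open>\<delta>\<close> and back along \<open>\<delta>'\<close> gives a null-homotopic
  loop, so the lift \<open>c\<close> of its image is closed; the first half of \<open>c\<close> is
  \<open>a\<close>, and the second half, read backwards, is \<open>b\<close>.\<close>

lemma covering_map_lift_end_unique:
  assumes cov: "covering_map E X q" and sc: "simply_connected_space Y"
    and f: "continuous_map Y X f"
    and d: "pathin Y \<delta>" "pathin Y \<delta>'" "\<delta> 0 = \<delta>' 0" "\<delta> 1 = \<delta>' 1"
    and a: "pathin E a" "\<And>t. t \<in> {0..1} \<Longrightarrow> q (a t) = f (\<delta> t)"
    and b: "pathin E b" "\<And>t. t \<in> {0..1} \<Longrightarrow> q (b t) = f (\<delta>' t)"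
    and ab: "a 0 = b 0"
  shows "a 1 = b 1"
proof -
  let ?y = "\<delta> 0"
  define l where "l = path_concat \<delta> (\<lambda>t. \<delta>' (1 - t))"
  have r: "pathin Y (\<lambda>t. \<delta>' (1 - t))"
    by (rule pathin_reparam[OF d(2)]) (auto intro!: continuous_intros)
  have l: "pathin Y l" unfolding l_def by (rule pathin_path_concat[OF d(1) r]) (simp add: d)
  have l01: "l 0 = ?y" "l 1 = ?y" by (auto simp: l_def path_concat_def d)
  have hom: "rel_homotopic (top_of_set {0..1::real}) {0, 1} X (f ?y) (f \<circ> (\<lambda>_. ?y)) (f \<circ> l)"
    by (rule rel_homotopic_compose[OF simply_connected_space_loop[OF sc l l01] f])
  have a0: "a 0 \<in> topspace E" using a(1) unfolding pathin_def continuous_map_def by auto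
  have fl: "pathin X (f \<circ> l)" using pathin_compose[OF l f] .
  obtain c where c: "pathin E c" "\<And>t. t \<in> {0..1} \<Longrightarrow> q (c t) = (f \<circ> l) t" "c 0 = a 0"
    by (rule covering_map_lift_path[OF cov fl a0]) (use a(2)[of 0] l01 in auto)
  have "a 0 = c 1"
    by (rule covering_map_lift_rel_homotopic[OF cov hom, of "\<lambda>_. a 0" c])
      (use a0 c a(2)[of 0] in \<open>auto simp: pathin_def\<close>)
  have r2: "pathin E (\<lambda>t. c (t * (1/2)))"
    by (rule pathin_reparam[OF c(1)]) (auto intro!: continuous_intros)
  have "c (1 * (1/2)) = a 1"
    by (rule covering_map_lift_path_unique[OF cov, of "\<lambda>t. c (t * (1/2))" a 0])
      (use a c r2 in \<open>auto simp: l_def path_concat_def\<close>)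
  moreover have "c (1 - 1 * (1/2)) = b 1"
  proof (rule covering_map_lift_path_unique[OF cov, of "\<lambda>t. c (1 - t * (1/2))" b 0])
    show "pathin E (\<lambda>t. c (1 - t * (1/2)))"
      by (rule pathin_reparam[OF c(1)]) (auto intro!: continuous_intros)
    \<comment> \<open>At \<open>t = 1\<close> the parameter is \<open>1/2\<close>, which
      \<open>path_concat\<close> assigns to the first path; there
      \<open>\<delta> 1 = \<delta>' 1\<close> is needed.\<close>
    show "q (c (1 - t * (1/2))) = q (b t)" if "t \<in> {0..1}" for t
      using that c(2)[of "1 - t * (1/2)"] b(2)[of t] d(4)
      by (cases "t = 1") (auto simp: l_def path_concat_def)
  qed (use b \<open>a 0 = c 1\<close> ab in auto)
  ultimately show ?thesis by simp
qed

section \<open>The lifting criterion and the uniqueness of universal coverings\<close>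

lemma covering_map_local_section:
  assumes cov: "covering_map E X p" and e: "e \<in> topspace E"
  obtains U V s where "openin X U" "openin E V" "e \<in> V" "continuous_map (subtopology X U) E s"
    "\<And>u. u \<in> U \<Longrightarrow> s u \<in> V" "\<And>u. u \<in> U \<Longrightarrow> p (s u) = u"
    "\<And>v. v \<in> V \<Longrightarrow> s (p v) = v" "\<And>v. v \<in> V \<Longrightarrow> p v \<in> U"
proof -
  have "p e \<in> topspace X" using covering_map_image[OF cov] e by blast
  then obtain U \<V> where U: "p e \<in> U" "openin X U" "\<Union>\<V> = topspace E \<inter> p -` U"
    "\<And>V. V \<in> \<V> \<Longrightarrow> openin E V" "pairwise disjnt \<V>"
    "\<And>V. V \<in> \<V> \<Longrightarrow> homeomorphic_map (subtopology E V) (subtopology X U) p"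
    using covering_map_sheets[OF cov] by metis
  have "e \<in> \<Union>\<V>" unfolding U(3) using U(1) e by simp
  then obtain V where V: "V \<in> \<V>" "e \<in> V" by blast
  obtain s where s: "continuous_map (subtopology X U) E s" "\<And>u. u \<in> U \<Longrightarrow> s u \<in> V"
    "\<And>u. u \<in> U \<Longrightarrow> p (s u) = u" "\<And>v. v \<in> V \<Longrightarrow> s (p v) = v" "p ` V = U"
    using homeomorphic_map_openin_inverse[OF U(6) U(4) U(2)] V by metis
  show ?thesis by (rule that[OF U(2) U(4)[OF V(1)] V(2) s(1-4)]) (use s(5) in blast)+
qed

text \<open>The value \<open>g y\<close> is the end point of the lift, starting at
  \<open>e0\<close>, of the image of a path from \<open>y0\<close> to \<open>y\<close>. For
  continuity at \<open>z\<close>, a fixed path to \<open>z\<close> is prolonged inside a path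
  connected neighbourhood, where the lift is given by a local section.\<close>

theorem covering_map_lift_simply_connected:
  assumes cov: "covering_map E X q" and sc: "simply_connected_space Y"
    and lpc: "locally_path_connected_space Y" and f: "continuous_map Y X f"
    and y0: "y0 \<in> topspace Y" and e0: "e0 \<in> topspace E" "q e0 = f y0"
  obtains g where "continuous_map Y E g" "\<And>y. y \<in> topspace Y \<Longrightarrow> q (g y) = f y" "g y0 = e0"
proof -
  \<comment> \<open>\<open>L y \<delta> a\<close> says that \<open>\<delta>\<close> is an admissible
    path to \<open>y\<close> and \<open>a\<close> the lift of its image.\<close>
  define L where "L \<equiv> \<lambda>y \<delta> a. pathin Y \<delta> \<and> \<delta> 0 = y0 \<and> \<delta> 1 = y \<and> pathin E a \<and>
      (\<forall>t\<in>{0..1}. q (a t) = f (\<delta> t)) \<and> a 0 = e0"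
  define g where "g \<equiv> \<lambda>y. SOME e. \<exists>\<delta> a. L y \<delta> a \<and> a 1 = e"
  have ex: "\<exists>\<delta> a. L y \<delta> a" if y: "y \<in> topspace Y" for y
  proof -
    have "path_connected_space Y" using sc by (simp add: simply_connected_space_def)
    then obtain \<delta> where d: "pathin Y \<delta>" "\<delta> 0 = y0" "\<delta> 1 = y"
      unfolding path_connected_space_def using y0 y by blast
    obtain a where "pathin E a" "\<And>t. t \<in> {0..1} \<Longrightarrow> q (a t) = (f \<circ> \<delta>) t" "a 0 = e0"
      by (rule covering_map_lift_path[OF cov pathin_compose[OF d(1) f] e0(1)]) (use e0 d in auto)
    then show ?thesis unfolding L_def using d by (intro exI[of _ \<delta>] exI[of _ a]) auto
  qed
  have g: "g y = a 1" if "L y \<delta> a" for y \<delta> a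
  proof -
    have "\<exists>\<delta> a. L y \<delta> a \<and> a 1 = g y" unfolding g_def by (rule someI_ex) (use that in blast)
    then obtain \<delta>' a' where "L y \<delta>' a'" "a' 1 = g y" by blast
    then show ?thesis
      using covering_map_lift_end_unique[OF cov sc f, of \<delta> \<delta>' a a'] that unfolding L_def by auto
  qed
  have qg: "q (g y) = f y" if y: "y \<in> topspace Y" for y
  proof -
    obtain \<delta> a where La: "L y \<delta> a" using ex[OF y] by blast
    then show ?thesis using g[OF La] unfolding L_def by auto
  qed
  have gE: "g y \<in> topspace E" if y: "y \<in> topspace Y" for y
  proof -
    obtain \<delta> a where La: "L y \<delta> a" using ex[OF y] by blast
    then show ?thesis using g[OF La] unfolding L_def pathin_def continuous_map_def by auto
  qed
  have loc: "\<exists>N. openin Y N \<and> z \<in> N \<and> continuous_map (subtopology Y N) E g" if z: "z \<in> topspace Y" for z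
  proof -
    obtain U V s where U: "openin X U" "openin E V" "g z \<in> V" "continuous_map (subtopology X U) E s"
      "\<And>u. u \<in> U \<Longrightarrow> s u \<in> V" "\<And>u. u \<in> U \<Longrightarrow> q (s u) = u"
      "\<And>v. v \<in> V \<Longrightarrow> s (q v) = v" "\<And>v. v \<in> V \<Longrightarrow> q v \<in> U"
      by (rule covering_map_local_section[OF cov gE[OF z]]) blast
    have fzU: "f z \<in> U" using U(8)[OF U(3)] qg[OF z] by simp
    have "openin Y {y \<in> topspace Y. f y \<in> U}" using f U(1) openin_continuous_map_preimage by blast
    then obtain N where N: "openin Y N" "path_connectedin Y N" "z \<in> N" "N \<subseteq> {y \<in> topspace Y. f y \<in> U}"
      using lpc z fzU unfolding locally_path_connected_space by (metis (mono_tags, lifting) mem_Collect_eq)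
    have Ntop: "topspace (subtopology Y N) = N" using openin_subset[OF N(1)] by auto
    \<comment> \<open>The chosen path to \<open>z\<close> followed by a path \<open>\<gamma>\<close>
      in \<open>N\<close> is admissible for \<open>z'\<close>, and its lift ends with
      \<open>s \<circ> f \<circ> \<gamma>\<close>.\<close>
    have eq: "s (f z') = g z'" if z': "z' \<in> N" for z'
    proof -
      obtain \<gamma> where gam: "pathin (subtopology Y N) \<gamma>" "\<gamma> 0 = z" "\<gamma> 1 = z'"
        using N(2,3) z' Ntop unfolding path_connectedin_def path_connected_space_def by metis
      have gY: "pathin Y \<gamma>" and gN: "\<And>t. t \<in> {0..1} \<Longrightarrow> \<gamma> t \<in> N"
        using gam(1) by (auto simp: pathin_def continuous_map_in_subtopology)
      obtain \<delta> a where La: "L z \<delta> a" using ex[OF z] by blast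
      have gU: "f (\<gamma> t) \<in> U" if "t \<in> {0..1}" for t using gN[OF that] N(4) by blast
      have fg: "pathin (subtopology X U) (f \<circ> \<gamma>)"
        using pathin_compose[OF gY f] gU by (auto simp: pathin_def continuous_map_in_subtopology)
      have sfg: "pathin E (s \<circ> (f \<circ> \<gamma>))" by (rule pathin_compose[OF fg U(4)])
      have "s (f z) = g z" using U(7)[OF U(3)] qg[OF z] by simp
      then have a1: "a 1 = (s \<circ> (f \<circ> \<gamma>)) 0" using g[OF La] gam by simp
      have "q (s (f (\<gamma> t))) = f (\<gamma> t)" if "t \<in> {0..1}" for t using U(6) gN[OF that] N(4) by blast
      then have "L z' (path_concat \<delta> \<gamma>) (path_concat a (s \<circ> (f \<circ> \<gamma>)))"
        using La gam(2,3) a1 gY sfg unfolding L_def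
        by (auto intro!: pathin_path_concat) (auto simp: path_concat_def)
      from g[OF this] show ?thesis using gam(3) by (simp add: path_concat_def)
    qed
    have "continuous_map (subtopology Y N) E (s \<circ> f)"
      by (rule continuous_map_compose[OF _ U(4)])
        (use continuous_map_from_subtopology[OF f] N(4) in \<open>auto simp: continuous_map_in_subtopology\<close>)
    then have "continuous_map (subtopology Y N) E g"
      by (rule continuous_map_eq) (use eq Ntop in auto)
    then show ?thesis using N by blast
  qed
  then obtain N where N: "\<And>z. z \<in> topspace Y \<Longrightarrow> openin Y (N z) \<and> z \<in> N z \<and> continuous_map (subtopology Y (N z)) E g"
    by metis
  have "continuous_map Y E g"
    by (rule pasting_lemma[where I = "topspace Y" and T = N and f = "\<lambda>_. g"]) (use N in auto)
  moreover have "L y0 (\<lambda>_. y0) (\<lambda>_. e0)" unfolding L_def using y0 e0 by (auto simp: pathin_def)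
  ultimately show ?thesis using that qg g by metis
qed

lemma covering_map_locally_path_connected:
  assumes cov: "covering_map E X p" and "locally_path_connected_space X"
  shows "locally_path_connected_space E"
  unfolding locally_path_connected_space
proof (intro allI impI, elim conjE)
  fix W e assume W: "openin E W" "e \<in> W"
  then have e: "e \<in> topspace E" using openin_subset by blast
  then obtain U V s where U: "openin X U" "openin E V" "e \<in> V" "continuous_map (subtopology X U) E s"
    "\<And>u. u \<in> U \<Longrightarrow> s u \<in> V" "\<And>u. u \<in> U \<Longrightarrow> p (s u) = u"
    "\<And>v. v \<in> V \<Longrightarrow> s (p v) = v" "\<And>v. v \<in> V \<Longrightarrow> p v \<in> U"
    by (rule covering_map_local_section[OF cov]) blast
  have Utop: "topspace (subtopology X U) = U" using openin_subset[OF U(1)] by auto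
  have "openin (subtopology X U) {u \<in> topspace (subtopology X U). s u \<in> W}"
    using U(4) W openin_continuous_map_preimage by blast
  then have "openin X {u \<in> U. s u \<in> W}" unfolding Utop using U(1) by (simp add: openin_open_subtopology)
  moreover have "p e \<in> {u \<in> U. s u \<in> W}" using U(3,7,8) W by simp
  ultimately obtain N where N: "openin X N" "path_connectedin X N" "p e \<in> N" "N \<subseteq> {u \<in> U. s u \<in> W}"
    using assms(2) unfolding locally_path_connected_space by meson
  have sN: "s ` N = V \<inter> {v \<in> topspace E. p v \<in> N}"
  proof
    show "s ` N \<subseteq> V \<inter> {v \<in> topspace E. p v \<in> N}"
    proof clarify
      fix u assume u: "u \<in> N"
      then have "u \<in> U" using N(4) by blast
      then show "s u \<in> V \<inter> {v \<in> topspace E. p v \<in> N}"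
        using u U(5,6) openin_subset[OF U(2)] by auto
    qed
    show "V \<inter> {v \<in> topspace E. p v \<in> N} \<subseteq> s ` N"
      using U(7) by (metis (no_types, lifting) IntE image_eqI mem_Collect_eq subsetI)
  qed
  have "openin E (s ` N)" unfolding sN
    using U(2) N(1) covering_map_continuous[OF cov] openin_continuous_map_preimage by blast
  moreover have "path_connectedin E (s ` N)"
  proof (rule path_connectedin_continuous_map_image[OF U(4)])
    show "path_connectedin (subtopology X U) N" using N by (auto simp: path_connectedin_subtopology)
  qed
  moreover have "e \<in> s ` N" using N(3) U(7)[OF U(3)] by (metis imageI)
  moreover have "s ` N \<subseteq> W" using N(4) by auto
  ultimately show "\<exists>U. openin E U \<and> path_connectedin E U \<and> e \<in> U \<and> U \<subseteq> W" by blast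
qed

text \<open>Each projection lifts through the other, and both composites are lifts that fix a point,
  hence identities. With \<open>E = F\<close> this yields the deck transformations; with different
  spaces it identifies a concrete universal covering with a given one.\<close>

theorem universal_covering_homeomorphic:
  assumes E: "universal_covering E X p" and F: "universal_covering F X q"
    and lpc: "locally_path_connected_space X"
    and e: "e \<in> topspace E" and f: "f \<in> topspace F" and ef: "p e = q f"
  obtains g where "homeomorphic_map E F g" "\<And>z. z \<in> topspace E \<Longrightarrow> q (g z) = p z" "g e = f"
proof -
  have cE: "covering_map E X p" and cF: "covering_map F X q"
    and sE: "simply_connected_space E" and sF: "simply_connected_space F"
    using E F by (auto simp: universal_covering_def)
  have lE: "locally_path_connected_space E" and lF: "locally_path_connected_space F"
    using covering_map_locally_path_connected lpc cE cF by blast+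
  have connE: "connected_space E" and connF: "connected_space F"
    using sE sF by (auto simp: simply_connected_space_def path_connected_imp_connected_space)
  obtain g where g: "continuous_map E F g" "\<And>z. z \<in> topspace E \<Longrightarrow> q (g z) = p z" "g e = f"
    using covering_map_lift_simply_connected[OF cF sE lE covering_map_continuous[OF cE] e f] ef by metis
  obtain k where k: "continuous_map F E k" "\<And>z. z \<in> topspace F \<Longrightarrow> p (k z) = q z" "k f = e"
    using covering_map_lift_simply_connected[OF cE sF lF covering_map_continuous[OF cF] f e] ef by metis
  have gF: "g z \<in> topspace F" if "z \<in> topspace E" for z using g(1) that unfolding continuous_map_def by auto
  have kE: "k z \<in> topspace E" if "z \<in> topspace F" for z using k(1) that unfolding continuous_map_def by auto
  have "(k \<circ> g) z = id z" if "z \<in> topspace E" for z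
    by (rule covering_map_lift_unique[OF cE connE continuous_map_compose[OF g(1) k(1)] continuous_map_id _ e])
      (use that g k gF in auto)
  moreover have "(g \<circ> k) z = id z" if "z \<in> topspace F" for z
    by (rule covering_map_lift_unique[OF cF connF continuous_map_compose[OF k(1) g(1)] continuous_map_id _ f])
      (use that g k kE in auto)
  ultimately have "homeomorphic_maps E F g k"
    using g(1) k(1) unfolding homeomorphic_maps_def by auto
  then have "homeomorphic_map E F g" unfolding homeomorphic_map_maps by auto
  then show ?thesis using that g by blast
qed

section \<open>Restrictions and finite powers of coverings\<close>

lemma covering_map_subtopology:
  assumes cov: "covering_map E X p"
  shows "covering_map (subtopology E (p -` S)) (subtopology X S) p"
  unfolding covering_map_def
proof (intro conjI ballI)
  show "continuous_map (subtopology E (p -` S)) (subtopology X S) p"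
    using covering_map_continuous[OF cov]
    by (auto simp: continuous_map_in_subtopology intro: continuous_map_from_subtopology)
  show "p ` topspace (subtopology E (p -` S)) = topspace (subtopology X S)"
  proof -
    have "p ` (topspace E \<inter> p -` S) = p ` topspace E \<inter> S" by auto
    then show ?thesis using covering_map_image[OF cov] by simp
  qed
next
  fix x assume "x \<in> topspace (subtopology X S)"
  then have x: "x \<in> topspace X" "x \<in> S" by auto
  obtain U \<V> where U: "x \<in> U" "openin X U" "\<Union>\<V> = topspace E \<inter> p -` U"
    "\<And>V. V \<in> \<V> \<Longrightarrow> openin E V" "pairwise disjnt \<V>"
    "\<And>V. V \<in> \<V> \<Longrightarrow> homeomorphic_map (subtopology E V) (subtopology X U) p"
    using covering_map_sheets[OF cov x(1)] by metis
  let ?\<V> = "(\<lambda>V. V \<inter> p -` S) ` \<V>"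
  have "homeomorphic_map (subtopology (subtopology E (p -` S)) (V \<inter> p -` S)) (subtopology (subtopology X S) (U \<inter> S)) p"
    if V: "V \<in> \<V>" for V
  proof -
    have "p ` (topspace (subtopology E V) \<inter> (p -` S)) = topspace (subtopology X U) \<inter> S"
    proof -
      have "p ` (topspace (subtopology E V) \<inter> (p -` S)) = p ` topspace (subtopology E V) \<inter> S" by blast
      then show ?thesis using homeomorphic_imp_surjective_map[OF U(6)[OF V]] by simp
    qed
    then have "homeomorphic_map (subtopology (subtopology E V) (p -` S)) (subtopology (subtopology X U) S) p"
      by (rule homeomorphic_map_subtopologies[OF U(6)[OF V]])
    then show ?thesis by (simp add: subtopology_subtopology Int_ac)
  qed
  moreover have "\<Union>?\<V> = topspace (subtopology E (p -` S)) \<inter> p -` (U \<inter> S)" using U(3) by auto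
  moreover have "pairwise disjnt ?\<V>" using U(5) by (auto simp: pairwise_def disjnt_def)
  moreover have "\<forall>V\<in>?\<V>. openin (subtopology E (p -` S)) V" using U(4) by (auto simp: openin_subtopology)
  moreover have "openin (subtopology X S) (U \<inter> S)" using U(2) by (auto simp: openin_subtopology)
  ultimately show "\<exists>U'. x \<in> U' \<and> openin (subtopology X S) U' \<and>
    (\<exists>\<V>. \<Union>\<V> = topspace (subtopology E (p -` S)) \<inter> p -` U' \<and>
      (\<forall>V\<in>\<V>. openin (subtopology E (p -` S)) V) \<and> pairwise disjnt \<V> \<and>
      (\<forall>V\<in>\<V>. homeomorphic_map (subtopology (subtopology E (p -` S)) V)
             (subtopology (subtopology X S) U') p))"
    using x U(1) by (intro exI[of _ "U \<inter> S"] conjI exI[of _ ?\<V>]) auto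
qed

lemma topspace_power_space: "topspace (power_space n X) = {1..n} \<rightarrow>\<^sub>E topspace X"
  by (simp add: power_space_def)

lemma power_space_component: "i \<in> {1..n} \<Longrightarrow> continuous_map (power_space n X) X (\<lambda>z. z i)"
  unfolding power_space_def by (rule continuous_map_product_projection)

lemma continuous_map_into_power_space:
  "continuous_map P (power_space n X) f \<longleftrightarrow>
    f ` topspace P \<subseteq> extensional {1..n} \<and> (\<forall>i\<in>{1..n}. continuous_map P X (\<lambda>s. f s i))"
  unfolding power_space_def continuous_map_componentwise by auto

lemma continuous_map_power_map:
  assumes "continuous_map X Y f"
  shows "continuous_map (power_space n X) (power_space n Y) (power_map n f)"
  unfolding continuous_map_into_power_space
proof (intro conjI ballI)
  fix i assume i: "i \<in> {1..n}"
  have "continuous_map (power_space n X) Y (f \<circ> (\<lambda>z. z i))"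
    by (rule continuous_map_compose[OF power_space_component[OF i] assms])
  then show "continuous_map (power_space n X) Y (\<lambda>z. power_map n f z i)"
    using i by (simp add: power_map_def o_def)
qed (auto simp: power_map_def)

text \<open>Over a product of evenly covered sets \<open>U i\<close>, the sheets are the products of
  sheets, one for each function \<open>c\<close> that selects a sheet over every \<open>U i\<close>.
  These boxes are open because there are finitely many coordinates; two different boxes have
  disjoint sides in some coordinate.\<close>

lemma covering_map_power_map:
  assumes cov: "covering_map E X p"
  shows "covering_map (power_space n E) (power_space n X) (power_map n p)"
  unfolding covering_map_def
proof (intro conjI ballI)
  show "continuous_map (power_space n E) (power_space n X) (power_map n p)"
    by (rule continuous_map_power_map[OF covering_map_continuous[OF cov]])
  show "power_map n p ` topspace (power_space n E) = topspace (power_space n X)"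
  proof
    show "power_map n p ` topspace (power_space n E) \<subseteq> topspace (power_space n X)"
      using continuous_map_power_map[OF covering_map_continuous[OF cov]]
      unfolding continuous_map_def by blast
    show "topspace (power_space n X) \<subseteq> power_map n p ` topspace (power_space n E)"
    proof
      fix x assume x: "x \<in> topspace (power_space n X)"
      then have "\<forall>i\<in>{1..n}. \<exists>z\<in>topspace E. p z = x i"
        using covering_map_image[OF cov] unfolding topspace_power_space by (metis PiE_mem image_iff)
      then obtain z where z: "\<And>i. i \<in> {1..n} \<Longrightarrow> z i \<in> topspace E \<and> p (z i) = x i" by metis
      have "x = power_map n p (restrict z {1..n})"
        using x z unfolding topspace_power_space power_map_def by (auto simp: PiE_def extensional_def)
      moreover have "restrict z {1..n} \<in> topspace (power_space n E)"
        using z by (auto simp: topspace_power_space)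
      ultimately show "x \<in> power_map n p ` topspace (power_space n E)" by blast
    qed
  qed
next
  fix x assume x: "x \<in> topspace (power_space n X)"
  define Q where "Q \<equiv> \<lambda>i U \<V>. x i \<in> U \<and> openin X U \<and> \<Union>\<V> = topspace E \<inter> p -` U \<and>
    (\<forall>V\<in>\<V>. openin E V) \<and> pairwise disjnt \<V> \<and>
    (\<forall>V\<in>\<V>. homeomorphic_map (subtopology E V) (subtopology X U) p)"
  have "\<exists>U \<V>. Q i U \<V>" if "i \<in> {1..n}" for i
  proof -
    have "x i \<in> topspace X" using x that by (auto simp: topspace_power_space)
    then show ?thesis using cov unfolding covering_map_def Q_def by blast
  qed
  then obtain U \<V> where Q: "\<And>i. i \<in> {1..n} \<Longrightarrow> Q i (U i) (\<V> i)" by metis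
  let ?U = "PiE {1..n} U"
  let ?\<V> = "(\<lambda>c. PiE {1..n} c) ` PiE {1..n} \<V>"
  have c1: "\<Union>?\<V> = topspace (power_space n E) \<inter> power_map n p -` ?U"
  proof
    show "\<Union>?\<V> \<subseteq> topspace (power_space n E) \<inter> power_map n p -` ?U"
    proof clarify
      fix z c assume c: "c \<in> PiE {1..n} \<V>" and z: "z \<in> PiE {1..n} c"
      have "z i \<in> topspace E \<inter> p -` U i" if i: "i \<in> {1..n}" for i
      proof -
        have "z i \<in> \<Union>(\<V> i)" using c z i by (meson PiE_mem UnionI)
        then show ?thesis using Q[OF i] unfolding Q_def by simp
      qed
      then show "z \<in> topspace (power_space n E) \<inter> power_map n p -` ?U"
        using z by (auto simp: topspace_power_space power_map_def PiE_iff)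
    qed
    show "topspace (power_space n E) \<inter> power_map n p -` ?U \<subseteq> \<Union>?\<V>"
    proof
      fix z assume z: "z \<in> topspace (power_space n E) \<inter> power_map n p -` ?U"
      have "\<exists>V\<in>\<V> i. z i \<in> V" if i: "i \<in> {1..n}" for i
      proof -
        have "z i \<in> topspace E \<inter> p -` U i"
          using z i by (auto simp: topspace_power_space power_map_def PiE_iff)
        then have "z i \<in> \<Union>(\<V> i)" using Q[OF i] unfolding Q_def by simp
        then show ?thesis by blast
      qed
      then obtain c where c: "\<And>i. i \<in> {1..n} \<Longrightarrow> c i \<in> \<V> i \<and> z i \<in> c i" by metis
      have "z \<in> PiE {1..n} (restrict c {1..n})"
        using z c by (auto simp: topspace_power_space PiE_iff)
      moreover have "restrict c {1..n} \<in> PiE {1..n} \<V>" using c by auto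
      ultimately show "z \<in> \<Union>?\<V>" by blast
    qed
  qed
  have c2: "openin (power_space n E) V" if "V \<in> ?\<V>" for V
    using that Q unfolding power_space_def Q_def by (fastforce simp: openin_PiE_gen)
  have c3: "pairwise disjnt ?\<V>"
  proof (rule pairwiseI, clarify)
    fix c c' assume c: "c \<in> PiE {1..n} \<V>" "c' \<in> PiE {1..n} \<V>" "PiE {1..n} c \<noteq> PiE {1..n} c'"
    then obtain i where i: "i \<in> {1..n}" "c i \<noteq> c' i" by (metis PiE_cong)
    then have "disjnt (c i) (c' i)" using Q[OF i(1)] c unfolding Q_def pairwise_def by (metis PiE_mem)
    then show "disjnt (PiE {1..n} c) (PiE {1..n} c')" using i(1) unfolding disjnt_iff PiE_iff by blast
  qed
  have c4: "openin (power_space n X) ?U"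
    using Q unfolding power_space_def Q_def by (simp add: openin_PiE_gen)
  have c5: "x \<in> ?U" using x Q unfolding Q_def topspace_power_space by (auto simp: PiE_iff)
  have c6: "homeomorphic_map (subtopology (power_space n E) V) (subtopology (power_space n X) ?U) (power_map n p)"
    if "V \<in> ?\<V>" for V
  proof -
    obtain c where c: "c \<in> PiE {1..n} \<V>" "V = PiE {1..n} c" using \<open>V \<in> ?\<V>\<close> by blast
    have "\<exists>g. homeomorphic_maps (subtopology E (c i)) (subtopology X (U i)) p g" if "i \<in> {1..n}" for i
      using Q[OF that] c(1) that unfolding Q_def homeomorphic_map_maps[symmetric] by (metis PiE_mem)
    then obtain g where g: "\<And>i. i \<in> {1..n} \<Longrightarrow> homeomorphic_maps (subtopology E (c i)) (subtopology X (U i)) p (g i)"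
      by metis
    have e: "subtopology (power_space n E) V = product_topology (\<lambda>i. subtopology E (c i)) {1..n}"
      "subtopology (power_space n X) ?U = product_topology (\<lambda>i. subtopology X (U i)) {1..n}"
      by (simp_all add: power_space_def c(2) subtopology_product_topology)
    have comp: "continuous_map (product_topology A {1..n}) (product_topology B {1..n}) (\<lambda>z. \<lambda>i\<in>{1..n}. f i (z i))"
      if "\<And>i. i \<in> {1..n} \<Longrightarrow> continuous_map (A i) (B i) (f i)" for A :: "nat \<Rightarrow> 'x topology" and B :: "nat \<Rightarrow> 'y topology" and f
      unfolding continuous_map_componentwise
    proof (intro conjI ballI)
      fix i assume i: "i \<in> {1..n}"
      have "continuous_map (product_topology A {1..n}) (B i) (f i \<circ> (\<lambda>z. z i))"
        by (rule continuous_map_compose[where X' = "A i"]) (use i that in \<open>auto intro: continuous_map_product_projection\<close>)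
      then show "continuous_map (product_topology A {1..n}) (B i) (\<lambda>z. (\<lambda>i\<in>{1..n}. f i (z i)) i)"
        using i by (simp add: o_def)
    qed auto
    have "homeomorphic_maps (product_topology (\<lambda>i. subtopology E (c i)) {1..n})
        (product_topology (\<lambda>i. subtopology X (U i)) {1..n}) (power_map n p) (\<lambda>x. \<lambda>i\<in>{1..n}. g i (x i))"
      unfolding homeomorphic_maps_def power_map_def
    proof (intro conjI comp ballI)
      show "continuous_map (subtopology E (c i)) (subtopology X (U i)) p" if "i \<in> {1..n}" for i
        using g[OF that] by (simp add: homeomorphic_maps_def)
      show "continuous_map (subtopology X (U i)) (subtopology E (c i)) (g i)" if "i \<in> {1..n}" for i
        using g[OF that] by (simp add: homeomorphic_maps_def)
      fix z assume z: "z \<in> topspace (product_topology (\<lambda>i. subtopology E (c i)) {1..n})"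
      then have "g i (p (z i)) = z i" if "i \<in> {1..n}" for i
        using g[OF that] that unfolding homeomorphic_maps_def by (auto simp: PiE_iff)
      then show "(\<lambda>i\<in>{1..n}. g i ((\<lambda>i\<in>{1..n}. p (z i)) i)) = z"
        using z by (auto simp: PiE_def extensional_def)
    next
      fix z assume z: "z \<in> topspace (product_topology (\<lambda>i. subtopology X (U i)) {1..n})"
      then have "p (g i (z i)) = z i" if "i \<in> {1..n}" for i
        using g[OF that] that unfolding homeomorphic_maps_def by (auto simp: PiE_iff)
      then show "(\<lambda>i\<in>{1..n}. p ((\<lambda>i\<in>{1..n}. g i (z i)) i)) = z"
        using z by (auto simp: PiE_def extensional_def)
    qed
    then show ?thesis unfolding e homeomorphic_map_maps by auto
  qed
  show "\<exists>U. x \<in> U \<and> openin (power_space n X) U \<and>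
    (\<exists>\<V>. \<Union>\<V> = topspace (power_space n E) \<inter> power_map n p -` U \<and> (\<forall>V\<in>\<V>. openin (power_space n E) V) \<and>
      pairwise disjnt \<V> \<and> (\<forall>V\<in>\<V>. homeomorphic_map (subtopology (power_space n E) V)
         (subtopology (power_space n X) U) (power_map n p)))"
    by (intro exI[of _ ?U] conjI exI[of _ ?\<V>] ballI c1 c2 c3 c4 c5 c6)
qed

subsection \<open>Cubes and their boundaries\<close>

lemma topspace_cube: "topspace (cube k) = {..<k} \<rightarrow>\<^sub>E {0..1}"
  by (simp add: cube_def)

lemma cube_boundary_subset: "cube_boundary k \<subseteq> topspace (cube k)"
  by (auto simp: cube_boundary_def)

lemma topspace_subtopology_cube_boundary:
  "topspace (subtopology (cube k) (cube_boundary k)) = cube_boundary k"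
  using cube_boundary_subset by auto

lemma continuous_map_cube_component:
  assumes "i < k"
  shows "continuous_map (cube k) (top_of_set {0..1}) (\<lambda>t. t i)"
  unfolding cube_def using assms by (intro continuous_map_product_projection) auto

lemma continuous_map_cube_component_real [continuous_intros]:
  assumes "i < k"
  shows "continuous_map (cube k) euclideanreal (\<lambda>t. t i)"
  using continuous_map_cube_component[OF assms] by (simp add: continuous_map_in_subtopology)

lemma continuous_map_into_cube:
  "continuous_map P (cube k) f \<longleftrightarrow> f ` topspace P \<subseteq> extensional {..<k} \<and>
    (\<forall>i<k. continuous_map P euclideanreal (\<lambda>s. f s i) \<and> (\<forall>s\<in>topspace P. f s i \<in> {0..1}))"
  unfolding cube_def continuous_map_componentwise continuous_map_in_subtopology
  by (simp only: Pi_iff Ball_def lessThan_iff)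

lemma closedin_cube_boundary: "closedin (cube k) (cube_boundary k)"
proof -
  have "cube_boundary k = (\<Union>i<k. {t \<in> topspace (cube k). t i \<in> {0, 1}})"
    by (auto simp: cube_boundary_def)
  moreover have "closedin (cube k) {t \<in> topspace (cube k). t i \<in> {0, 1}}" if "i < k" for i
    using continuous_map_cube_component_real[OF that]
    by (rule closedin_continuous_map_preimage) (auto intro!: finite_imp_closed)
  ultimately show ?thesis by (auto intro!: closedin_Union)
qed

text \<open>The last coordinate is put first, where homotopies have their time parameter. This
  translates between homotopies of \<open>k\<close>-cubes and maps of cubes of dimension
  \<open>Suc k\<close>.\<close>

definition cube_split :: "nat \<Rightarrow> (nat \<Rightarrow> real) \<Rightarrow> real \<times> (nat \<Rightarrow> real)" where
  "cube_split k t = (t k, restrict t {..<k})"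

definition cube_join :: "nat \<Rightarrow> real \<times> (nat \<Rightarrow> real) \<Rightarrow> nat \<Rightarrow> real" where
  "cube_join k z = (\<lambda>i\<in>{..<Suc k}. if i = k then fst z else snd z i)"

lemma continuous_map_cube_split:
  "continuous_map (cube (Suc k)) (prod_topology (top_of_set {0..1}) (cube k)) (cube_split k)"
  unfolding cube_split_def
proof (intro continuous_map_pairedI continuous_map_cube_component)
  show "continuous_map (cube (Suc k)) (cube k) (\<lambda>t. restrict t {..<k})"
    unfolding continuous_map_into_cube
  proof (intro conjI allI impI ballI)
    fix i assume i: "i < k"
    then show "continuous_map (cube (Suc k)) euclideanreal (\<lambda>t. restrict t {..<k} i)"
      using continuous_map_cube_component_real[of i "Suc k"] by simp
    fix t assume "t \<in> topspace (cube (Suc k))"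
    then show "restrict t {..<k} i \<in> {0..1}" using i by (auto simp: topspace_cube PiE_iff)
  qed auto
qed simp

lemma continuous_map_cube_join:
  "continuous_map (prod_topology (top_of_set {0..1}) (cube k)) (cube (Suc k)) (cube_join k)"
  unfolding continuous_map_into_cube
proof (intro conjI allI impI)
  fix i assume i: "i < Suc k"
  have f: "continuous_map (prod_topology (top_of_set {0..1::real}) (cube k)) euclideanreal fst"
    using continuous_map_fst[of "top_of_set {0..1::real}" "cube k"]
    by (simp add: continuous_map_in_subtopology)
  show "continuous_map (prod_topology (top_of_set {0..1}) (cube k)) euclideanreal (\<lambda>s. cube_join k s i)"
  proof (cases "i = k")
    case True
    then show ?thesis using f by (simp add: cube_join_def)
  next
    case False
    then have "i < k" using i by simp
    then have "continuous_map (prod_topology (top_of_set {0..1::real}) (cube k)) euclideanreal ((\<lambda>t. t i) \<circ> snd)"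
      by (intro continuous_map_compose[OF continuous_map_snd] continuous_map_cube_component_real)
    then show ?thesis using False i by (simp add: cube_join_def o_def)
  qed
  show "\<forall>s\<in>topspace (prod_topology (top_of_set {0..1}) (cube k)). cube_join k s i \<in> {0..1}"
    using i by (auto simp: cube_join_def topspace_cube PiE_iff)
qed (auto simp: cube_join_def)

lemma cube_join_split: "t \<in> topspace (cube (Suc k)) \<Longrightarrow> cube_join k (cube_split k t) = t"
  by (rule ext) (auto simp: cube_join_def cube_split_def topspace_cube PiE_def extensional_def restrict_def)

lemma cube_split_join: "s \<in> topspace (cube k) \<Longrightarrow> cube_split k (cube_join k (r, s)) = (r, s)"
  by (auto simp: cube_join_def cube_split_def topspace_cube PiE_def extensional_def restrict_def)

lemma cube_join_in: "r \<in> {0..1} \<Longrightarrow> s \<in> topspace (cube k) \<Longrightarrow> cube_join k (r, s) \<in> topspace (cube (Suc k))"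
  by (auto simp: cube_join_def topspace_cube PiE_iff)

lemma cube_join_boundary_iff:
  assumes "r \<in> {0..1}" "s \<in> topspace (cube k)"
  shows "cube_join k (r, s) \<in> cube_boundary (Suc k) \<longleftrightarrow> r = 0 \<or> r = 1 \<or> s \<in> cube_boundary k"
proof -
  have "(\<exists>i<Suc k. cube_join k (r, s) i = 0 \<or> cube_join k (r, s) i = 1) \<longleftrightarrow>
    r = 0 \<or> r = 1 \<or> (\<exists>i<k. s i = 0 \<or> s i = 1)"
    unfolding Ex_less_Suc by (auto simp: cube_join_def)
  then show ?thesis using cube_join_in[OF assms] assms by (simp add: cube_boundary_def)
qed

lemma cube_Suc_cases:
  assumes "t \<in> topspace (cube (Suc k))"
  obtains r s where "t = cube_join k (r, s)" "r \<in> {0..1}" "s \<in> topspace (cube k)"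
proof (rule that[of "fst (cube_split k t)" "snd (cube_split k t)"])
  show "t = cube_join k (fst (cube_split k t), snd (cube_split k t))"
    using cube_join_split[OF assms] by simp
  show "fst (cube_split k t) \<in> {0..1}" "snd (cube_split k t) \<in> topspace (cube k)"
    using continuous_map_image_subset_topspace[OF continuous_map_cube_split[of k]] assms by auto
qed

text \<open>The boundary of the larger cube consists of bottom, top and sides. With this lemma,
  finding a homotopy from \<open>u\<close> to \<open>v\<close> that is prescribed as
  \<open>w\<close> over the boundary becomes an extension problem for one cube.\<close>

lemma cube_boundary_Suc_glue:
  assumes u: "continuous_map (cube k) Y u" and v: "continuous_map (cube k) Y v"
    and w: "continuous_map (prod_topology (top_of_set {0..1}) (subtopology (cube k) (cube_boundary k))) Y w"
    and wu: "\<And>s. s \<in> cube_boundary k \<Longrightarrow> w (0, s) = u s"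
    and wv: "\<And>s. s \<in> cube_boundary k \<Longrightarrow> w (1, s) = v s"
  obtains c where "continuous_map (subtopology (cube (Suc k)) (cube_boundary (Suc k))) Y c"
    "\<And>s. s \<in> topspace (cube k) \<Longrightarrow> c (cube_join k (0, s)) = u s"
    "\<And>s. s \<in> topspace (cube k) \<Longrightarrow> c (cube_join k (1, s)) = v s"
    "\<And>r s. r \<in> {0..1} \<Longrightarrow> s \<in> cube_boundary k \<Longrightarrow> c (cube_join k (r, s)) = w (r, s)"
proof -
  let ?I = "top_of_set {0..1::real}"
  let ?Q = "prod_topology ?I (cube k)"
  \<comment> \<open>\<open>B\<close> describes the boundary of the larger cube in the split
    coordinates; pasting over its three closed pieces is done there.\<close>
  define B :: "(real \<times> (nat \<Rightarrow> real)) set" where "B = {(r, s). r = 0 \<or> r = 1 \<or> s \<in> cube_boundary k}"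
  define c where "c \<equiv> \<lambda>z. if fst z = 0 then u (snd z) else if fst z = (1::real) then v (snd z) else w z"
  have tw: "subtopology ?Q ({0..1} \<times> cube_boundary k) = prod_topology ?I (subtopology (cube k) (cube_boundary k))"
    by (simp add: subtopology_Times subtopology_subtopology)
  have cl: "closedin (subtopology ?Q B) (A \<inter> B)" if "closedin ?Q A" for A
    using that by (auto simp: closedin_subtopology)
  have ct: "closedin (cube k) (topspace (cube k))" by simp
  have B: "B \<inter> topspace ?Q = topspace (subtopology ?Q B)" by auto
  have sub: "subtopology (subtopology ?Q B) (A \<inter> B) = subtopology ?Q A" if "A \<inter> topspace ?Q \<subseteq> B" for A
  proof -
    have "topspace ?Q \<inter> (B \<inter> (A \<inter> B)) = topspace ?Q \<inter> A" using that by auto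
    then show ?thesis unfolding subtopology_subtopology by (metis subtopology_restrict)
  qed
  have 0: "continuous_map (subtopology (subtopology ?Q B) ({0} \<times> topspace (cube k) \<inter> B)) Y (u \<circ> snd)"
    by (subst sub) (auto simp: B_def intro!: continuous_map_compose[OF _ u] continuous_map_from_subtopology continuous_map_snd)
  have 1: "continuous_map (subtopology (subtopology ?Q B) ({1} \<times> topspace (cube k) \<inter> B)) Y (v \<circ> snd)"
    by (subst sub) (auto simp: B_def intro!: continuous_map_compose[OF _ v] continuous_map_from_subtopology continuous_map_snd)
  have 2: "continuous_map (subtopology (subtopology ?Q B) ({0..1} \<times> cube_boundary k \<inter> B)) Y w"
    by (subst sub) (use w in \<open>auto simp: B_def tw\<close>)
  define T where "T \<equiv> \<lambda>i::nat. (if i = 0 then {0} \<times> topspace (cube k) else if i = 1 then {1} \<times> topspace (cube k) else {0..1} \<times> cube_boundary k) \<inter> B"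
  define F where "F \<equiv> \<lambda>i::nat. if i = 0 then u \<circ> snd else if i = 1 then v \<circ> snd else w"
  have cF: "c x = F i x" if "i \<in> {0, 1, 2}" "x \<in> T i" for i x
    using that wu wv cube_boundary_subset by (auto simp: T_def F_def c_def split: if_splits)
  have cc: "continuous_map (subtopology ?Q B) Y c"
  proof (rule pasting_lemma_closed[where I = "{0, 1, 2::nat}" and T = T and f = F])
    show "closedin (subtopology ?Q B) (T i)" if "i \<in> {0, 1, 2}" for i
      unfolding T_def by (rule cl)
        (use ct closedin_cube_boundary in \<open>auto simp: closedin_prod_Times_iff intro!: closed_subset\<close>)
    show "continuous_map (subtopology (subtopology ?Q B) (T i)) Y (F i)" if "i \<in> {0, 1, 2}" for i
      using that 0 1 2 by (auto simp: T_def F_def)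
    show "F i x = F j x" if "i \<in> {0, 1, 2}" "j \<in> {0, 1, 2}" "x \<in> topspace (subtopology ?Q B) \<inter> T i \<inter> T j" for i j x
      using cF[of i x] cF[of j x] that by auto
    show "\<exists>j. j \<in> {0, 1, 2} \<and> x \<in> T j \<and> c x = F j x" if "x \<in> topspace (subtopology ?Q B)" for x
    proof -
      have "x \<in> T 0 \<or> x \<in> T 1 \<or> x \<in> T 2" using that by (auto simp: T_def B_def)
      then show ?thesis using cF by blast
    qed
  qed auto
  have sp: "cube_split k t \<in> B" if "t \<in> cube_boundary (Suc k)" for t
  proof -
    have t: "t \<in> topspace (cube (Suc k))" using that cube_boundary_subset by blast
    obtain r s where rs: "t = cube_join k (r, s)" "r \<in> {0..1}" "s \<in> topspace (cube k)"
      using cube_Suc_cases[OF t] by metis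
    then show ?thesis using that cube_join_boundary_iff[OF rs(2,3)] cube_split_join[OF rs(3)]
      by (simp add: B_def)
  qed
  show ?thesis
  proof (rule that[of "c \<circ> cube_split k"])
    show "continuous_map (subtopology (cube (Suc k)) (cube_boundary (Suc k))) Y (c \<circ> cube_split k)"
      by (rule continuous_map_compose[OF _ cc])
        (use sp continuous_map_cube_split in \<open>auto simp: continuous_map_in_subtopology intro: continuous_map_from_subtopology\<close>)
    fix s assume s: "s \<in> topspace (cube k)"
    show "(c \<circ> cube_split k) (cube_join k (0, s)) = u s" "(c \<circ> cube_split k) (cube_join k (1, s)) = v s"
      by (simp_all add: c_def cube_split_join[OF s])
  next
    fix r :: real and s assume "r \<in> {0..1}" and s: "s \<in> cube_boundary k"
    then have "s \<in> topspace (cube k)" using cube_boundary_subset by blast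
    then show "(c \<circ> cube_split k) (cube_join k (r, s)) = w (r, s)"
      using wu[OF s] wv[OF s] by (simp add: c_def cube_split_join)
  qed
qed

text \<open>As the boundary of the 0-cube is empty, \<open>fills 0\<close> amounts to being
  nonempty; the cases 1 and 2 together give simple connectedness.\<close>

definition fills :: "nat \<Rightarrow> 'a topology \<Rightarrow> bool" where
  "fills k Y \<longleftrightarrow> (\<forall>a. continuous_map (subtopology (cube k) (cube_boundary k)) Y a \<longrightarrow>
     (\<exists>b. continuous_map (cube k) Y b \<and> (\<forall>s\<in>cube_boundary k. b s = a s)))"

text \<open>Twice the maximum distance from the centre of the cube, so that the boundary has radius
  1; the recursion makes continuity an induction.\<close>

primrec cube_radius :: "nat \<Rightarrow> (nat \<Rightarrow> real) \<Rightarrow> real" where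
  "cube_radius 0 t = 0"
| "cube_radius (Suc k) t = max (cube_radius k t) \<bar>2 * t k - 1\<bar>"

lemma continuous_map_cube_radius:
  "j \<le> k \<Longrightarrow> continuous_map (cube k) euclideanreal (cube_radius j)"
proof (induction j)
  case 0
  have "cube_radius 0 = (\<lambda>t. 0)" by (rule ext) simp
  then show ?case by simp
next
  case (Suc j)
  have "continuous_map (cube k) euclideanreal (\<lambda>t. max (cube_radius j t) \<bar>2 * t j - 1\<bar>)"
    using Suc by (intro continuous_intros) auto
  moreover have "cube_radius (Suc j) = (\<lambda>t. max (cube_radius j t) \<bar>2 * t j - 1\<bar>)"
    by (rule ext) simp
  ultimately show ?case by simp
qed

lemma cube_radius_ge: "i < k \<Longrightarrow> \<bar>2 * t i - 1\<bar> \<le> cube_radius k t"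
  by (induction k) (auto simp: less_Suc_eq)

lemma cube_radius_attained: "cube_radius k t = 0 \<or> (\<exists>i<k. cube_radius k t = \<bar>2 * t i - 1\<bar>)"
  by (induction k) (auto simp: max_def less_Suc_eq)

lemma cube_radius_le: "t \<in> topspace (cube k) \<Longrightarrow> cube_radius k t \<le> 1"
  using cube_radius_attained[of k t] by (auto simp: topspace_cube PiE_iff abs_le_iff)

lemma cube_radius_boundary:
  assumes "t \<in> cube_boundary k" shows "cube_radius k t = 1"
proof -
  have "1 \<le> cube_radius k t" using assms cube_radius_ge[of _ k t] by (auto simp: cube_boundary_def) fastforce+
  moreover have "cube_radius k t \<le> 1" using assms cube_radius_le cube_boundary_subset by blast
  ultimately show ?thesis by simp
qed

text \<open>The radial projection from the centre of the cube to its boundary; it is used only where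
  the radius is positive.\<close>

definition cube_radial :: "nat \<Rightarrow> (nat \<Rightarrow> real) \<Rightarrow> nat \<Rightarrow> real" where
  "cube_radial k t = (\<lambda>i\<in>{..<k}. 1/2 + (t i - 1/2) / cube_radius k t)"

lemma cube_radial_boundary:
  assumes "t \<in> topspace (cube k)" "cube_radius k t > 0"
  shows "cube_radial k t \<in> cube_boundary k"
proof -
  have "\<bar>t i - 1/2\<bar> / cube_radius k t \<le> 1/2" if "i < k" for i
  proof -
    have "\<bar>t i - 1/2\<bar> \<le> 1/2 * cube_radius k t" using cube_radius_ge[OF that, of t] by (simp add: abs_if split: if_splits)
    then show ?thesis using assms(2) by (simp add: field_simps)
  qed
  then have bnd: "\<bar>(t i - 1/2) / cube_radius k t\<bar> \<le> 1/2" if "i < k" for i using that assms(2) by simp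
  have in01: "cube_radial k t i \<in> {0..1}" if i: "i < k" for i
  proof -
    define x where "x = (t i - 1/2) / cube_radius k t"
    have "\<bar>x\<bar> \<le> 1/2" using bnd[OF i] by (simp only: x_def)
    then have "1/2 + x \<in> {0..1}" by auto
    then show ?thesis using i by (simp only: cube_radial_def x_def restrict_apply lessThan_iff if_True)
  qed
  obtain i where i: "i < k" "cube_radius k t = \<bar>2 * t i - 1\<bar>"
    using cube_radius_attained[of k t] assms(2) by auto
  then have "(t i - 1/2) / cube_radius k t = 1/2 \<or> (t i - 1/2) / cube_radius k t = -1/2"
    using assms(2) by (auto simp: abs_if field_simps)
  moreover have "cube_radial k t i = 1/2 + (t i - 1/2) / cube_radius k t"
    using i(1) by (simp only: cube_radial_def restrict_apply lessThan_iff if_True)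
  ultimately have "cube_radial k t i = 1/2 + 1/2 \<or> cube_radial k t i = 1/2 + -1/2" by argo
  then have "cube_radial k t i = 0 \<or> cube_radial k t i = 1" by auto
  then show ?thesis using i(1) in01 by (auto simp: cube_boundary_def topspace_cube PiE_iff cube_radial_def)
qed

lemma cube_radial_fixes: "t \<in> cube_boundary k \<Longrightarrow> cube_radial k t = t"
  by (rule ext) (auto simp: cube_radial_def cube_radius_boundary cube_boundary_def topspace_cube PiE_def extensional_def)

text \<open>The cube is a cone over its boundary. In the shell of radius at least \<open>1/2\<close>
  the contraction is run along the rays, and inside it the map is constant; this keeps the radial
  projection away from the centre.\<close>

lemma contractible_space_fills:
  assumes Y: "contractible_space Y" "topspace Y \<noteq> {}"
  shows "fills k Y"
  unfolding fills_def
proof (intro allI impI)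
  fix a assume a: "continuous_map (subtopology (cube k) (cube_boundary k)) Y a"
  let ?I = "top_of_set {0..1::real}"
  obtain z h where h: "continuous_map (prod_topology ?I Y) Y h" "\<And>y. h (0, y) = y" "\<And>y. h (1, y) = z"
    using Y(1) unfolding contractible_space_def homotopic_with_def by auto
  have z: "z \<in> topspace Y"
  proof -
    obtain y where "y \<in> topspace Y" using Y(2) by blast
    then have "h (1, y) \<in> topspace Y" using h(1) unfolding continuous_map_def by auto
    then show ?thesis using h(3) by simp
  qed
  \<comment> \<open>The time \<open>2 - 2 * cube_radius k t\<close> is 0 on the boundary and 1 at
    radius \<open>1/2\<close>.\<close>
  define b where "b \<equiv> \<lambda>t. if cube_radius k t \<le> 1/2 then z else h (2 - 2 * cube_radius k t, a (cube_radial k t))"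
  have rad: "continuous_map (cube k) euclideanreal (cube_radius k)"
    by (rule continuous_map_cube_radius) simp
  have "continuous_map (cube k) Y b"
    unfolding b_def
  proof (rule continuous_map_cases_le[OF rad])
    let ?S = "{t \<in> topspace (cube k). 1/2 \<le> cube_radius k t}"
    have rS: "continuous_map (subtopology (cube k) ?S) euclideanreal (cube_radius k)"
      by (rule continuous_map_from_subtopology[OF rad])
    have "continuous_map (subtopology (cube k) ?S) (subtopology (cube k) (cube_boundary k)) (cube_radial k)"
      unfolding continuous_map_in_subtopology
    proof
      show "cube_radial k \<in> topspace (subtopology (cube k) ?S) \<rightarrow> cube_boundary k"
        using cube_radial_boundary[of _ k] by auto
      show "continuous_map (subtopology (cube k) ?S) (cube k) (cube_radial k)"
        unfolding continuous_map_into_cube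
      proof (intro conjI allI impI ballI)
        fix i assume i: "i < k"
        have "continuous_map (subtopology (cube k) ?S) euclideanreal (\<lambda>t. 1/2 + (t i - 1/2) / cube_radius k t)"
          by (intro continuous_intros rS continuous_map_from_subtopology[OF continuous_map_cube_component_real[OF i]]) auto
        then show "continuous_map (subtopology (cube k) ?S) euclideanreal (\<lambda>t. cube_radial k t i)"
          using i by (simp add: cube_radial_def)
        fix t assume "t \<in> topspace (subtopology (cube k) ?S)"
        then show "cube_radial k t i \<in> {0..1}"
          using cube_radial_boundary[of t k] i by (auto simp: cube_boundary_def topspace_cube PiE_iff)
      qed (auto simp: cube_radial_def)
    qed
    from continuous_map_compose[OF this a]
    have "continuous_map (subtopology (cube k) ?S) Y (a \<circ> cube_radial k)" .
    moreover have "continuous_map (subtopology (cube k) ?S) ?I (\<lambda>t. 2 - 2 * cube_radius k t)"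
      unfolding continuous_map_in_subtopology
    proof
      show "continuous_map (subtopology (cube k) ?S) euclideanreal (\<lambda>t. 2 - 2 * cube_radius k t)"
        by (intro continuous_intros rS)
      show "(\<lambda>t. 2 - 2 * cube_radius k t) \<in> topspace (subtopology (cube k) ?S) \<rightarrow> {0..1}"
        using cube_radius_le by auto
    qed
    ultimately have "continuous_map (subtopology (cube k) ?S) Y (h \<circ> (\<lambda>t. (2 - 2 * cube_radius k t, (a \<circ> cube_radial k) t)))"
      by (intro continuous_map_compose[OF _ h(1)] continuous_map_pairedI)
    then show "continuous_map (subtopology (cube k) ?S) Y (\<lambda>t. h (2 - 2 * cube_radius k t, a (cube_radial k t)))"
      by (simp add: o_def)
    show "z = h (2 - 2 * cube_radius k t, a (cube_radial k t))"
      if "t \<in> topspace (cube k)" "cube_radius k t = 1/2" for t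
    proof -
      have "2 - 2 * cube_radius k t = 1" using that(2) by simp
      then show ?thesis by (simp only: h(3))
    qed
  qed (use z in auto)
  moreover have "b s = a s" if "s \<in> cube_boundary k" for s
    using that by (simp add: b_def cube_radius_boundary cube_radial_fixes h)
  ultimately show "\<exists>b. continuous_map (cube k) Y b \<and> (\<forall>s\<in>cube_boundary k. b s = a s)" by blast
qed

subsection \<open>A criterion for weak homotopy equivalences\<close>

lemma rel_class_self:
  "continuous_map D X f \<Longrightarrow> f ` A \<subseteq> {x} \<Longrightarrow> f \<in> rel_class D A X x f"
  by (simp add: rel_class_def rel_homotopic_def)

lemma rel_class_eq_iff:
  assumes "continuous_map D X f" "f ` A \<subseteq> {x}"
  shows "rel_class D A X x f = rel_class D A X x g \<longleftrightarrow> rel_homotopic D A X x f g"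
proof
  assume "rel_class D A X x f = rel_class D A X x g"
  then have "rel_homotopic D A X x g f" using rel_class_self[OF assms] by (simp add: rel_class_def)
  then show "rel_homotopic D A X x f g" unfolding rel_homotopic_def by (rule homotopic_with_symD)
next
  assume "rel_homotopic D A X x f g"
  then show "rel_class D A X x f = rel_class D A X x g"
    unfolding rel_class_def rel_homotopic_def using homotopic_with_trans homotopic_with_symD by blast
qed

text \<open>In the union that defines the induced map all representatives contribute the same
  class.\<close>

lemma homotopy_group_map_class:
  assumes f: "continuous_map X Y f" and a: "continuous_map (cube n) X \<alpha>" "\<alpha> ` cube_boundary n \<subseteq> {x}"
  shows "homotopy_group_map n Y f x (rel_class (cube n) (cube_boundary n) X x \<alpha>) =
    rel_class (cube n) (cube_boundary n) Y (f x) (f \<circ> \<alpha>)"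
proof -
  have fa: "continuous_map (cube n) Y (f \<circ> \<alpha>)" "(f \<circ> \<alpha>) ` cube_boundary n \<subseteq> {f x}"
    using continuous_map_compose[OF a(1) f] a(2) by auto
  have "rel_class (cube n) (cube_boundary n) Y (f x) (f \<circ> \<beta>) = rel_class (cube n) (cube_boundary n) Y (f x) (f \<circ> \<alpha>)"
    if "\<beta> \<in> rel_class (cube n) (cube_boundary n) X x \<alpha>" for \<beta>
    using rel_homotopic_compose[OF _ f, of "cube n" "cube_boundary n" x \<alpha> \<beta>] that
      rel_class_eq_iff[OF fa, of "f \<circ> \<beta>"] by (simp add: rel_class_def)
  then show ?thesis unfolding homotopy_group_map_def using rel_class_self[OF a] by blast
qed

lemma homotopy_group_setE:
  assumes "C \<in> homotopy_group_set n X x"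
  obtains \<alpha> where "continuous_map (cube n) X \<alpha>" "\<alpha> ` cube_boundary n \<subseteq> {x}"
    "C = rel_class (cube n) (cube_boundary n) X x \<alpha>"
  using assms unfolding homotopy_group_set_def rel_classes_def by auto

lemma homotopy_group_setI:
  assumes "continuous_map (cube n) X \<alpha>" "\<alpha> ` cube_boundary n \<subseteq> {x}"
  shows "rel_class (cube n) (cube_boundary n) X x \<alpha> \<in> homotopy_group_set n X x"
  using assms unfolding homotopy_group_set_def rel_classes_def by auto

lemma homotopy_group_map_in:
  assumes f: "continuous_map X Y f"
  shows "homotopy_group_map n Y f x ` homotopy_group_set n X x \<subseteq> homotopy_group_set n Y (f x)"
proof clarify
  fix C assume "C \<in> homotopy_group_set n X x"
  then obtain \<alpha> where a: "continuous_map (cube n) X \<alpha>" "\<alpha> ` cube_boundary n \<subseteq> {x}"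
    "C = rel_class (cube n) (cube_boundary n) X x \<alpha>" by (rule homotopy_group_setE)
  show "homotopy_group_map n Y f x C \<in> homotopy_group_set n Y (f x)"
    unfolding a(3) homotopy_group_map_class[OF f a(1,2)]
    by (rule homotopy_group_setI) (use continuous_map_compose[OF a(1) f] a(2) in auto)
qed

lemma homotopy_group_map_compose:
  assumes f: "continuous_map X Y f" and g: "continuous_map Y Z g" and C: "C \<in> homotopy_group_set n X x"
  shows "homotopy_group_map n Z (g \<circ> f) x C = (homotopy_group_map n Z g (f x) \<circ> homotopy_group_map n Y f x) C"
proof -
  obtain \<alpha> where a: "continuous_map (cube n) X \<alpha>" "\<alpha> ` cube_boundary n \<subseteq> {x}"
    "C = rel_class (cube n) (cube_boundary n) X x \<alpha>" using C by (rule homotopy_group_setE)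
  have "continuous_map (cube n) Y (f \<circ> \<alpha>)" "(f \<circ> \<alpha>) ` cube_boundary n \<subseteq> {f x}"
    using continuous_map_compose[OF a(1) f] a(2) by auto
  from homotopy_group_map_class[OF g this] show ?thesis
    unfolding a(3) using homotopy_group_map_class[OF f a(1,2)] homotopy_group_map_class[OF continuous_map_compose[OF f g] a(1,2)]
    by (simp add: o_assoc)
qed

lemma bij_betw_homotopy_group_map_compose:
  assumes "continuous_map X Y f" "continuous_map Y Z g"
  shows "bij_betw (homotopy_group_map n Z (g \<circ> f) x) (homotopy_group_set n X x) T \<longleftrightarrow>
    bij_betw (homotopy_group_map n Z g (f x) \<circ> homotopy_group_map n Y f x) (homotopy_group_set n X x) T"
  by (rule bij_betw_cong) (rule homotopy_group_map_compose[OF assms])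

lemma weak_homotopy_equivalence_compose:
  assumes f: "weak_homotopy_equivalence X Y f" and g: "weak_homotopy_equivalence Y Z g"
  shows "weak_homotopy_equivalence X Z (g \<circ> f)"
  unfolding weak_homotopy_equivalence_def
proof (intro conjI ballI allI)
  have cf: "continuous_map X Y f" and cg: "continuous_map Y Z g"
    using f g by (auto simp: weak_homotopy_equivalence_def)
  show "continuous_map X Z (g \<circ> f)" using continuous_map_compose[OF cf cg] .
  show "topspace X = {} \<longrightarrow> topspace Z = {}" using f g by (simp add: weak_homotopy_equivalence_def)
  fix x n assume x: "x \<in> topspace X"
  have fx: "f x \<in> topspace Y" using cf x by (auto simp: continuous_map_def)
  have "bij_betw (homotopy_group_map n Z g (f x) \<circ> homotopy_group_map n Y f x)
      (homotopy_group_set n X x) (homotopy_group_set n Z (g (f x)))"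
    by (rule bij_betw_trans) (use f g x fx in \<open>auto simp: weak_homotopy_equivalence_def\<close>)
  then show "bij_betw (homotopy_group_map n Z (g \<circ> f) x) (homotopy_group_set n X x)
      (homotopy_group_set n Z ((g \<circ> f) x))"
    unfolding bij_betw_homotopy_group_map_compose[OF cf cg] by simp
qed

text \<open>The bijection induced by \<open>g\<close> is used only at base points of the form
  \<open>f x\<close>, so it can be cancelled at each \<open>x\<close>.\<close>

lemma weak_homotopy_equivalence_cancel_left:
  assumes f: "continuous_map X Y f" and g: "weak_homotopy_equivalence Y Z g"
    and gf: "weak_homotopy_equivalence X Z (g \<circ> f)"
  shows "weak_homotopy_equivalence X Y f"
  unfolding weak_homotopy_equivalence_def
proof (intro conjI ballI allI)
  have cg: "continuous_map Y Z g" using g by (auto simp: weak_homotopy_equivalence_def)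
  show "continuous_map X Y f" by fact
  show "topspace X = {} \<longrightarrow> topspace Y = {}"
    using gf cg unfolding weak_homotopy_equivalence_def continuous_map_def by blast
  fix x n assume x: "x \<in> topspace X"
  have fx: "f x \<in> topspace Y" using f x by (auto simp: continuous_map_def)
  have "bij_betw (homotopy_group_map n Z (g \<circ> f) x) (homotopy_group_set n X x) (homotopy_group_set n Z (g (f x)))"
    using gf x by (simp add: weak_homotopy_equivalence_def)
  then have comp: "bij_betw (homotopy_group_map n Z g (f x) \<circ> homotopy_group_map n Y f x)
      (homotopy_group_set n X x) (homotopy_group_set n Z (g (f x)))"
    unfolding bij_betw_homotopy_group_map_compose[OF f cg] .
  have "bij_betw (homotopy_group_map n Z g (f x)) (homotopy_group_set n Y (f x)) (homotopy_group_set n Z (g (f x)))"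
    using g fx by (simp add: weak_homotopy_equivalence_def)
  from bij_betw_comp_iff2[OF this homotopy_group_map_in[OF f]]
  show "bij_betw (homotopy_group_map n Y f x) (homotopy_group_set n X x) (homotopy_group_set n Y (f x))"
    using comp by simp
qed

text \<open>A relative lifting property: in the square formed by the boundary inclusion and
  \<open>f\<close> there is a diagonal \<open>a'\<close> for which the upper triangle commutes
  exactly and the lower one up to a homotopy fixed on the boundary. All dimensions are included, and
  the case \<open>k = 0\<close> concerns path components.\<close>

definition compression :: "'a topology \<Rightarrow> 'b topology \<Rightarrow> ('a \<Rightarrow> 'b) \<Rightarrow> bool" where
  "compression A B f \<longleftrightarrow> continuous_map A B f \<and>
    (\<forall>k b a. continuous_map (cube k) B b \<longrightarrow>
       continuous_map (subtopology (cube k) (cube_boundary k)) A a \<longrightarrow>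
       (\<forall>s\<in>cube_boundary k. f (a s) = b s) \<longrightarrow>
       (\<exists>a' h. continuous_map (cube k) A a' \<and> (\<forall>s\<in>cube_boundary k. a' s = a s) \<and>
          continuous_map (prod_topology (top_of_set {0..1::real}) (cube k)) B h \<and>
          (\<forall>s\<in>topspace (cube k). h (0, s) = b s \<and> h (1, s) = f (a' s)) \<and>
          (\<forall>t\<in>{0..1}. \<forall>s\<in>cube_boundary k. h (t, s) = b s)))"

lemma rel_homotopic_cube_iff:
  "rel_homotopic (cube k) (cube_boundary k) X x f g \<longleftrightarrow>
    (\<exists>h. continuous_map (prod_topology (top_of_set {0..1::real}) (cube k)) X h \<and>
       (\<forall>s\<in>topspace (cube k). h (0, s) = f s) \<and> (\<forall>s\<in>topspace (cube k). h (1, s) = g s) \<and>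
       (\<forall>t\<in>{0..1}. (\<lambda>s. h (t, s)) ` cube_boundary k \<subseteq> {x}))"
  unfolding rel_homotopic_def
proof (rule homotopic_with)
  fix h h' :: "(nat \<Rightarrow> real) \<Rightarrow> 'a"
  assume "\<And>s. s \<in> topspace (cube k) \<Longrightarrow> h s = h' s"
  then have "h ` cube_boundary k = h' ` cube_boundary k"
    using cube_boundary_subset[of k] by (intro image_cong) auto
  then show "(h ` cube_boundary k \<subseteq> {x}) = (h' ` cube_boundary k \<subseteq> {x})" by simp
qed

lemma compressionD:
  assumes "compression A B f" "continuous_map (cube k) B b"
    "continuous_map (subtopology (cube k) (cube_boundary k)) A a"
    "\<And>s. s \<in> cube_boundary k \<Longrightarrow> f (a s) = b s"
  obtains a' h where "continuous_map (cube k) A a'" "\<And>s. s \<in> cube_boundary k \<Longrightarrow> a' s = a s"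
    "continuous_map (prod_topology (top_of_set {0..1::real}) (cube k)) B h"
    "\<And>s. s \<in> topspace (cube k) \<Longrightarrow> h (0, s) = b s" "\<And>s. s \<in> topspace (cube k) \<Longrightarrow> h (1, s) = f (a' s)"
    "\<And>t s. t \<in> {0..1} \<Longrightarrow> s \<in> cube_boundary k \<Longrightarrow> h (t, s) = b s"
proof -
  have "\<exists>a' h. continuous_map (cube k) A a' \<and> (\<forall>s\<in>cube_boundary k. a' s = a s) \<and>
          continuous_map (prod_topology (top_of_set {0..1::real}) (cube k)) B h \<and>
          (\<forall>s\<in>topspace (cube k). h (0, s) = b s \<and> h (1, s) = f (a' s)) \<and>
          (\<forall>t\<in>{0..1}. \<forall>s\<in>cube_boundary k. h (t, s) = b s)"
    using assms unfolding compression_def by simp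
  then obtain a' h where *: "continuous_map (cube k) A a'" "\<forall>s\<in>cube_boundary k. a' s = a s"
    "continuous_map (prod_topology (top_of_set {0..1::real}) (cube k)) B h"
    "\<forall>s\<in>topspace (cube k). h (0, s) = b s \<and> h (1, s) = f (a' s)"
    "\<forall>t\<in>{0..1}. \<forall>s\<in>cube_boundary k. h (t, s) = b s"
    by blast
  show ?thesis by (rule that[OF *(1) _ *(3)]) (use *(2,4,5) in blast)+
qed

text \<open>If the lower triangle commutes exactly, as for fibrations with weakly contractible
  fibres, the constant homotopy will do.\<close>

lemma compression_exactI:
  assumes "continuous_map A B f"
    and "\<And>k b a. continuous_map (cube k) B b \<Longrightarrow>
       continuous_map (subtopology (cube k) (cube_boundary k)) A a \<Longrightarrow>
       (\<And>s. s \<in> cube_boundary k \<Longrightarrow> f (a s) = b s) \<Longrightarrow>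
       \<exists>a'. continuous_map (cube k) A a' \<and> (\<forall>s\<in>cube_boundary k. a' s = a s) \<and>
         (\<forall>s\<in>topspace (cube k). f (a' s) = b s)"
  shows "compression A B f"
  unfolding compression_def
proof (intro conjI assms(1) allI impI)
  fix k b a
  assume b: "continuous_map (cube k) B b"
    and a: "continuous_map (subtopology (cube k) (cube_boundary k)) A a"
    and ab: "\<forall>s\<in>cube_boundary k. f (a s) = b s"
  obtain a' where a': "continuous_map (cube k) A a'" "\<forall>s\<in>cube_boundary k. a' s = a s"
    "\<forall>s\<in>topspace (cube k). f (a' s) = b s"
    using assms(2)[OF b a] ab by blast
  have "continuous_map (prod_topology (top_of_set {0..1::real}) (cube k)) B (b \<circ> snd)"
    by (rule continuous_map_compose[OF continuous_map_snd b])
  then show "\<exists>a' h. continuous_map (cube k) A a' \<and> (\<forall>s\<in>cube_boundary k. a' s = a s) \<and>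
          continuous_map (prod_topology (top_of_set {0..1::real}) (cube k)) B h \<and>
          (\<forall>s\<in>topspace (cube k). h (0, s) = b s \<and> h (1, s) = f (a' s)) \<and>
          (\<forall>t\<in>{0..1}. \<forall>s\<in>cube_boundary k. h (t, s) = b s)"
    using a' by (intro exI[of _ a'] exI[of _ "b \<circ> snd"]) auto
qed

lemma continuous_map_swap_args:
  assumes "continuous_map (prod_topology A B) Y h"
  shows "continuous_map (prod_topology B A) Y (\<lambda>z. h (snd z, fst z))"
proof -
  have "continuous_map (prod_topology B A) Y (h \<circ> (\<lambda>z. (snd z, fst z)))"
    by (rule continuous_map_compose[OF _ assms])
      (intro continuous_map_pairedI continuous_map_fst continuous_map_snd)
  then show ?thesis by (simp add: o_def)
qed

text \<open>Surjectivity in degree \<open>n\<close> is compression of an \<open>n\<close>-cube with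
  constant boundary values. For injectivity, a homotopy from \<open>f \<circ> \<alpha>\<close> to
  \<open>f \<circ> \<beta>\<close> is a cube of dimension \<open>Suc n\<close> whose boundary lifts
  as \<alpha> on the bottom, \<beta> on the top and \<open>x\<close> on the sides; the compressed
  cube is a homotopy in \<open>A\<close>.\<close>

theorem compression_weak_homotopy_equivalence:
  assumes c: "compression A B f"
  shows "weak_homotopy_equivalence A B f"
  unfolding weak_homotopy_equivalence_def
proof (intro conjI ballI allI)
  show f: "continuous_map A B f" using c by (simp add: compression_def)
  show "topspace A = {} \<longrightarrow> topspace B = {}"
  proof (rule impI, rule ccontr)
    assume A: "topspace A = {}" and "topspace B \<noteq> {}"
    then obtain y where y: "y \<in> topspace B" by blast
    \<comment> \<open>Even an empty \<open>A\<close> receives a map from the empty boundary of the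
      0-cube, whatever function represents it; compressing a point of \<open>B\<close> then produces
      a point of \<open>A\<close>.\<close>
    have "cube_boundary 0 = {}" by (auto simp: cube_boundary_def)
    then have "continuous_map (subtopology (cube 0) (cube_boundary 0)) A undefined"
      by (simp add: continuous_map_def)
    then obtain a' h where "continuous_map (cube 0) A a'"
      "continuous_map (prod_topology (top_of_set {0..1::real}) (cube 0)) B h"
      by (rule compressionD[OF c, of 0 "\<lambda>_. y" undefined, rotated]) (use y \<open>cube_boundary 0 = {}\<close> in auto)
    then show False using A by (auto simp: continuous_map_def topspace_cube)
  qed
  fix x n assume x: "x \<in> topspace A"
  let ?b = "cube_boundary n"
  show "bij_betw (homotopy_group_map n B f x) (homotopy_group_set n A x) (homotopy_group_set n B (f x))"
    unfolding bij_betw_def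
  proof
    show "homotopy_group_map n B f x ` homotopy_group_set n A x = homotopy_group_set n B (f x)"
    proof
      show "homotopy_group_map n B f x ` homotopy_group_set n A x \<subseteq> homotopy_group_set n B (f x)"
        by (rule homotopy_group_map_in[OF f])
      show "homotopy_group_set n B (f x) \<subseteq> homotopy_group_map n B f x ` homotopy_group_set n A x"
      proof
        fix C assume "C \<in> homotopy_group_set n B (f x)"
        then obtain \<beta> where b: "continuous_map (cube n) B \<beta>" "\<beta> ` ?b \<subseteq> {f x}"
          "C = rel_class (cube n) ?b B (f x) \<beta>" by (rule homotopy_group_setE)
        obtain a' h where h: "continuous_map (cube n) A a'" "\<And>s. s \<in> ?b \<Longrightarrow> a' s = x"
          "continuous_map (prod_topology (top_of_set {0..1::real}) (cube n)) B h"
          "\<And>s. s \<in> topspace (cube n) \<Longrightarrow> h (0, s) = \<beta> s" "\<And>s. s \<in> topspace (cube n) \<Longrightarrow> h (1, s) = f (a' s)"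
          "\<And>t s. t \<in> {0..1} \<Longrightarrow> s \<in> ?b \<Longrightarrow> h (t, s) = \<beta> s"
          by (rule compressionD[OF c b(1), of "\<lambda>_. x"]) (use x b(2) in auto)
        have "rel_homotopic (cube n) ?b B (f x) \<beta> (f \<circ> a')"
          unfolding rel_homotopic_cube_iff using h b(2) by (intro exI[of _ h]) auto
        then have "C = rel_class (cube n) ?b B (f x) (f \<circ> a')"
          using rel_class_eq_iff[OF b(1,2)] b(3) by blast
        also have "\<dots> = homotopy_group_map n B f x (rel_class (cube n) ?b A x a')"
          by (rule homotopy_group_map_class[OF f h(1), symmetric]) (use h(2) in auto)
        finally show "C \<in> homotopy_group_map n B f x ` homotopy_group_set n A x"
          using homotopy_group_setI[OF h(1), of x] h(2) by blast
      qed
    qed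
    show "inj_on (homotopy_group_map n B f x) (homotopy_group_set n A x)"
    proof (rule inj_onI)
      fix C D assume CD: "C \<in> homotopy_group_set n A x" "D \<in> homotopy_group_set n A x"
        "homotopy_group_map n B f x C = homotopy_group_map n B f x D"
      obtain \<alpha> where a: "continuous_map (cube n) A \<alpha>" "\<alpha> ` ?b \<subseteq> {x}"
        "C = rel_class (cube n) ?b A x \<alpha>" using CD(1) by (rule homotopy_group_setE)
      obtain \<beta> where b: "continuous_map (cube n) A \<beta>" "\<beta> ` ?b \<subseteq> {x}"
        "D = rel_class (cube n) ?b A x \<beta>" using CD(2) by (rule homotopy_group_setE)
      have fa: "continuous_map (cube n) B (f \<circ> \<alpha>)" "(f \<circ> \<alpha>) ` ?b \<subseteq> {f x}"
        using continuous_map_compose[OF a(1) f] a(2) by auto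
      have "rel_homotopic (cube n) ?b B (f x) (f \<circ> \<alpha>) (f \<circ> \<beta>)"
        using CD(3) rel_class_eq_iff[OF fa, of "f \<circ> \<beta>"]
        unfolding a(3) b(3) homotopy_group_map_class[OF f a(1,2)] homotopy_group_map_class[OF f b(1,2)] by simp
      then obtain h where h: "continuous_map (prod_topology (top_of_set {0..1::real}) (cube n)) B h"
         "\<And>s. s \<in> topspace (cube n) \<Longrightarrow> h (0, s) = f (\<alpha> s)" "\<And>s. s \<in> topspace (cube n) \<Longrightarrow> h (1, s) = f (\<beta> s)"
         "\<And>t s. t \<in> {0..1} \<Longrightarrow> s \<in> ?b \<Longrightarrow> h (t, s) = f x"
        unfolding rel_homotopic_cube_iff by (auto simp: image_subset_iff)
      obtain g where g: "continuous_map (subtopology (cube (Suc n)) (cube_boundary (Suc n))) A g"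
        "\<And>s. s \<in> topspace (cube n) \<Longrightarrow> g (cube_join n (0, s)) = \<alpha> s"
        "\<And>s. s \<in> topspace (cube n) \<Longrightarrow> g (cube_join n (1, s)) = \<beta> s"
        "\<And>r s. r \<in> {0..1} \<Longrightarrow> s \<in> ?b \<Longrightarrow> g (cube_join n (r, s)) = x"
        by (rule cube_boundary_Suc_glue[OF a(1) b(1), of "\<lambda>_. x"]) (use x a(2) b(2) in auto)
      have hc: "continuous_map (cube (Suc n)) B (h \<circ> cube_split n)"
        by (rule continuous_map_compose[OF continuous_map_cube_split h(1)])
      have fg: "f (g t) = (h \<circ> cube_split n) t" if t: "t \<in> cube_boundary (Suc n)" for t
      proof -
        have "t \<in> topspace (cube (Suc n))" using t cube_boundary_subset by blast
        then obtain r s where rs: "t = cube_join n (r, s)" "r \<in> {0..1}" "s \<in> topspace (cube n)"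
          by (rule cube_Suc_cases)
        then have "r = 0 \<or> r = 1 \<or> s \<in> ?b" using t cube_join_boundary_iff by blast
        then show ?thesis using rs g h cube_split_join[OF rs(3)] by auto
      qed
      obtain a' where a': "continuous_map (cube (Suc n)) A a'" "\<And>s. s \<in> cube_boundary (Suc n) \<Longrightarrow> a' s = g s"
        using compressionD[OF c hc g(1) fg] by metis
      have ca: "continuous_map (prod_topology (top_of_set {0..1::real}) (cube n)) A (a' \<circ> cube_join n)"
        by (rule continuous_map_compose[OF continuous_map_cube_join a'(1)])
      have "a' (cube_join n (r, s)) = g (cube_join n (r, s))"
        if "r \<in> {0..1}" "s \<in> topspace (cube n)" "r = 0 \<or> r = 1 \<or> s \<in> ?b" for r s
        using a'(2) cube_join_boundary_iff[OF that(1,2)] that(3) by blast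
      then have "rel_homotopic (cube n) ?b A x \<alpha> \<beta>"
        unfolding rel_homotopic_cube_iff
        using ca g cube_boundary_subset[of n] by (intro exI[of _ "a' \<circ> cube_join n"]) (auto simp: subset_iff)
      then show "C = D" unfolding a(3) b(3) using rel_class_eq_iff[OF a(1,2)] by blast
    qed
  qed
qed

section \<open>Homeomorphisms, and the type of the points of the common source\<close>

lemma homeomorphic_map_weak_homotopy_equivalence:
  assumes "homeomorphic_map A B f"
  shows "weak_homotopy_equivalence A B f"
proof (rule compression_weak_homotopy_equivalence, rule compression_exactI)
  obtain g where g: "homeomorphic_maps A B f g" using assms homeomorphic_map_maps by blast
  show "continuous_map A B f" using g by (simp add: homeomorphic_maps_def)
  fix k b a
  assume b: "continuous_map (cube k) B b"
    and a: "continuous_map (subtopology (cube k) (cube_boundary k)) A a"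
    and ab: "\<And>s. s \<in> cube_boundary k \<Longrightarrow> f (a s) = b s"
  have "(g \<circ> b) s = a s" if "s \<in> cube_boundary k" for s
  proof -
    have "a s \<in> topspace A" using a that cube_boundary_subset[of k] by (auto simp: continuous_map_def Pi_iff)
    then show ?thesis using g ab[OF that] by (simp add: homeomorphic_maps_def) metis
  qed
  moreover have "f ((g \<circ> b) s) = b s" if "s \<in> topspace (cube k)" for s
    using g b that by (auto simp: homeomorphic_maps_def continuous_map_def)
  moreover have "continuous_map (cube k) A (g \<circ> b)"
    by (rule continuous_map_compose[OF b]) (use g in \<open>simp add: homeomorphic_maps_def\<close>)
  ultimately show "\<exists>a'. continuous_map (cube k) A a' \<and> (\<forall>s\<in>cube_boundary k. a' s = a s) \<and>
         (\<forall>s\<in>topspace (cube k). f (a' s) = b s)" by blast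
qed

text \<open>Transport of the topology along an injection of the points, which serves to change their
  type.\<close>

lemma homeomorphic_copy:
  assumes "inj_on \<kappa> (topspace Z)"
  obtains Z' where "homeomorphic_map Z' Z (inv_into (topspace Z) \<kappa>)"
proof (rule that)
  let ?g = "inv_into (topspace Z) \<kappa>"
  let ?Z' = "pullback_topology (\<kappa> ` topspace Z) ?g Z"
  have gk: "?g (\<kappa> z) = z" if "z \<in> topspace Z" for z using assms that by simp
  have "continuous_map ?Z' Z (id \<circ> ?g)" by (rule continuous_map_pullback) simp
  moreover have "continuous_map Z ?Z' \<kappa>"
    by (rule continuous_map_pullback') (use gk in \<open>auto intro: continuous_map_eq[OF continuous_map_id]\<close>)
  ultimately have "homeomorphic_maps ?Z' Z ?g \<kappa>"
    unfolding homeomorphic_maps_def using gk by (auto simp: topspace_pullback_topology f_inv_into_f)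
  then show "homeomorphic_map ?Z' Z ?g" unfolding homeomorphic_map_maps by auto
qed

text \<open>The point type of the roof \<open>Z\<close> is arbitrary here, as long as its points embed into those of \<open>X\<close>.\<close>

lemma weakly_homotopy_equivalent_spaceI:
  fixes X :: "'a topology" and \<kappa> :: "'z \<Rightarrow> 'a"
  assumes \<kappa>: "inj_on \<kappa> (topspace Z)"
    and f: "weak_homotopy_equivalence Z X f" and g: "weak_homotopy_equivalence Z Y g"
  shows "weakly_homotopy_equivalent_space X Y"
proof -
  \<comment> \<open>Constant functions paired with zero embed \<open>'a\<close> into the prescribed
    type of points.\<close>
  define \<kappa>' :: "'z \<Rightarrow> ((nat \<Rightarrow> real) \<Rightarrow> 'a) \<times> (nat \<Rightarrow> real)" where "\<kappa>' z = ((\<lambda>_. \<kappa> z), (\<lambda>_. 0))" for z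
  have "inj_on \<kappa>' (topspace Z)" using \<kappa> by (auto simp: inj_on_def \<kappa>'_def fun_eq_iff)
  then obtain Z' where Z': "homeomorphic_map Z' Z (inv_into (topspace Z) \<kappa>')"
    by (rule homeomorphic_copy)
  note w = homeomorphic_map_weak_homotopy_equivalence[OF Z']
  show ?thesis unfolding weakly_homotopy_equivalent_space_def
    using weak_homotopy_equivalence_compose[OF w f] weak_homotopy_equivalence_compose[OF w g] by blast
qed

subsection \<open>Homotopy fibres\<close>

lemma topspace_compact_open_topology:
  "topspace (compact_open_topology D Y) = {\<gamma> \<in> extensional (topspace D). continuous_map D Y \<gamma>}"
proof
  show "topspace (compact_open_topology D Y) \<subseteq> {\<gamma> \<in> extensional (topspace D). continuous_map D Y \<gamma>}"
    unfolding compact_open_topology_def topology_generated_by_topspace by auto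
  \<comment> \<open>The empty compact set imposes no condition, so the set of all maps is itself a
    member of the subbase.\<close>
  have "{\<gamma> \<in> extensional (topspace D). continuous_map D Y \<gamma> \<and> \<gamma> ` {} \<subseteq> {}} \<in>
    {{\<gamma> \<in> extensional (topspace D). continuous_map D Y \<gamma> \<and> \<gamma> ` K \<subseteq> U} | K U.
        compactin D K \<and> openin Y U}"
    by (intro CollectI exI[of _ "{}"]) auto
  then show "{\<gamma> \<in> extensional (topspace D). continuous_map D Y \<gamma>} \<subseteq> topspace (compact_open_topology D Y)"
    unfolding compact_open_topology_def topology_generated_by_topspace by auto
qed

lemma openin_compact_open_subbase:
  assumes "compactin D K" "openin Y U"
  shows "openin (compact_open_topology D Y) {\<gamma> \<in> extensional (topspace D). continuous_map D Y \<gamma> \<and> \<gamma> ` K \<subseteq> U}"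
  unfolding compact_open_topology_def by (rule topology_generated_by_Basis) (use assms in blast)

lemma continuous_map_into_compact_open:
  assumes "\<And>s. s \<in> topspace P \<Longrightarrow> g s \<in> extensional (topspace D) \<and> continuous_map D Y (g s)"
    and "\<And>K U. compactin D K \<Longrightarrow> openin Y U \<Longrightarrow> openin P {s \<in> topspace P. g s ` K \<subseteq> U}"
  shows "continuous_map P (compact_open_topology D Y) g"
  unfolding compact_open_topology_def continuous_on_generated_topo_iff
proof (intro conjI allI impI)
  fix W assume "W \<in> {{\<gamma> \<in> extensional (topspace D). continuous_map D Y \<gamma> \<and> \<gamma> ` K \<subseteq> U} | K U.
        compactin D K \<and> openin Y U}"
  then obtain K U where W: "W = {\<gamma> \<in> extensional (topspace D). continuous_map D Y \<gamma> \<and> \<gamma> ` K \<subseteq> U}"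
    "compactin D K" "openin Y U" by blast
  have "g -` W \<inter> topspace P = {s \<in> topspace P. g s ` K \<subseteq> U}" using assms(1) W(1) by auto
  then show "openin P (g -` W \<inter> topspace P)" using assms(2)[OF W(2,3)] by simp
next
  show "g ` topspace P \<subseteq> \<Union>{{\<gamma> \<in> extensional (topspace D). continuous_map D Y \<gamma> \<and> \<gamma> ` K \<subseteq> U} | K U.
        compactin D K \<and> openin Y U}"
    using assms(1) topspace_compact_open_topology[of D Y]
    unfolding compact_open_topology_def topology_generated_by_topspace by auto
qed

text \<open>By the tube lemma, a condition that holds on \<open>{s} \<times> K\<close> with
  \<open>K\<close> compact persists for parameters near \<open>s\<close>.\<close>

lemma continuous_map_curry:
  assumes h: "continuous_map (prod_topology P D) Y h"
  shows "continuous_map P (compact_open_topology D Y) (\<lambda>s. \<lambda>t\<in>topspace D. h (s, t))"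
proof (rule continuous_map_into_compact_open)
  fix s assume s: "s \<in> topspace P"
  have "continuous_map D Y (\<lambda>t\<in>topspace D. h (s, t))"
    by (rule continuous_map_eq[OF continuous_map_slice_left[OF h s]]) auto
  then show "(\<lambda>t\<in>topspace D. h (s, t)) \<in> extensional (topspace D) \<and> continuous_map D Y (\<lambda>t\<in>topspace D. h (s, t))"
    by simp
next
  fix K U assume K: "compactin D K" and U: "openin Y U"
  let ?W = "{z \<in> topspace (prod_topology P D). h z \<in> U}"
  have W: "openin (prod_topology P D) ?W" using h U openin_continuous_map_preimage by blast
  have KD: "K \<subseteq> topspace D" using compactin_subset_topspace[OF K] .
  show "openin P {s \<in> topspace P. (\<lambda>t\<in>topspace D. h (s, t)) ` K \<subseteq> U}"
  proof (subst openin_subopen, clarify)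
    fix s assume s: "s \<in> topspace P" "(\<lambda>t\<in>topspace D. h (s, t)) ` K \<subseteq> U"
    have "{s} \<times> K \<subseteq> ?W" using s KD by auto
    then obtain A B where AB: "openin P A" "s \<in> A" "K \<subseteq> B" "A \<times> B \<subseteq> ?W"
      using tube_lemma_right[OF W K s(1)] by metis
    have "A \<subseteq> {s \<in> topspace P. (\<lambda>t\<in>topspace D. h (s, t)) ` K \<subseteq> U}"
      using AB(3,4) openin_subset[OF AB(1)] KD by (auto simp: subset_iff)
    then show "\<exists>T. openin P T \<and> s \<in> T \<and> T \<subseteq> {s \<in> topspace P. (\<lambda>t\<in>topspace D. h (s, t)) ` K \<subseteq> U}"
      using AB by blast
  qed
qed

text \<open>Local compactness of the interval is what counts: near \<open>t\<close> the path
  \<open>g s\<close> maps a compact neighbourhood of \<open>t\<close> into \<open>U\<close>, and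
  this is an open condition on the path.\<close>

lemma continuous_map_uncurry_interval:
  assumes g: "continuous_map P (compact_open_topology (top_of_set {0..1::real}) Y) g"
  shows "continuous_map (prod_topology P (top_of_set {0..1})) Y (\<lambda>z. g (fst z) (snd z))"
proof -
  let ?I = "top_of_set {0..1::real}"
  have gs: "continuous_map ?I Y (g s)" "g s \<in> extensional {0..1}" if "s \<in> topspace P" for s
  proof -
    have "g s \<in> topspace (compact_open_topology ?I Y)" using g that by (auto simp: continuous_map_def)
    then show "continuous_map ?I Y (g s)" "g s \<in> extensional {0..1}"
      by (auto simp: topspace_compact_open_topology)
  qed
  show ?thesis unfolding continuous_map_def
  proof (intro conjI allI impI)
    show "(\<lambda>z. g (fst z) (snd z)) \<in> topspace (prod_topology P ?I) \<rightarrow> topspace Y"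
      using gs(1) by (fastforce simp: continuous_map_def)
    fix U assume U: "openin Y U"
    show "openin (prod_topology P ?I) {z \<in> topspace (prod_topology P ?I). g (fst z) (snd z) \<in> U}"
    proof (subst openin_subopen, clarify)
      fix s t assume "(s, t) \<in> topspace (prod_topology P ?I)" and u: "g (fst (s, t)) (snd (s, t)) \<in> U"
      then have s: "s \<in> topspace P" and t: "t \<in> {0..1}" by auto
      have "openin ?I {r \<in> topspace ?I. g s r \<in> U}"
        using gs(1)[OF s] U openin_continuous_map_preimage by blast
      moreover have "t \<in> {r \<in> topspace ?I. g s r \<in> U}" using t u by simp
      ultimately obtain e where e: "e > 0" "ball t e \<inter> {0..1} \<subseteq> {r \<in> topspace ?I. g s r \<in> U}"
        unfolding openin_contains_ball by blast
      \<comment> \<open>Half the radius, so that the closed ball stays in the preimage of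
        \<open>U\<close> while the open ball is still a neighbourhood of \<open>t\<close>.\<close>
      let ?K = "cball t (e / 2) \<inter> {0..1}"
      have cK: "compactin ?I ?K" by (auto simp: compactin_subtopology intro: compact_Int_closed)
      have sK: "g s ` ?K \<subseteq> U" using e by (auto simp: subset_iff)
      let ?A = "{s \<in> topspace P. g s \<in> {\<gamma> \<in> extensional (topspace ?I). continuous_map ?I Y \<gamma> \<and> \<gamma> ` ?K \<subseteq> U}}"
      have A: "openin P ?A" using g openin_compact_open_subbase[OF cK U] openin_continuous_map_preimage by blast
      have B: "openin ?I (ball t (e / 2) \<inter> {0..1})" by (auto simp: openin_subtopology)
      have "openin (prod_topology P ?I) (?A \<times> (ball t (e / 2) \<inter> {0..1}))"
        using A B by (simp add: openin_prod_Times_iff)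
      moreover have "(s, t) \<in> ?A \<times> (ball t (e / 2) \<inter> {0..1})" using s t e(1) sK gs[OF s] by simp
      moreover have "?A \<times> (ball t (e / 2) \<inter> {0..1}) \<subseteq> {z \<in> topspace (prod_topology P ?I). g (fst z) (snd z) \<in> U}"
      proof clarify
        fix s' r assume "r \<in> ball t (e / 2)" "r \<in> {0..1}" "s' \<in> topspace P" and K: "g s' ` ?K \<subseteq> U"
        then show "(s', r) \<in> topspace (prod_topology P ?I) \<and> g (fst (s', r)) (snd (s', r)) \<in> U"
          by (auto simp: image_subset_iff)
      qed
      ultimately show "\<exists>T. openin (prod_topology P ?I) T \<and> (s, t) \<in> T \<and>
        T \<subseteq> {z \<in> topspace (prod_topology P ?I). g (fst z) (snd z) \<in> U}" by blast
    qed
  qed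
qed

lemma continuous_map_compact_open_compose:
  assumes f: "continuous_map Y Y' f"
  shows "continuous_map (compact_open_topology D Y) (compact_open_topology D Y') (\<lambda>\<gamma>. \<lambda>t\<in>topspace D. f (\<gamma> t))"
proof (rule continuous_map_into_compact_open)
  fix \<gamma> assume "\<gamma> \<in> topspace (compact_open_topology D Y)"
  then have "continuous_map D Y' (f \<circ> \<gamma>)"
    using continuous_map_compose[OF _ f] by (auto simp: topspace_compact_open_topology)
  then have "continuous_map D Y' (\<lambda>t\<in>topspace D. f (\<gamma> t))" by (rule continuous_map_eq) auto
  then show "(\<lambda>t\<in>topspace D. f (\<gamma> t)) \<in> extensional (topspace D) \<and> continuous_map D Y' (\<lambda>t\<in>topspace D. f (\<gamma> t))"
    by simp
next
  fix K U assume K: "compactin D K" and U: "openin Y' U"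
  let ?U = "{y \<in> topspace Y. f y \<in> U}"
  have oU: "openin Y ?U" using f U openin_continuous_map_preimage by blast
  have KD: "K \<subseteq> topspace D" using compactin_subset_topspace[OF K] .
  have "{\<gamma> \<in> topspace (compact_open_topology D Y). (\<lambda>t\<in>topspace D. f (\<gamma> t)) ` K \<subseteq> U} =
    {\<gamma> \<in> extensional (topspace D). continuous_map D Y \<gamma> \<and> \<gamma> ` K \<subseteq> ?U}"
    using KD by (auto simp: topspace_compact_open_topology continuous_map_def subset_iff image_iff Pi_iff)
  then show "openin (compact_open_topology D Y)
     {\<gamma> \<in> topspace (compact_open_topology D Y). (\<lambda>t\<in>topspace D. f (\<gamma> t)) ` K \<subseteq> U}"
    using openin_compact_open_subbase[OF K oU] by simp
qed

section \<open>Lifting properties of homotopy fibres\<close>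

lemma continuous_map_into_homotopy_fibre:
  "continuous_map P (homotopy_fibre A Y y0 f) g \<longleftrightarrow>
    continuous_map P A (\<lambda>s. fst (g s)) \<and>
    continuous_map P (compact_open_topology (top_of_set {0..1}) Y) (\<lambda>s. snd (g s)) \<and>
    (\<forall>s\<in>topspace P. snd (g s) 0 = f (fst (g s)) \<and> snd (g s) 1 = y0)"
  unfolding homotopy_fibre_def continuous_map_in_subtopology continuous_map_pairwise
  by (auto simp: Pi_iff case_prod_beta o_def)

lemma topspace_homotopy_fibre:
  "z \<in> topspace (homotopy_fibre A Y y0 f) \<longleftrightarrow> fst z \<in> topspace A \<and>
     snd z \<in> extensional {0..1} \<and> continuous_map (top_of_set {0..1}) Y (snd z) \<and>
     snd z 0 = f (fst z) \<and> snd z 1 = y0"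
  by (cases z) (auto simp: homotopy_fibre_def topspace_compact_open_topology)

lemma continuous_map_homotopy_fibre_fst: "continuous_map (homotopy_fibre A Y y0 f) A fst"
  unfolding homotopy_fibre_def by (intro continuous_map_from_subtopology continuous_map_fst)

lemma continuous_map_homotopy_fibre_snd:
  "continuous_map (homotopy_fibre A Y y0 f) (compact_open_topology (top_of_set {0..1}) Y) snd"
  unfolding homotopy_fibre_def by (intro continuous_map_from_subtopology continuous_map_snd)

text \<open>Lifting \<open>b\<close> means to find paths from \<open>f (b s)\<close> to
  \<open>y0\<close> that depend continuously on \<open>s\<close> and are prescribed by
  \<open>a\<close> on the boundary. This is a map on a cube of one dimension more with given
  boundary values, and the contractible \<open>Y\<close> fills it.\<close>

lemma compression_homotopy_fibre_fst:
  assumes f: "continuous_map A Y f" and Y: "contractible_space Y" and y0: "y0 \<in> topspace Y"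
  shows "compression (homotopy_fibre A Y y0 f) A fst"
proof (rule compression_exactI[OF continuous_map_homotopy_fibre_fst])
  let ?I = "top_of_set {0..1::real}"
  let ?F = "homotopy_fibre A Y y0 f"
  fix k b a
  assume b: "continuous_map (cube k) A b"
    and a: "continuous_map (subtopology (cube k) (cube_boundary k)) ?F a"
    and ab: "\<And>s. s \<in> cube_boundary k \<Longrightarrow> fst (a s) = b s"
  let ?B = "subtopology (cube k) (cube_boundary k)"
  have aF: "a s \<in> topspace ?F" if "s \<in> cube_boundary k" for s
    using continuous_map_image_subset_topspace[OF a] that topspace_subtopology_cube_boundary by blast
  have "continuous_map (prod_topology ?B ?I) Y (\<lambda>z. (snd \<circ> a) (fst z) (snd z))"
    by (intro continuous_map_uncurry_interval continuous_map_compose[OF a continuous_map_homotopy_fibre_snd])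
  from continuous_map_swap_args[OF this]
  have w: "continuous_map (prod_topology ?I ?B) Y (\<lambda>z. snd (a (snd z)) (fst z))" by simp
  obtain c where c: "continuous_map (subtopology (cube (Suc k)) (cube_boundary (Suc k))) Y c"
    "\<And>s. s \<in> topspace (cube k) \<Longrightarrow> c (cube_join k (0, s)) = (f \<circ> b) s"
    "\<And>s. s \<in> topspace (cube k) \<Longrightarrow> c (cube_join k (1, s)) = y0"
    "\<And>r s. r \<in> {0..1} \<Longrightarrow> s \<in> cube_boundary k \<Longrightarrow> c (cube_join k (r, s)) = snd (a s) r"
    by (rule cube_boundary_Suc_glue[OF continuous_map_compose[OF b f] _ w, of "\<lambda>_. y0"])
      (use y0 aF ab topspace_homotopy_fibre[of _ A Y y0 f] in auto)
  obtain C where C: "continuous_map (cube (Suc k)) Y C" "\<And>s. s \<in> cube_boundary (Suc k) \<Longrightarrow> C s = c s"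
    using contractible_space_fills[OF Y] y0 c(1) unfolding fills_def by blast
  define h where "h = (\<lambda>z. C (cube_join k (snd z, fst z)))"
  have "continuous_map (prod_topology ?I (cube k)) Y (C \<circ> cube_join k)"
    by (rule continuous_map_compose[OF continuous_map_cube_join C(1)])
  from continuous_map_swap_args[OF this] have h: "continuous_map (prod_topology (cube k) ?I) Y h"
    by (simp add: h_def)
  have hc: "h (s, r) = c (cube_join k (r, s))"
    if "r \<in> {0..1}" "s \<in> topspace (cube k)" "r = 0 \<or> r = 1 \<or> s \<in> cube_boundary k" for r s
    using C(2) cube_join_boundary_iff[OF that(1,2)] that(3) by (simp add: h_def)
  let ?a = "\<lambda>s. (b s, \<lambda>r\<in>{0..1}. h (s, r))"
  have "continuous_map (cube k) ?F ?a"
    unfolding continuous_map_into_homotopy_fibre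
    using b continuous_map_curry[OF h] hc[of 0] hc[of 1] c(2,3) by auto
  moreover have "?a s = a s" if s: "s \<in> cube_boundary k" for s
  proof -
    have sc: "s \<in> topspace (cube k)" using s cube_boundary_subset by blast
    \<comment> \<open>Equality as functions is required, so the values outside the interval are
      compared too; both sides are undefined there.\<close>
    have "(\<lambda>r\<in>{0..1}. h (s, r)) r = snd (a s) r" for r
      using aF[OF s] hc[OF _ sc] c(4)[OF _ s] s
      by (cases "r \<in> {0..1}") (auto simp: topspace_homotopy_fibre extensional_def)
    then show ?thesis using ab[OF s] by (intro prod_eqI) auto
  qed
  ultimately show "\<exists>a'. continuous_map (cube k) ?F a' \<and> (\<forall>s\<in>cube_boundary k. a' s = a s) \<and>
       (\<forall>s\<in>topspace (cube k). fst (a' s) = b s)"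
    by (intro exI[of _ ?a]) auto
qed

text \<open>Paths in the base lift uniquely when their end point is prescribed.\<close>

lemma compression_homotopy_fibre_covering:
  assumes cov: "covering_map Y' Y p" and y0: "y0 \<in> topspace Y'"
  shows "compression (homotopy_fibre (subtopology Y' (p -` S)) Y' y0 (\<lambda>x. x))
     (homotopy_fibre (subtopology Y S) Y (p y0) (\<lambda>x. x)) (\<lambda>z. (p (fst z), \<lambda>t\<in>{0..1}. p (snd z t)))"
    (is "compression ?F' ?F ?m")
proof (rule compression_exactI)
  let ?I = "top_of_set {0..1::real}"
  have p: "continuous_map Y' Y p" by (rule covering_map_continuous[OF cov])
  have "continuous_map ?F' (compact_open_topology ?I Y) ((\<lambda>\<gamma>. \<lambda>t\<in>topspace ?I. p (\<gamma> t)) \<circ> snd)"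
    by (rule continuous_map_compose[OF continuous_map_homotopy_fibre_snd continuous_map_compact_open_compose[OF p]])
  moreover have "continuous_map ?F' (subtopology Y S) (p \<circ> fst)"
    by (rule continuous_map_compose[OF continuous_map_homotopy_fibre_fst
          covering_map_continuous[OF covering_map_subtopology[OF cov]]])
  ultimately show "continuous_map ?F' ?F ?m"
    unfolding continuous_map_into_homotopy_fibre by (auto simp: o_def topspace_homotopy_fibre)
  fix k b a
  assume b: "continuous_map (cube k) ?F b"
    and a: "continuous_map (subtopology (cube k) (cube_boundary k)) ?F' a"
    and ab: "\<And>s. s \<in> cube_boundary k \<Longrightarrow> ?m (a s) = b s"
  have aF: "a s \<in> topspace ?F'" if "s \<in> cube_boundary k" for s
    using continuous_map_image_subset_topspace[OF a] that topspace_subtopology_cube_boundary by blast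
  have bF: "b s \<in> topspace ?F" if "s \<in> topspace (cube k)" for s
    using continuous_map_image_subset_topspace[OF b] that by blast
  have sb: "continuous_map (prod_topology (cube k) ?I) Y (\<lambda>z. (snd \<circ> b) (fst z) (snd z))"
    by (intro continuous_map_uncurry_interval continuous_map_compose[OF b continuous_map_homotopy_fibre_snd])
  \<comment> \<open>Homotopy lifting starts from time 0, but the prescribed point is the end of the
    paths; hence time is reversed before lifting and again afterwards.\<close>
  have rev: "continuous_map (prod_topology (cube k) ?I) (prod_topology (cube k) ?I) (\<lambda>z. (fst z, 1 - snd z))"
  proof (rule continuous_map_pairedI[OF continuous_map_fst])
    have "continuous_map (prod_topology (cube k) ?I) euclideanreal snd"
      using continuous_map_snd[of "cube k" ?I] by (simp add: continuous_map_in_subtopology)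
    then have "continuous_map (prod_topology (cube k) ?I) euclideanreal (\<lambda>z. 1 - snd z)"
      by (intro continuous_intros)
    then show "continuous_map (prod_topology (cube k) ?I) ?I (\<lambda>z. 1 - snd z)"
      by (auto simp: continuous_map_in_subtopology)
  qed
  have hb: "continuous_map (prod_topology (cube k) ?I) Y (\<lambda>z. snd (b (fst z)) (1 - snd z))"
    using continuous_map_compose[OF rev sb] by (simp add: o_def)
  obtain H where H: "continuous_map (prod_topology (cube k) ?I) Y' H"
    "\<And>s t. s \<in> topspace (cube k) \<Longrightarrow> t \<in> {0..1} \<Longrightarrow> p (H (s, t)) = snd (b s) (1 - t)"
    "\<And>s. s \<in> topspace (cube k) \<Longrightarrow> H (s, 0) = y0"
    by (rule covering_map_lift_homotopy[OF cov hb, of "\<lambda>_. y0"])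
      (use y0 bF in \<open>auto simp: topspace_homotopy_fibre\<close>)
  define h where "h = (\<lambda>z. H (fst z, 1 - snd z))"
  have h: "continuous_map (prod_topology (cube k) ?I) Y' h"
    using continuous_map_compose[OF rev H(1)] by (simp add: o_def h_def)
  have ph: "p (h (s, t)) = snd (b s) t" if "s \<in> topspace (cube k)" "t \<in> {0..1}" for s t
    using H(2)[OF that(1), of "1 - t"] that(2) by (simp add: h_def)
  have h1: "h (s, 1) = y0" if "s \<in> topspace (cube k)" for s using H(3)[OF that] by (simp add: h_def)
  let ?a = "\<lambda>s. (h (s, 0), \<lambda>t\<in>{0..1}. h (s, t))"
  have pb: "p (h (s, 0)) = fst (b s)" if "s \<in> topspace (cube k)" for s
    using ph[OF that, of 0] bF[OF that] by (simp add: topspace_homotopy_fibre)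
  have bS: "fst (b s) \<in> S" if "s \<in> topspace (cube k)" for s
    using bF[OF that] by (simp add: topspace_homotopy_fibre)
  have "continuous_map (cube k) (subtopology Y' (p -` S)) (\<lambda>s. h (s, 0))"
    using continuous_map_slice_right[OF h, of 0] pb bS by (auto simp: continuous_map_in_subtopology)
  then have "continuous_map (cube k) ?F' ?a"
    unfolding continuous_map_into_homotopy_fibre using continuous_map_curry[OF h] h1 by auto
  moreover have "?a s = a s" if s: "s \<in> cube_boundary k" for s
  proof -
    have sc: "s \<in> topspace (cube k)" using s cube_boundary_subset by blast
    have as: "snd (a s) \<in> extensional {0..1}" "pathin Y' (snd (a s))" "snd (a s) 0 = fst (a s)" "snd (a s) 1 = y0"
      using aF[OF s] by (auto simp: topspace_homotopy_fibre pathin_def)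
    have ps: "pathin Y' (\<lambda>t. h (s, t))" using continuous_map_slice_left[OF h sc] by (simp add: pathin_def)
    have pab: "p (snd (a s) t) = snd (b s) t" if "t \<in> {0..1}" for t
      using arg_cong[OF ab[OF s], of "\<lambda>z. snd z t"] that by simp
    \<comment> \<open>On the boundary both are lifts of the path \<open>snd (b s)\<close> with end
      point \<open>y0\<close>, so uniqueness is applied at time 1.\<close>
    have eq: "h (s, t) = snd (a s) t" if "t \<in> {0..1}" for t
      by (rule covering_map_lift_path_unique[OF cov ps as(2), of 1]) (use that ph[OF sc] pab h1[OF sc] as in auto)
    then have "(\<lambda>t\<in>{0..1}. h (s, t)) t = snd (a s) t" for t
      using as(1) by (cases "t \<in> {0..1}") (auto simp: extensional_def)
    then show ?thesis using eq[of 0] as(3) by (intro prod_eqI) auto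
  qed
  moreover have "?m (?a s) = b s" if s: "s \<in> topspace (cube k)" for s
  proof -
    have "(\<lambda>t\<in>{0..1}. p ((\<lambda>t\<in>{0..1}. h (s, t)) t)) t = snd (b s) t" for t
      using ph[OF s] bF[OF s] by (cases "t \<in> {0..1}") (auto simp: topspace_homotopy_fibre extensional_def)
    then show ?thesis using pb[OF s] by (intro prod_eqI) auto
  qed
  ultimately show "\<exists>a'. continuous_map (cube k) ?F' a' \<and> (\<forall>s\<in>cube_boundary k. a' s = a s) \<and>
       (\<forall>s\<in>topspace (cube k). ?m (a' s) = b s)"
    by blast
qed

subsection \<open>Moving a point of a manifold inside a chart\<close>

definition l1_dist :: "nat \<Rightarrow> (nat \<Rightarrow> real) \<Rightarrow> (nat \<Rightarrow> real) \<Rightarrow> real" where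
  "l1_dist d y u = (\<Sum>i<d. \<bar>y i - u i\<bar>)"

lemma l1_dist_triangle: "l1_dist d a c \<le> l1_dist d a b + l1_dist d b c"
  unfolding l1_dist_def sum.distrib[symmetric] by (intro sum_mono) auto

lemma l1_dist_commute: "l1_dist d a b = l1_dist d b a"
  unfolding l1_dist_def by (simp add: abs_minus_commute)

lemma l1_dist_self [simp]: "l1_dist d a a = 0"
  by (simp add: l1_dist_def)

lemma l1_dist_nonneg: "0 \<le> l1_dist d a b"
  unfolding l1_dist_def by (intro sum_nonneg) auto

lemma l1_dist_le_0:
  assumes "l1_dist d a b \<le> 0" "a \<in> topspace (Euclidean_space d)" "b \<in> topspace (Euclidean_space d)"
  shows "a = b"
proof
  fix i
  have "(\<Sum>i<d. \<bar>a i - b i\<bar>) = 0" using assms(1) l1_dist_nonneg[of d a b] unfolding l1_dist_def by linarith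
  then have "\<forall>i\<in>{..<d}. \<bar>a i - b i\<bar> = 0" by (subst (asm) sum_nonneg_eq_0_iff) auto
  then show "a i = b i" using assms(2,3) by (cases "i < d") (auto simp: topspace_Euclidean_space)
qed

text \<open>Displacement by \<open>v - u\<close> near \<open>u\<close>, damped by a factor with Lipschitz constant \<open>1 / r\<close>:
  this is injective as long as \<open>v\<close> is closer than \<open>r\<close> to \<open>u\<close>.\<close>

definition slide :: "nat \<Rightarrow> real \<Rightarrow> (nat \<Rightarrow> real) \<Rightarrow> (nat \<Rightarrow> real) \<Rightarrow> (nat \<Rightarrow> real) \<Rightarrow> nat \<Rightarrow> real" where
  "slide d r u v y = (\<lambda>i. y i + max 0 (1 - l1_dist d y u / r) * (v i - u i))"

lemma slide_self [simp]: "slide d r u u y = y"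
  by (simp add: slide_def)

lemma slide_start [simp]: "slide d r u v u = v"
  by (simp add: slide_def)

lemma slide_far: "r > 0 \<Longrightarrow> l1_dist d y u \<ge> r \<Longrightarrow> slide d r u v y = y"
  by (simp add: slide_def max_def)

lemma slide_in:
  assumes "u \<in> topspace (Euclidean_space d)" "v \<in> topspace (Euclidean_space d)" "y \<in> topspace (Euclidean_space d)"
  shows "slide d r u v y \<in> topspace (Euclidean_space d)"
  using assms by (simp add: slide_def topspace_Euclidean_space)

text \<open>With \<open>lam = 1 - l1_dist d y u / r\<close>, the new distance is at most
  \<open>l1_dist d y u + lam * l1_dist d v u\<close>, which is less than
  \<open>l1_dist d y u + lam * r = r\<close>.\<close>

lemma slide_near:
  assumes r: "r > 0" and y: "l1_dist d y u < r" and v: "l1_dist d v u < r"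
  shows "l1_dist d (slide d r u v y) u < r"
proof -
  define lam where "lam = 1 - l1_dist d y u / r"
  have l: "lam > 0" using r y by (simp add: lam_def field_simps)
  have "l1_dist d (slide d r u v y) u \<le> (\<Sum>i<d. \<bar>y i - u i\<bar> + lam * \<bar>v i - u i\<bar>)"
    unfolding l1_dist_def
  proof (intro sum_mono)
    fix i
    have "\<bar>y i + lam * (v i - u i) - u i\<bar> \<le> \<bar>y i - u i\<bar> + \<bar>lam * (v i - u i)\<bar>" by linarith
    then show "\<bar>slide d r u v y i - u i\<bar> \<le> \<bar>y i - u i\<bar> + lam * \<bar>v i - u i\<bar>"
      using l by (simp add: slide_def lam_def[symmetric] max_def abs_mult)
  qed
  also have "\<dots> = l1_dist d y u + lam * l1_dist d v u"
    by (simp add: l1_dist_def sum.distrib sum_distrib_left)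
  also have "\<dots> < l1_dist d y u + lam * r" using l v by simp
  also have "\<dots> = r" using r by (simp add: lam_def field_simps)
  finally show ?thesis .
qed

text \<open>Points with the same image differ by a multiple of \<open>v - u\<close>, namely by the
  difference of their damping factors, which is at most their distance over \<open>r\<close>. So the
  distance is bounded by itself times \<open>l1_dist d v u / r\<close>, a factor less than
  1.\<close>

lemma slide_inj:
  assumes r: "r > 0" and v: "l1_dist d v u < r"
    and y: "y \<in> topspace (Euclidean_space d)" "y' \<in> topspace (Euclidean_space d)"
    and eq: "slide d r u v y = slide d r u v y'"
  shows "y = y'"
proof (rule l1_dist_le_0[OF _ y])
  define a where "a = max 0 (1 - l1_dist d y u / r)"
  define b where "b = max 0 (1 - l1_dist d y' u / r)"
  have "y i - y' i = (b - a) * (v i - u i)" for i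
    using fun_cong[OF eq, of i] by (simp add: slide_def a_def[symmetric] b_def[symmetric] algebra_simps)
  then have "l1_dist d y y' = \<bar>b - a\<bar> * l1_dist d v u"
    by (simp add: l1_dist_def abs_mult sum_distrib_left)
  moreover have "\<bar>b - a\<bar> \<le> l1_dist d y y' / r"
  proof -
    have "\<bar>b - a\<bar> \<le> \<bar>l1_dist d y u / r - l1_dist d y' u / r\<bar>" unfolding a_def b_def by linarith
    also have "\<dots> = \<bar>l1_dist d y u - l1_dist d y' u\<bar> / r"
      using r by (simp add: diff_divide_distrib[symmetric])
    also have "\<dots> \<le> l1_dist d y y' / r"
      using l1_dist_triangle[of d y u y'] l1_dist_triangle[of d y' u y] l1_dist_commute[of d y y'] r
      by (intro divide_right_mono) auto
    finally show ?thesis .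
  qed
  ultimately have "l1_dist d y y' \<le> l1_dist d y y' / r * l1_dist d v u"
    using l1_dist_nonneg[of d v u] by (metis mult_right_mono)
  then have le: "l1_dist d y y' * (1 - l1_dist d v u / r) \<le> 0" by (simp add: algebra_simps)
  have pos: "1 - l1_dist d v u / r > 0" using v r by simp
  show "l1_dist d y y' \<le> 0"
  proof (rule ccontr)
    assume "\<not> l1_dist d y y' \<le> 0"
    then have "l1_dist d y y' * (1 - l1_dist d v u / r) > 0" using pos by simp
    then show False using le by simp
  qed
qed

lemma continuous_map_l1_dist:
  assumes "\<And>i. i < d \<Longrightarrow> continuous_map P euclideanreal (\<lambda>s. f s i)"
    "\<And>i. i < d \<Longrightarrow> continuous_map P euclideanreal (\<lambda>s. g s i)"
  shows "continuous_map P euclideanreal (\<lambda>s. l1_dist d (f s) (g s))"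
  unfolding l1_dist_def by (intro continuous_map_sum continuous_map_real_abs continuous_map_diff assms) auto

lemma continuous_map_Euclidean_component:
  assumes "continuous_map P (Euclidean_space d) f"
  shows "continuous_map P euclideanreal (\<lambda>s. f s i)"
  using assms unfolding Euclidean_space_def continuous_map_in_subtopology continuous_map_componentwise_UNIV by blast

lemma continuous_map_into_Euclidean:
  assumes "\<And>i. continuous_map P euclideanreal (\<lambda>s. f s i)"
    and "\<And>s. s \<in> topspace P \<Longrightarrow> f s \<in> topspace (Euclidean_space d)"
  shows "continuous_map P (Euclidean_space d) f"
  using assms unfolding Euclidean_space_def continuous_map_in_subtopology continuous_map_componentwise_UNIV by auto

lemma continuous_map_slide:
  assumes u: "continuous_map P (Euclidean_space d) u" and v: "continuous_map P (Euclidean_space d) v"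
    and y: "continuous_map P (Euclidean_space d) y" and r: "r \<noteq> 0"
  shows "continuous_map P (Euclidean_space d) (\<lambda>s. slide d r (u s) (v s) (y s))"
proof (rule continuous_map_into_Euclidean)
  fix i
  show "continuous_map P euclideanreal (\<lambda>s. slide d r (u s) (v s) (y s) i)"
    unfolding slide_def
    by (intro continuous_intros continuous_map_l1_dist continuous_map_Euclidean_component[OF u]
        continuous_map_Euclidean_component[OF v] continuous_map_Euclidean_component[OF y]) (use r in auto)
next
  fix s assume "s \<in> topspace P"
  then show "slide d r (u s) (v s) (y s) \<in> topspace (Euclidean_space d)"
    using continuous_map_image_subset_topspace[OF u] continuous_map_image_subset_topspace[OF v]
      continuous_map_image_subset_topspace[OF y] by (intro slide_in) blast+
qed

lemma openin_Euclidean_space_l1_ball: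
  assumes V: "openin (Euclidean_space d) V" and c: "c \<in> V"
  obtains e where "e > 0" "\<And>y. y \<in> topspace (Euclidean_space d) \<Longrightarrow> l1_dist d y c < e \<Longrightarrow> y \<in> V"
proof -
  obtain W where W: "openin (powertop_real UNIV) W" "V = W \<inter> {x. \<forall>i\<ge>d. x i = 0}"
    using V unfolding Euclidean_space_def openin_subtopology by blast
  then obtain A where A: "c \<in> PiE UNIV A" "\<And>i. open (A i)" "finite {i. A i \<noteq> UNIV}" "PiE UNIV A \<subseteq> W"
    using product_topology_open_contains_basis[OF W(1), of c] c by auto
  have "\<exists>e>0. ball (c i) e \<subseteq> A i" for i
    using A(1,2) open_contains_ball[of "A i"] by (auto simp: PiE_iff)
  then obtain e where e: "\<And>i. e i > 0" "\<And>i. ball (c i) (e i) \<subseteq> A i" by metis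
  \<comment> \<open>The additional 1 keeps the minimum defined when \<open>d = 0\<close>.\<close>
  define E where "E = Min (insert 1 (e ` {..<d}))"
  have E: "E > 0" "\<And>i. i < d \<Longrightarrow> E \<le> e i" using e(1) by (auto simp: E_def)
  show ?thesis
  proof (rule that[OF E(1)])
    fix y assume y: "y \<in> topspace (Euclidean_space d)" "l1_dist d y c < E"
    have "y i \<in> A i" for i
    proof (cases "i < d")
      case True
      have "\<bar>y i - c i\<bar> \<le> l1_dist d y c" unfolding l1_dist_def by (rule member_le_sum) (use True in auto)
      then have "y i \<in> ball (c i) (e i)" using y(2) E(2)[OF True] by (simp add: dist_real_def abs_minus_commute)
      then show ?thesis using e(2) by blast
    next
      case False
      have "c \<in> topspace (Euclidean_space d)" using c W(2) by (auto simp: topspace_Euclidean_space)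
      then have "y i = c i" using y(1) False by (simp add: topspace_Euclidean_space)
      then show ?thesis using A(1) by (auto simp: PiE_iff)
    qed
    then show "y \<in> V" using A(4) y(1) W(2) by (auto simp: PiE_iff topspace_Euclidean_space)
  qed
qed

lemma compactin_Euclidean_space_l1_cball:
  assumes c: "c \<in> topspace (Euclidean_space d)"
  shows "compactin (Euclidean_space d) {y \<in> topspace (Euclidean_space d). l1_dist d y c \<le> r}"
    (is "compactin _ ?B")
proof -
  let ?C = "PiE UNIV (\<lambda>i. if i < d then {c i - r..c i + r} else {0})"
  have C: "compactin (powertop_real UNIV) ?C"
    by (subst compactin_PiE) auto
  have CE: "?C \<subseteq> topspace (Euclidean_space d)"
  proof
    fix y assume "y \<in> ?C"
    then have "y i \<in> (if i < d then {c i - r..c i + r} else {0})" for i by (simp add: PiE_iff)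
    then have "y i = 0" if "i \<ge> d" for i using that by (metis not_less singletonD)
    then show "y \<in> topspace (Euclidean_space d)" by (simp add: topspace_Euclidean_space)
  qed
  then have C': "compactin (Euclidean_space d) ?C"
    using C unfolding Euclidean_space_def by (simp add: compactin_subtopology)
  have "?B \<subseteq> ?C"
  proof
    fix y assume y: "y \<in> ?B"
    have "y i \<in> (if i < d then {c i - r..c i + r} else {0})" for i
    proof (cases "i < d")
      case True
      have "\<bar>y i - c i\<bar> \<le> l1_dist d y c" unfolding l1_dist_def by (rule member_le_sum) (use True in auto)
      then show ?thesis using y True by (simp add: abs_le_iff)
    qed (use y in \<open>simp add: topspace_Euclidean_space\<close>)
    then show "y \<in> ?C" by (simp only: PiE_UNIV_domain Pi_iff) blast
  qed
  moreover have "closedin (Euclidean_space d) ?B"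
  proof -
    have "continuous_map (Euclidean_space d) euclideanreal (\<lambda>y. l1_dist d y c)"
      by (intro continuous_map_l1_dist continuous_map_Euclidean_component[OF continuous_map_id, unfolded id_def]) auto
    then have "closedin (Euclidean_space d) {y \<in> topspace (Euclidean_space d). l1_dist d y c \<in> {..r}}"
      by (rule closedin_continuous_map_preimage) auto
    then show ?thesis by simp
  qed
  ultimately show ?thesis using closed_compactin[OF C'] by blast
qed

section \<open>Charts, and injective pushes that move one point to another\<close>

definition chart :: "nat \<Rightarrow> 'a topology \<Rightarrow> 'a set \<Rightarrow> (nat \<Rightarrow> real) set \<Rightarrow> ('a \<Rightarrow> nat \<Rightarrow> real) \<Rightarrow> ((nat \<Rightarrow> real) \<Rightarrow> 'a) \<Rightarrow> bool" where
  "chart d X U V c c' \<longleftrightarrow> openin X U \<and> openin (Euclidean_space d) V \<and>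
     continuous_map (subtopology X U) (Euclidean_space d) c \<and>
     continuous_map (subtopology (Euclidean_space d) V) X c' \<and>
     (\<forall>x\<in>U. c x \<in> V \<and> c' (c x) = x) \<and> (\<forall>y\<in>V. c' y \<in> U \<and> c (c' y) = y)"

lemma topological_manifold_chart:
  assumes man: "topological_manifold d X" and x: "x \<in> topspace X"
  obtains U V c c' where "x \<in> U" "chart d X U V c c'"
proof -
  obtain U V where U: "openin X U" "x \<in> U" "openin (Euclidean_space d) V"
    "subtopology X U homeomorphic_space subtopology (Euclidean_space d) V"
    using man x unfolding topological_manifold_def by blast
  obtain c c' where c: "homeomorphic_maps (subtopology X U) (subtopology (Euclidean_space d) V) c c'"
    using U(4) unfolding homeomorphic_space_def by blast
  have tU: "topspace (subtopology X U) = U" and tV: "topspace (subtopology (Euclidean_space d) V) = V"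
    using openin_subset U(1,3) by fastforce+
  have "chart d X U V c c'" unfolding chart_def
    using c tU tV U(1,3) unfolding homeomorphic_maps_def continuous_map_in_subtopology by (auto simp: Pi_iff)
  then show ?thesis using that U(2) by blast
qed

text \<open>Injectivity of \<open>\<theta> u v\<close> keeps the points of a configuration apart
  while \<open>u\<close> is pushed to \<open>v\<close>. Continuity in all three arguments allows
  \<open>u\<close>, \<open>v\<close> and the configuration to depend on parameters, and
  \<open>\<theta> u u\<close> being the identity makes the push start at rest.\<close>

definition slidable :: "'a topology \<Rightarrow> 'a set \<Rightarrow> ('a \<Rightarrow> 'a \<Rightarrow> 'a \<Rightarrow> 'a) \<Rightarrow> bool" where
  "slidable X B \<theta> \<longleftrightarrow> openin X B \<and>
     continuous_map (prod_topology (prod_topology (subtopology X B) (subtopology X B)) X) X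
       (\<lambda>z. \<theta> (fst (fst z)) (snd (fst z)) (snd z)) \<and>
     (\<forall>u\<in>B. \<forall>v\<in>B. \<theta> u v u = v \<and> inj_on (\<theta> u v) (topspace X)) \<and>
     (\<forall>u\<in>B. \<forall>y\<in>topspace X. \<theta> u u y = y)"

text \<open>The slide of the chart is extended by the identity. Its support lies in the compact set
  \<open>F\<close>, which is closed because \<open>X\<close> is Hausdorff, so \<open>U\<close> and
  the complement of \<open>F\<close> form an open cover on which the map is visibly
  continuous.\<close>

lemma topological_manifold_slidable:
  assumes man: "topological_manifold d X" and x: "x \<in> topspace X"
  obtains B \<theta> where "x \<in> B" "slidable X B \<theta>"
proof -
  have haus: "Hausdorff_space X" using man by (simp add: topological_manifold_def)
  let ?E = "Euclidean_space d"
  obtain U V c c' where xU: "x \<in> U" and ch: "chart d X U V c c'"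
    by (rule topological_manifold_chart[OF man x])
  have U: "openin X U" "x \<in> U" "openin ?E V" and cc: "continuous_map (subtopology X U) ?E c"
    and c': "continuous_map (subtopology ?E V) X c'"
    and cV: "\<And>y. y \<in> U \<Longrightarrow> c y \<in> V" and c'c: "\<And>y. y \<in> U \<Longrightarrow> c' (c y) = y"
    and c'U: "\<And>y. y \<in> V \<Longrightarrow> c' y \<in> U" and cc': "\<And>y. y \<in> V \<Longrightarrow> c (c' y) = y"
    using xU ch unfolding chart_def by auto
  have tU: "topspace (subtopology X U) = U" using openin_subset[OF U(1)] by auto
  have VE: "V \<subseteq> topspace ?E" using openin_subset[OF U(3)] .
  let ?c0 = "c x"
  obtain e where e: "e > 0" "\<And>y. y \<in> topspace ?E \<Longrightarrow> l1_dist d y ?c0 < e \<Longrightarrow> y \<in> V"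
    using openin_Euclidean_space_l1_ball[OF U(3) cV[OF U(2)]] by metis
  \<comment> \<open>Points of \<open>B\<close> are within \<rho> of the centre, hence within
    \<open>2 * \<rho>\<close> of each other, as a slide of radius \<open>2 * \<rho>\<close>
    requires. It moves only points within \<open>3 * \<rho>\<close> of the centre, which is less
    than \<open>e\<close>.\<close>
  define \<rho> where "\<rho> = e / 4"
  have \<rho>: "\<rho> > 0" using e(1) by (simp add: \<rho>_def)
  let ?r = "2 * \<rho>"
  define B where "B = {y \<in> U. l1_dist d (c y) ?c0 < \<rho>}"
  define F where "F = c' ` {y \<in> topspace ?E. l1_dist d y ?c0 \<le> 3 * \<rho>}"
  define \<theta> where "\<theta> u v y = (if y \<in> U then c' (slide d ?r (c u) (c v) (c y)) else y)" for u v y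
  have oB: "openin X B"
  proof -
    have "continuous_map (subtopology X U) euclideanreal (\<lambda>y. l1_dist d (c y) ?c0)"
      by (intro continuous_map_l1_dist continuous_map_Euclidean_component[OF cc]) auto
    then have "openin (subtopology X U) {y \<in> topspace (subtopology X U). l1_dist d (c y) ?c0 \<in> {..<\<rho>}}"
      by (rule openin_continuous_map_preimage) auto
    then show ?thesis using U(1) unfolding tU B_def by (simp add: openin_open_subtopology)
  qed
  have cF: "closedin X F"
  proof -
    have sub: "{y \<in> topspace ?E. l1_dist d y ?c0 \<le> 3 * \<rho>} \<subseteq> V" using e by (auto simp: \<rho>_def)
    have "compactin (subtopology ?E V) {y \<in> topspace ?E. l1_dist d y ?c0 \<le> 3 * \<rho>}"
      using compactin_Euclidean_space_l1_cball[of ?c0 d "3 * \<rho>"] cV[OF U(2)] VE sub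
      by (auto simp: compactin_subtopology)
    then have "compactin X F" unfolding F_def using image_compactin c' by blast
    then show ?thesis using haus compactin_imp_closedin by blast
  qed
  have uv: "l1_dist d (c v) (c u) < ?r" if "u \<in> B" "v \<in> B" for u v
    using that l1_dist_triangle[of d "c v" "c u" ?c0] l1_dist_commute[of d "c u" ?c0] by (simp add: B_def)
  have BU: "B \<subseteq> U" by (auto simp: B_def)
  have sV: "slide d ?r (c u) (c v) y \<in> V" if uvB: "u \<in> B" "v \<in> B" and y: "y \<in> V" for u v y
  proof (cases "l1_dist d y (c u) < ?r")
    case True
    have "l1_dist d (slide d ?r (c u) (c v) y) (c u) < ?r"
      by (rule slide_near[OF _ True uv[OF uvB]]) (use \<rho> in simp)
    then have "l1_dist d (slide d ?r (c u) (c v) y) ?c0 < 3 * \<rho>"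
      using l1_dist_triangle[of d "slide d ?r (c u) (c v) y" ?c0 "c u"] uvB(1) by (simp add: B_def)
    moreover have "slide d ?r (c u) (c v) y \<in> topspace ?E"
      by (rule slide_in) (use uvB y cV BU VE in blast)+
    ultimately show ?thesis using e by (simp add: \<rho>_def)
  next
    case False
    then show ?thesis using slide_far[of ?r d y "c u"] y \<rho> by simp
  qed
  have far: "\<theta> u v y = y" if "u \<in> B" "y \<in> topspace X" "y \<notin> F" for u v y
  proof (cases "y \<in> U")
    case True
    have "\<not> l1_dist d (c y) ?c0 \<le> 3 * \<rho>"
    proof
      assume "l1_dist d (c y) ?c0 \<le> 3 * \<rho>"
      then have "c' (c y) \<in> F" using cV[OF True] VE unfolding F_def by blast
      then show False using c'c[OF True] \<open>y \<notin> F\<close> by simp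
    qed
    then have "l1_dist d (c y) (c u) \<ge> ?r"
      using l1_dist_triangle[of d "c y" ?c0 "c u"] \<open>u \<in> B\<close> by (simp add: B_def)
    then show ?thesis using slide_far[of ?r d "c y" "c u"] \<rho> c'c[OF True] by (simp add: \<theta>_def)
  qed (simp add: \<theta>_def)
  let ?P = "prod_topology (prod_topology (subtopology X B) (subtopology X B)) X"
  have cont: "continuous_map ?P X (\<lambda>z. \<theta> (fst (fst z)) (snd (fst z)) (snd z))"
  proof (rule continuous_map_paste_open[where S = "(B \<times> B) \<times> U" and T = "(B \<times> B) \<times> (topspace X - F)" and g = snd])
    have tB: "topspace (subtopology X B) = B" using openin_subset[OF oB] by auto
    have oBB: "openin (prod_topology (subtopology X B) (subtopology X B)) (B \<times> B)"
      using openin_topspace[of "prod_topology (subtopology X B) (subtopology X B)"] tB by simp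
    show "openin ?P ((B \<times> B) \<times> U)" using oBB U(1) by (simp add: openin_prod_Times_iff)
    show "openin ?P ((B \<times> B) \<times> (topspace X - F))"
      using oBB cF by (simp add: openin_prod_Times_iff openin_diff)
    have "F \<subseteq> U"
    proof -
      have "{y \<in> topspace ?E. l1_dist d y ?c0 \<le> 3 * \<rho>} \<subseteq> V" using e by (auto simp: \<rho>_def)
      then show ?thesis unfolding F_def using c'U by blast
    qed
    then show "topspace ?P \<subseteq> (B \<times> B) \<times> U \<union> (B \<times> B) \<times> (topspace X - F)" by auto
    let ?Q = "subtopology ?P ((B \<times> B) \<times> U)"
    have q1: "continuous_map ?Q (subtopology X U) (\<lambda>z. fst (fst z))"
    proof -
      have "continuous_map ?P (subtopology X B) (fst \<circ> fst)"
        by (rule continuous_map_compose[OF continuous_map_fst continuous_map_fst])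
      then show ?thesis
        using BU by (auto simp: continuous_map_in_subtopology o_def intro: continuous_map_from_subtopology)
    qed
    have q2: "continuous_map ?Q (subtopology X U) (\<lambda>z. snd (fst z))"
    proof -
      have "continuous_map ?P (subtopology X B) (snd \<circ> fst)"
        by (rule continuous_map_compose[OF continuous_map_fst continuous_map_snd])
      then show ?thesis
        using BU by (auto simp: continuous_map_in_subtopology o_def intro: continuous_map_from_subtopology)
    qed
    have q3: "continuous_map ?Q (subtopology X U) snd"
      by (auto simp: continuous_map_in_subtopology intro: continuous_map_from_subtopology continuous_map_snd)
    have "continuous_map ?Q ?E (\<lambda>z. slide d ?r ((c \<circ> (\<lambda>z. fst (fst z))) z) ((c \<circ> (\<lambda>z. snd (fst z))) z) ((c \<circ> snd) z))"
      by (intro continuous_map_slide continuous_map_compose[OF q1 cc] continuous_map_compose[OF q2 cc]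
          continuous_map_compose[OF q3 cc]) (use \<rho> in simp)
    then have "continuous_map ?Q (subtopology ?E V) (\<lambda>z. slide d ?r (c (fst (fst z))) (c (snd (fst z))) (c (snd z)))"
      using sV cV by (auto simp: continuous_map_in_subtopology o_def)
    from continuous_map_compose[OF this c']
    show "continuous_map ?Q X (\<lambda>z. c' (slide d ?r (c (fst (fst z))) (c (snd (fst z))) (c (snd z))))"
      by (simp add: o_def)
    show "continuous_map (subtopology ?P ((B \<times> B) \<times> (topspace X - F))) X snd"
      by (intro continuous_map_from_subtopology continuous_map_snd)
    fix z assume "z \<in> topspace ?P"
    show "\<theta> (fst (fst z)) (snd (fst z)) (snd z) = snd z" if "z \<in> (B \<times> B) \<times> (topspace X - F)"
      by (rule far) (use that in auto)
  qed (auto simp: \<theta>_def)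
  have "inj_on (\<theta> u v) (topspace X)" if uvB: "u \<in> B" "v \<in> B" for u v
  proof (rule inj_onI)
    fix y y' assume eq: "\<theta> u v y = \<theta> u v y'"
    have inU: "\<theta> u v y \<in> U" if "y \<in> U" for y using that c'U[OF sV[OF uvB cV[OF that]]] by (simp add: \<theta>_def)
    have outU: "\<theta> u v y = y" if "y \<notin> U" for y using that by (simp add: \<theta>_def)
    show "y = y'"
    proof (cases "y \<in> U \<and> y' \<in> U")
      case True
      then have "c' (slide d ?r (c u) (c v) (c y)) = c' (slide d ?r (c u) (c v) (c y'))"
        using eq by (simp add: \<theta>_def)
      then have "slide d ?r (c u) (c v) (c y) = slide d ?r (c u) (c v) (c y')"
        using cc' sV[OF uvB] cV True by metis
      then have "c y = c y'"
        using slide_inj[OF _ uv[OF uvB], of "c y" "c y'"] \<rho> cV VE True by (meson in_mono mult_pos_pos zero_less_numeral)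
      then show ?thesis using c'c True by metis
    next
      case False
      then show ?thesis using eq inU outU by metis
    qed
  qed
  moreover have "\<theta> u v u = v" if "u \<in> B" "v \<in> B" for u v
    using that BU c'c by (auto simp: \<theta>_def subset_iff)
  moreover have "\<theta> u u y = y" for u y using c'c by (simp add: \<theta>_def)
  ultimately have "slidable X B \<theta>" unfolding slidable_def using oB cont by simp
  moreover have "x \<in> B" using U(2) \<rho> by (simp add: B_def)
  ultimately show ?thesis using that by blast
qed

subsection \<open>Moving configurations along their first point\<close>

definition distinct_points :: "nat \<Rightarrow> (nat \<Rightarrow> 'a) set" where
  "distinct_points n = {x. \<forall>i \<in> {1..n}. \<forall>j \<in> {1..n}. i \<noteq> j \<longrightarrow> x i \<noteq> x j}"

definition config_cover :: "nat \<Rightarrow> 'b topology \<Rightarrow> ('b \<Rightarrow> 'a) \<Rightarrow> (nat \<Rightarrow> 'b) topology" where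
  "config_cover n Xt p = subtopology (power_space n Xt) (power_map n p -` distinct_points n)"

lemma config_space_eq: "config_space n X = subtopology (power_space n X) (distinct_points n)"
  by (simp add: config_space_def distinct_points_def)

lemma covering_map_config_cover:
  assumes "covering_map Xt X p"
  shows "covering_map (config_cover n Xt p) (config_space n X) (power_map n p)"
  unfolding config_cover_def config_space_eq
  by (intro covering_map_subtopology covering_map_power_map assms)

lemma continuous_map_into_config_cover:
  "continuous_map P (config_cover n Xt p) f \<longleftrightarrow>
    continuous_map P (power_space n Xt) f \<and>
    (\<forall>s\<in>topspace P. \<forall>i\<in>{1..n}. \<forall>j\<in>{1..n}. i \<noteq> j \<longrightarrow> p (f s i) \<noteq> p (f s j))"
  unfolding config_cover_def continuous_map_in_subtopology distinct_points_def power_map_def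
  by (auto simp: Pi_iff)

section \<open>Families of configurations dragged along by their first points\<close>

lemma homotopic_rel_iff:
  assumes "A \<subseteq> topspace P"
  shows "homotopic_with (\<lambda>f. \<forall>s\<in>A. f s = b s) P C f g \<longleftrightarrow>
    (\<exists>h. continuous_map (prod_topology (top_of_set {0..1::real}) P) C h \<and>
      (\<forall>s\<in>topspace P. h (0, s) = f s) \<and> (\<forall>s\<in>topspace P. h (1, s) = g s) \<and>
      (\<forall>t\<in>{0..1}. \<forall>s\<in>A. h (t, s) = b s))"
  by (rule homotopic_with) (use assms in \<open>auto simp: subset_iff\<close>)

lemma homotopic_rel_trans:
  assumes 1: "homotopic_with (\<lambda>f. \<forall>s\<in>A. f s = b s) P C b b1"
    and 2: "homotopic_with (\<lambda>f. \<forall>s\<in>A. f s = b1 s) P C b1 b2"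
  shows "homotopic_with (\<lambda>f. \<forall>s\<in>A. f s = b s) P C b b2"
proof -
  have "\<forall>s\<in>A. b1 s = b s" using homotopic_with_imp_property[OF 1] by blast
  then have "homotopic_with (\<lambda>f. \<forall>s\<in>A. f s = b s) P C b1 b2"
    using homotopic_with_mono[OF 2, of "\<lambda>f. \<forall>s\<in>A. f s = b s"] by auto
  then show ?thesis using homotopic_with_trans[OF 1] by blast
qed

text \<open>As long as the projected first point stays in \<open>B\<close>, the pushes \<theta> drag
  the other projected points along. This is a homotopy in the configuration space of
  \<open>X\<close>, and it is lifted through the covering by \<open>config_cover\<close>. The first
  coordinate of the lift is \<open>k\<close>, by uniqueness of lifts. Parameters outside
  \<open>K\<close> have a resting first point and are left alone.\<close>

lemma config_cover_slide:
  assumes cov: "covering_map Xt X p" and sl: "slidable X B \<theta>" and n: "n \<ge> 1"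
    and b: "continuous_map P (config_cover n Xt p) b"
    and k: "continuous_map (prod_topology P (top_of_set {0..1::real})) Xt k"
    and k0: "\<And>s. s \<in> topspace P \<Longrightarrow> k (s, 0) = b s 1"
    and K: "closedin P K"
    and kK: "\<And>s t. s \<in> K \<Longrightarrow> t \<in> {0..1} \<Longrightarrow> p (k (s, t)) \<in> B"
    and koff: "\<And>s t. s \<in> topspace P \<Longrightarrow> s \<notin> K \<Longrightarrow> t \<in> {0..1} \<Longrightarrow> k (s, t) = k (s, 0)"
    and A: "A \<subseteq> topspace P" and kA: "\<And>s t. s \<in> A \<Longrightarrow> t \<in> {0..1} \<Longrightarrow> k (s, t) = k (s, 0)"
  obtains b' where "continuous_map P (config_cover n Xt p) b'"
    "\<And>s. s \<in> topspace P \<Longrightarrow> b' s 1 = k (s, 1)"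
    "homotopic_with (\<lambda>f. \<forall>s\<in>A. f s = b s) P (config_cover n Xt p) b b'"
proof -
  let ?I = "top_of_set {0..1::real}"
  let ?PI = "prod_topology P ?I"
  let ?C = "config_cover n Xt p"
  have cont_p: "continuous_map Xt X p" by (rule covering_map_continuous[OF cov])
  have oB: "openin X B" and \<theta>c: "continuous_map (prod_topology (prod_topology (subtopology X B) (subtopology X B)) X) X
       (\<lambda>z. \<theta> (fst (fst z)) (snd (fst z)) (snd z))"
    and \<theta>uv: "\<And>u v. u \<in> B \<Longrightarrow> v \<in> B \<Longrightarrow> \<theta> u v u = v"
    and \<theta>inj: "\<And>u v. u \<in> B \<Longrightarrow> v \<in> B \<Longrightarrow> inj_on (\<theta> u v) (topspace X)"
    and \<theta>uu: "\<And>u y. u \<in> B \<Longrightarrow> y \<in> topspace X \<Longrightarrow> \<theta> u u y = y"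
    using sl unfolding slidable_def by auto
  have covC: "covering_map ?C (config_space n X) (power_map n p)"
    by (rule covering_map_config_cover[OF cov])
  have bX: "continuous_map P (power_space n Xt) b"
    and bd: "\<And>s i j. s \<in> topspace P \<Longrightarrow> i \<in> {1..n} \<Longrightarrow> j \<in> {1..n} \<Longrightarrow> i \<noteq> j \<Longrightarrow> p (b s i) \<noteq> p (b s j)"
    using b unfolding continuous_map_into_config_cover by auto
  have bi: "continuous_map P X (\<lambda>s. p (b s i))" if "i \<in> {1..n}" for i
    using continuous_map_compose[OF continuous_map_compose[OF bX power_space_component[OF that]] cont_p]
    by (simp add: o_def)
  have biX: "p (b s i) \<in> topspace X" if "s \<in> topspace P" "i \<in> {1..n}" for s i
    using bi[OF that(2)] that(1) by (auto simp: continuous_map_def)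
  have pk: "continuous_map ?PI X (p \<circ> k)" by (rule continuous_map_compose[OF k cont_p])
  \<comment> \<open>The parameters whose whole track stays in \<open>B\<close>. This set contains
    \<open>K\<close> and is open by the tube lemma, so it covers the parameter space together with
    the complement of \<open>K\<close>.\<close>
  define U where "U = {s \<in> topspace P. \<forall>t\<in>{0..1}. p (k (s, t)) \<in> B}"
  have KP: "K \<subseteq> topspace P" using closedin_subset[OF K] .
  have oU: "openin P U"
  proof (subst openin_subopen, intro ballI)
    fix s assume s: "s \<in> U"
    let ?W = "{z \<in> topspace ?PI. (p \<circ> k) z \<in> B}"
    have W: "openin ?PI ?W" using pk oB openin_continuous_map_preimage by blast
    have "compactin ?I {0..1}" by (simp add: compactin_subtopology)
    moreover have "{s} \<times> {0..1} \<subseteq> ?W" using s by (auto simp: U_def)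
    ultimately obtain N T where N: "openin P N" "s \<in> N" "{0..1} \<subseteq> T" "N \<times> T \<subseteq> ?W"
      using tube_lemma_right[OF W, of "{0..1}" s] s by (auto simp: U_def)
    have "N \<subseteq> U"
    proof
      fix s' assume "s' \<in> N"
      then have "(s', t) \<in> ?W" if "t \<in> {0..1}" for t using that N(3,4) by blast
      then show "s' \<in> U" using openin_subset[OF N(1)] \<open>s' \<in> N\<close> by (auto simp: U_def)
    qed
    then show "\<exists>T. openin P T \<and> s \<in> T \<and> T \<subseteq> U" using N by blast
  qed
  define h where "h = (\<lambda>z. if fst z \<in> U then (\<lambda>i\<in>{1..n}. \<theta> (p (k (fst z, 0))) (p (k z)) (p (b (fst z) i)))
      else power_map n p (b (fst z)))"
  \<comment> \<open>Where the first point has not moved in \<open>X\<close>, the push is the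
    identity; so the two formulas for \<open>h\<close> agree on the overlap of the two open
    sets.\<close>
  have h_off: "h z = power_map n p (b (fst z))" if z: "z \<in> topspace ?PI" and c: "p (k z) = p (k (fst z, 0))" for z
  proof (cases "fst z \<in> U")
    case True
    then have "p (k (fst z, 0)) \<in> B" by (auto simp: U_def)
    then show ?thesis using True c z \<theta>uu biX by (auto simp: h_def power_map_def)
  qed (simp add: h_def)
  have hX: "continuous_map ?PI (power_space n X) h"
  proof (rule continuous_map_paste_open[where S = "U \<times> {0..1}" and T = "(topspace P - K) \<times> {0..1}"
        and f = "\<lambda>z. \<lambda>i\<in>{1..n}. \<theta> (p (k (fst z, 0))) (p (k z)) (p (b (fst z) i))"
        and g = "power_map n p \<circ> (b \<circ> fst)"])
    show "openin ?PI (U \<times> {0..1})" "openin ?PI ((topspace P - K) \<times> {0..1})"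
      using oU K by (auto simp: openin_prod_Times_iff openin_diff)
    show "topspace ?PI \<subseteq> U \<times> {0..1} \<union> (topspace P - K) \<times> {0..1}" using kK by (auto simp: U_def)
    show "continuous_map (subtopology ?PI ((topspace P - K) \<times> {0..1})) (power_space n X) (power_map n p \<circ> (b \<circ> fst))"
      by (intro continuous_map_from_subtopology continuous_map_compose[OF _ continuous_map_power_map[OF cont_p]]
          continuous_map_compose[OF continuous_map_fst bX])
    let ?Q = "subtopology ?PI (U \<times> {0..1})"
    show "continuous_map ?Q (power_space n X) (\<lambda>z. \<lambda>i\<in>{1..n}. \<theta> (p (k (fst z, 0))) (p (k z)) (p (b (fst z) i)))"
      unfolding continuous_map_into_power_space
    proof (intro conjI ballI)
      fix i assume i: "i \<in> {1..n}"
      have q1: "continuous_map ?Q (subtopology X B) (\<lambda>z. p (k (fst z, 0)))"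
      proof -
        have "continuous_map ?PI Xt ((\<lambda>s. k (s, 0)) \<circ> fst)"
          by (rule continuous_map_compose[OF continuous_map_fst continuous_map_slice_right[OF k]]) simp
        from continuous_map_compose[OF this cont_p] show ?thesis
          by (auto simp: continuous_map_in_subtopology o_def U_def intro: continuous_map_from_subtopology)
      qed
      have q2: "continuous_map ?Q (subtopology X B) (\<lambda>z. p (k z))"
        using pk by (auto simp: continuous_map_in_subtopology o_def U_def intro: continuous_map_from_subtopology)
      have q3: "continuous_map ?Q X (\<lambda>z. p (b (fst z) i))"
        using continuous_map_compose[OF continuous_map_fst bi[OF i]]
        by (auto simp: o_def intro: continuous_map_from_subtopology)
      have "continuous_map ?Q X ((\<lambda>z. \<theta> (fst (fst z)) (snd (fst z)) (snd z)) \<circ>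
          (\<lambda>z. ((p (k (fst z, 0)), p (k z)), p (b (fst z) i))))"
        by (rule continuous_map_compose[OF _ \<theta>c]) (intro continuous_map_pairedI q1 q2 q3)
      then show "continuous_map ?Q X (\<lambda>z. (\<lambda>i\<in>{1..n}. \<theta> (p (k (fst z, 0))) (p (k z)) (p (b (fst z) i))) i)"
        using i by (simp add: o_def)
    qed auto
    fix z assume z: "z \<in> topspace ?PI"
    show "h z = (\<lambda>i\<in>{1..n}. \<theta> (p (k (fst z, 0))) (p (k z)) (p (b (fst z) i)))" if "z \<in> U \<times> {0..1}"
      using that by (auto simp: h_def)
    show "h z = (power_map n p \<circ> (b \<circ> fst)) z" if "z \<in> (topspace P - K) \<times> {0..1}"
      using h_off[OF z] koff[of "fst z" "snd z"] that by auto
  qed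
  have hD: "h z \<in> distinct_points n" if z: "z \<in> topspace ?PI" for z
    unfolding distinct_points_def
  proof (intro CollectI ballI impI)
    fix i j assume ij: "i \<in> {1..n}" "j \<in> {1..n}" "i \<noteq> j"
    have s: "fst z \<in> topspace P" using z by auto
    note d = bd[OF s ij]
    show "h z i \<noteq> h z j"
    proof (cases "fst z \<in> U")
      case True
      have t: "snd z \<in> {0..1}" using z by auto
      have "p (k (fst z, snd z)) \<in> B" "p (k (fst z, 0)) \<in> B" using True t unfolding U_def by fastforce+
      then have "inj_on (\<theta> (p (k (fst z, 0))) (p (k z))) (topspace X)" using \<theta>inj by simp
      then have "\<theta> (p (k (fst z, 0))) (p (k z)) (p (b (fst z) i)) \<noteq> \<theta> (p (k (fst z, 0))) (p (k z)) (p (b (fst z) j))"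
        using d biX[OF s ij(1)] biX[OF s ij(2)] by (meson inj_onD)
      then show ?thesis using True ij by (simp add: h_def)
    qed (use ij d in \<open>simp add: h_def power_map_def\<close>)
  qed
  have h: "continuous_map ?PI (config_space n X) h"
    using hX hD by (auto simp: config_space_eq continuous_map_in_subtopology)
  obtain H where H: "continuous_map ?PI ?C H"
    "\<And>s t. s \<in> topspace P \<Longrightarrow> t \<in> {0..1} \<Longrightarrow> power_map n p (H (s, t)) = h (s, t)"
    "\<And>s. s \<in> topspace P \<Longrightarrow> H (s, 0) = b s"
  proof (rule covering_map_lift_homotopy[OF covC h b])
    fix s assume "s \<in> topspace P"
    then show "power_map n p (b s) = h (s, 0)" using h_off[of "(s, 0)"] by simp
  qed auto
  have HX: "continuous_map ?PI (power_space n Xt) H" using H(1) by (simp add: continuous_map_into_config_cover)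
  have 1: "1 \<in> {1..n}" using n by simp
  \<comment> \<open>Both sides start at \<open>b s 1\<close> and lie over the same path in
    \<open>X\<close>: the push takes the first point to \<open>p (k (s, t))\<close>.\<close>
  have Hk: "H (s, t) 1 = k (s, t)" if s: "s \<in> topspace P" and t: "t \<in> {0..1}" for s t
  proof (rule covering_map_lift_path_unique[OF cov, of "\<lambda>t. H (s, t) 1" "\<lambda>t. k (s, t)" 0 t])
    show "pathin Xt (\<lambda>t. H (s, t) 1)" unfolding pathin_def
      using continuous_map_compose[OF continuous_map_slice_left[OF HX s] power_space_component[OF 1]]
      by (simp add: o_def)
    show "pathin Xt (\<lambda>t. k (s, t))" unfolding pathin_def by (rule continuous_map_slice_left[OF k s])
    show "H (s, 0) 1 = k (s, 0)" using H(3)[OF s] k0[OF s] by simp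
    fix t :: real assume t: "t \<in> {0..1}"
    have "p (H (s, t) 1) = h (s, t) 1"
      using fun_cong[OF H(2)[OF s t], of 1] 1 by (simp add: power_map_def)
    also have "\<dots> = p (k (s, t))"
    proof (cases "s \<in> U")
      case True
      then have "p (k (s, t)) \<in> B" "p (k (s, 0)) \<in> B" using t by (auto simp: U_def)
      then show ?thesis using True 1 \<theta>uv k0[OF s] by (simp add: h_def)
    next
      case False
      then have "s \<notin> K" using kK KP s by (auto simp: U_def)
      then show ?thesis using False 1 koff[OF s _ t] k0[OF s] by (simp add: h_def power_map_def)
    qed
    finally show "p (H (s, t) 1) = p (k (s, t))" .
  qed (use t in auto)
  \<comment> \<open>Over \<open>A\<close> the homotopy \<open>h\<close> is stationary, so its lift
    is constant.\<close>
  have HA: "H (s, t) = b s" if s: "s \<in> A" and t: "t \<in> {0..1}" for s t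
  proof -
    have sP: "s \<in> topspace P" using s A by blast
    have "H (s, t) = H (s, 0)"
    proof (rule covering_map_lift_path_unique[OF covC, of "\<lambda>t. H (s, t)" "\<lambda>t. H (s, 0)" 0 t])
      show "pathin ?C (\<lambda>t. H (s, t))" unfolding pathin_def by (rule continuous_map_slice_left[OF H(1) sP])
      then show "pathin ?C (\<lambda>t. H (s, 0))" by (auto simp: pathin_def continuous_map_def)
      fix t :: real assume t: "t \<in> {0..1}"
      show "power_map n p (H (s, t)) = power_map n p (H (s, 0))"
        using h_off[of "(s, t)"] h_off[of "(s, 0)"] kA[OF s t] sP t H(2)[OF sP t] H(2)[OF sP, of 0] by simp
    qed (use t in auto)
    then show ?thesis using H(3)[OF sP] by simp
  qed
  show ?thesis
  proof (rule that[of "\<lambda>s. H (s, 1)"])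
    show "continuous_map P ?C (\<lambda>s. H (s, 1))" by (rule continuous_map_slice_right[OF H(1)]) simp
    show "H (s, 1) 1 = k (s, 1)" if "s \<in> topspace P" for s using Hk[OF that] by simp
    show "homotopic_with (\<lambda>f. \<forall>s\<in>A. f s = b s) P ?C b (\<lambda>s. H (s, 1))"
      unfolding homotopic_rel_iff[OF A]
      using continuous_map_swap_args[OF H(1)] H(3) HA by (intro exI[of _ "\<lambda>z. H (snd z, fst z)"]) auto
  qed
qed

text \<open>Along the track \<open>h\<close> of the first point, every family of configurations at
  time \<open>T\<close> can be dragged to time \<open>T'\<close>. The times depend on the parameter
  because a single step advances only a part of the parameter space.\<close>

definition movable :: "nat \<Rightarrow> 'b topology \<Rightarrow> ('b \<Rightarrow> 'a) \<Rightarrow> 'p topology \<Rightarrow> 'p set \<Rightarrow> ('p \<times> real \<Rightarrow> 'b) \<Rightarrow>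
    ('p \<Rightarrow> real) \<Rightarrow> ('p \<Rightarrow> real) \<Rightarrow> bool" where
  "movable n Xt p P A h T T' \<longleftrightarrow> (\<forall>b. continuous_map P (config_cover n Xt p) b \<longrightarrow>
     (\<forall>s\<in>topspace P. b s 1 = h (s, T s)) \<longrightarrow>
     (\<exists>b'. continuous_map P (config_cover n Xt p) b' \<and> (\<forall>s\<in>topspace P. b' s 1 = h (s, T' s)) \<and>
        homotopic_with (\<lambda>f. \<forall>s\<in>A. f s = b s) P (config_cover n Xt p) b b'))"

lemma movable_refl:
  assumes "\<And>s. s \<in> topspace P \<Longrightarrow> T s = T' s"
  shows "movable n Xt p P A h T T'"
  unfolding movable_def using assms by auto

lemma movable_trans:
  assumes 1: "movable n Xt p P A h T T1" and 2: "movable n Xt p P A h T1 T2"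
  shows "movable n Xt p P A h T T2"
  unfolding movable_def
proof (intro allI impI)
  fix b assume "continuous_map P (config_cover n Xt p) b" "\<forall>s\<in>topspace P. b s 1 = h (s, T s)"
  then obtain b1 where b1: "continuous_map P (config_cover n Xt p) b1" "\<forall>s\<in>topspace P. b1 s 1 = h (s, T1 s)"
    "homotopic_with (\<lambda>f. \<forall>s\<in>A. f s = b s) P (config_cover n Xt p) b b1"
    using 1 unfolding movable_def by blast
  then obtain b2 where b2: "continuous_map P (config_cover n Xt p) b2" "\<forall>s\<in>topspace P. b2 s 1 = h (s, T2 s)"
    "homotopic_with (\<lambda>f. \<forall>s\<in>A. f s = b1 s) P (config_cover n Xt p) b1 b2"
    using 2 unfolding movable_def by blast
  show "\<exists>b'. continuous_map P (config_cover n Xt p) b' \<and> (\<forall>s\<in>topspace P. b' s 1 = h (s, T2 s)) \<and>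
        homotopic_with (\<lambda>f. \<forall>s\<in>A. f s = b s) P (config_cover n Xt p) b b'"
    using b2(1,2) homotopic_rel_trans[OF b1(3) b2(3)] by blast
qed

text \<open>The first point runs through \<open>h\<close> with the time \<tau> interpolating
  linearly between \<open>T\<close> and \<open>T'\<close>. Only over \<open>K\<close> do the two
  times differ, and there the track remains in \<open>B\<close>.\<close>

lemma movable_step:
  assumes cov: "covering_map Xt X p" and sl: "slidable X B \<theta>" and n: "n \<ge> 1"
    and h: "continuous_map (prod_topology P (top_of_set {0..1::real})) Xt h"
    and A: "A \<subseteq> topspace P" and hA: "\<And>s t. s \<in> A \<Longrightarrow> t \<in> {0..1} \<Longrightarrow> h (s, t) = h (s, 0)"
    and T: "continuous_map P (top_of_set {0..1}) T" and T': "continuous_map P (top_of_set {0..1}) T'"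
    and K: "closedin P K" and off: "\<And>s. s \<in> topspace P \<Longrightarrow> s \<notin> K \<Longrightarrow> T' s = T s"
    and hK: "\<And>s t. s \<in> K \<Longrightarrow> T s \<le> t \<Longrightarrow> t \<le> T' s \<Longrightarrow> p (h (s, t)) \<in> B"
    and le: "\<And>s. s \<in> topspace P \<Longrightarrow> T s \<le> T' s"
  shows "movable n Xt p P A h T T'"
  unfolding movable_def
proof (intro allI impI)
  let ?I = "top_of_set {0..1::real}"
  let ?PI = "prod_topology P ?I"
  fix b assume b: "continuous_map P (config_cover n Xt p) b" and b1: "\<forall>s\<in>topspace P. b s 1 = h (s, T s)"
  have T01: "T s \<in> {0..1}" "T' s \<in> {0..1}" if "s \<in> topspace P" for s
    using T T' that by (auto simp: continuous_map_def)
  define \<tau> where "\<tau> = (\<lambda>z. T (fst z) + snd z * (T' (fst z) - T (fst z)))"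
  have between: "T s \<le> \<tau> (s, t)" "\<tau> (s, t) \<le> T' s" if "s \<in> topspace P" "t \<in> {0..1}" for s t
  proof -
    have "0 \<le> t * (T' s - T s)" using le[OF that(1)] that(2) by simp
    then show "T s \<le> \<tau> (s, t)" by (simp add: \<tau>_def)
    have "t * (T' s - T s) \<le> 1 * (T' s - T s)"
      by (rule mult_right_mono) (use le[OF that(1)] that(2) in auto)
    then show "\<tau> (s, t) \<le> T' s" by (simp add: \<tau>_def)
  qed
  have \<tau>01: "\<tau> (s, t) \<in> {0..1}" if "s \<in> topspace P" "t \<in> {0..1}" for s t
    using between[OF that] T01[OF that(1)] by auto
  have "continuous_map ?PI euclideanreal \<tau>"
  proof -
    have t: "continuous_map ?PI euclideanreal snd"
      using continuous_map_snd[of P ?I] by (simp add: continuous_map_in_subtopology)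
    have "continuous_map ?PI euclideanreal (T \<circ> fst)" "continuous_map ?PI euclideanreal (T' \<circ> fst)"
      using T T' by (auto intro!: continuous_map_compose[OF continuous_map_fst] simp: continuous_map_in_subtopology)
    then show ?thesis unfolding \<tau>_def using t by (intro continuous_intros) (auto simp: o_def)
  qed
  then have \<tau>: "continuous_map ?PI ?I \<tau>" using \<tau>01 by (auto simp: continuous_map_in_subtopology)
  define k where "k = (\<lambda>z. h (fst z, \<tau> z))"
  have k: "continuous_map ?PI Xt k"
    using continuous_map_compose[OF continuous_map_pairedI[OF continuous_map_fst \<tau>] h] by (simp add: k_def o_def)
  obtain b' where b': "continuous_map P (config_cover n Xt p) b'"
    "\<And>s. s \<in> topspace P \<Longrightarrow> b' s 1 = k (s, 1)"
    "homotopic_with (\<lambda>f. \<forall>s\<in>A. f s = b s) P (config_cover n Xt p) b b'"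
  proof (rule config_cover_slide[OF cov sl n b k _ K _ _ A])
    show "k (s, 0) = b s 1" if "s \<in> topspace P" for s using b1 that by (simp add: k_def \<tau>_def)
    show "p (k (s, t)) \<in> B" if "s \<in> K" "t \<in> {0..1}" for s t
    proof -
      have "s \<in> topspace P" using that(1) closedin_subset[OF K] by blast
      then show ?thesis using hK[OF that(1) between] that(2) by (simp add: k_def)
    qed
    show "k (s, t) = k (s, 0)" if "s \<in> topspace P" "s \<notin> K" "t \<in> {0..1}" for s t
      using off[OF that(1,2)] by (simp add: k_def \<tau>_def)
    show "k (s, t) = k (s, 0)" if "s \<in> A" "t \<in> {0..1}" for s t
    proof -
      have sP: "s \<in> topspace P" using that A by blast
      show ?thesis using hA[OF that(1) \<tau>01[OF sP that(2)]] hA[OF that(1) \<tau>01[OF sP, of 0]] by (simp add: k_def)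
    qed
  qed auto
  show "\<exists>b'. continuous_map P (config_cover n Xt p) b' \<and> (\<forall>s\<in>topspace P. b' s 1 = h (s, T' s)) \<and>
        homotopic_with (\<lambda>f. \<forall>s\<in>A. f s = b s) P (config_cover n Xt p) b b'"
    using b' by (intro exI[of _ b']) (auto simp: k_def \<tau>_def)
qed

text \<open>On a short time interval the configurations are moved patch by patch: the time \<open>T\<close> is raised from
  \<open>a\<close> to \<open>b\<close> by bump functions, each supported where the first point stays in one slidable set.\<close>

lemma movable_local:
  assumes cov: "covering_map Xt X p" and n: "n \<ge> 1"
    and slide: "\<And>x. x \<in> topspace X \<Longrightarrow> \<exists>B \<theta>. x \<in> B \<and> slidable X B \<theta>"
    and P: "compact_space P" "completely_regular_space P"
    and h: "continuous_map (prod_topology P (top_of_set {0..1::real})) Xt h"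
    and A: "A \<subseteq> topspace P" and hA: "\<And>s t. s \<in> A \<Longrightarrow> t \<in> {0..1} \<Longrightarrow> h (s, t) = h (s, 0)"
    and x: "x \<in> {0..1}"
  shows "\<exists>\<delta>>0. \<forall>a b. a \<le> x \<and> x \<le> b \<and> b - a < \<delta> \<longrightarrow> 0 \<le> a \<longrightarrow> b \<le> 1 \<longrightarrow>
    movable n Xt p P A h (\<lambda>_. a) (\<lambda>_. b)"
proof -
  let ?I = "top_of_set {0..1::real}"
  let ?PI = "prod_topology P ?I"
  have ph: "continuous_map ?PI X (p \<circ> h)" by (rule continuous_map_compose[OF h covering_map_continuous[OF cov]])
  \<comment> \<open>\<open>f\<close> is a Urysohn function around \<open>s0\<close>. The track stays
    in \<open>B\<close> where \<open>f \<le> 3/4\<close>, which leaves room for a bump that is full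
    where \<open>f \<le> 1/2\<close>.\<close>
  define Q where "Q \<equiv> \<lambda>s0 B d (f :: 'c \<Rightarrow> real). (\<exists>\<theta>. slidable X B \<theta>) \<and> d > 0 \<and>
    continuous_map P ?I f \<and> f s0 = 0 \<and>
    (\<forall>s\<in>topspace P. \<forall>t\<in>{0..1}. f s \<le> 3/4 \<longrightarrow> \<bar>t - x\<bar> < d \<longrightarrow> p (h (s, t)) \<in> B)"
  have "\<exists>B d f. Q s0 B d f" if s0: "s0 \<in> topspace P" for s0
  proof -
    have "(p \<circ> h) (s0, x) \<in> topspace X" using ph s0 x by (auto simp: continuous_map_def)
    then have "\<exists>B \<theta>. p (h (s0, x)) \<in> B \<and> slidable X B \<theta>" by (intro slide) simp
    then obtain B \<theta> where B: "p (h (s0, x)) \<in> B" "slidable X B \<theta>" by blast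
    then have "openin ?PI {z \<in> topspace ?PI. (p \<circ> h) z \<in> B}"
      using ph openin_continuous_map_preimage unfolding slidable_def by blast
    then obtain N T where N: "openin P N" "openin ?I T" "s0 \<in> N" "x \<in> T"
      "N \<times> T \<subseteq> {z \<in> topspace ?PI. (p \<circ> h) z \<in> B}"
      by (rule openin_prod_topology_box[where x = s0 and y = x]) (use s0 x B in auto)
    obtain d where d: "d > 0" "ball x d \<inter> {0..1} \<subseteq> T" using N(2,4) by (metis openin_contains_ball)
    have "closedin P (topspace P - N)" using N(1) by blast
    moreover have "s0 \<in> topspace P - (topspace P - N)" using N(3) s0 by blast
    ultimately obtain f where f: "continuous_map P ?I f" "f s0 = 0" "f ` (topspace P - N) \<subseteq> {1}"
      using P(2) unfolding completely_regular_space_def by (metis image_subset_iff_funcset)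
    have "p (h (s, t)) \<in> B" if "s \<in> topspace P" "t \<in> {0..1}" "f s \<le> 3/4" "\<bar>t - x\<bar> < d" for s t
    proof -
      have "s \<in> N" using f(3) that(1,3) by (cases "s \<in> N") auto
      moreover have "t \<in> T" using d(2) that(2,4) by (auto simp: dist_real_def abs_minus_commute)
      ultimately show ?thesis using N(5) by auto
    qed
    then have "Q s0 B d f" unfolding Q_def using B(2) d(1) f(1,2) by blast
    then show ?thesis by blast
  qed
  then obtain B d f where Q: "\<And>s0. s0 \<in> topspace P \<Longrightarrow> Q s0 (B s0) (d s0) (f s0)" by metis
  have fc: "continuous_map P euclideanreal (f s0)" if "s0 \<in> topspace P" for s0
    using Q[OF that] unfolding Q_def by (simp add: continuous_map_in_subtopology)
  let ?O = "\<lambda>s0. {s \<in> topspace P. f s0 s \<in> {..<1/2}}"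
  have "openin P (?O s0)" if "s0 \<in> topspace P" for s0
    by (rule openin_continuous_map_preimage[OF fc[OF that]]) auto
  moreover have "topspace P \<subseteq> \<Union>(?O ` topspace P)" using Q by (auto simp: Q_def)
  ultimately obtain \<F> where \<F>: "finite \<F>" "\<F> \<subseteq> ?O ` topspace P" "topspace P \<subseteq> \<Union>\<F>"
    using P(1) unfolding compact_space_alt by (metis (no_types, lifting) imageE)
  obtain F where F: "F \<subseteq> topspace P" "finite F" "\<F> = ?O ` F"
    using finite_subset_image[OF \<F>(1,2)] by blast
  \<comment> \<open>The additional 1 covers the case of an empty \<open>F\<close>, that is, of an
    empty parameter space.\<close>
  define \<delta> where "\<delta> = Min (insert 1 (d ` F))"
  have \<delta>: "\<delta> > 0" "\<And>s. s \<in> F \<Longrightarrow> \<delta> \<le> d s"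
    using F Q by (auto simp: \<delta>_def Q_def subset_iff)
  show ?thesis
  proof (intro exI[of _ \<delta>] conjI allI impI, fact \<delta>, elim conjE)
    fix a b :: real assume ab: "a \<le> x" "x \<le> b" "b - a < \<delta>" "0 \<le> a" "b \<le> 1"
    have "\<exists>T. continuous_map P euclideanreal T \<and> (\<forall>s\<in>topspace P. a \<le> T s \<and> T s \<le> b) \<and>
        (\<forall>s0\<in>G. \<forall>s\<in>topspace P. f s0 s < 1/2 \<longrightarrow> T s = b) \<and> movable n Xt p P A h (\<lambda>_. a) T"
      if "finite G" "G \<subseteq> F" for G
      using that
    proof (induction G rule: finite_induct)
      case empty
      show ?case by (rule exI[of _ "\<lambda>_. a"]) (use ab in \<open>auto intro: movable_refl\<close>)
    next
      case (insert s0 G)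
      then obtain T where T: "continuous_map P euclideanreal T" "\<forall>s\<in>topspace P. a \<le> T s \<and> T s \<le> b"
        "\<forall>s0\<in>G. \<forall>s\<in>topspace P. f s0 s < 1/2 \<longrightarrow> T s = b" "movable n Xt p P A h (\<lambda>_. a) T" by auto
      have s0: "s0 \<in> F" "s0 \<in> topspace P" using insert F by auto
      \<comment> \<open>The bump \<mu> is 1 for \<open>f s0 s \<le> 1/2\<close> and 0 for
        \<open>f s0 s \<ge> 3/4\<close>. Taking the maximum with \<open>T\<close> keeps what the
        previous patches have reached.\<close>
      define \<mu> where "\<mu> = (\<lambda>s. max 0 (min 1 (3 - 4 * f s0 s)))"
      define T' where "T' = (\<lambda>s. max (T s) (a + (b - a) * \<mu> s))"
      have \<mu>01: "0 \<le> \<mu> s" "\<mu> s \<le> 1" for s by (auto simp: \<mu>_def)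
      have "(b - a) * \<mu> s \<le> (b - a) * 1" for s by (rule mult_left_mono) (use \<mu>01 ab in auto)
      then have T'b: "a \<le> T' s \<and> T' s \<le> b" if "s \<in> topspace P" for s
        using T(2) that by (auto simp: T'_def max_def algebra_simps)
      have T'c: "continuous_map P euclideanreal T'"
        unfolding T'_def \<mu>_def by (intro continuous_intros T(1) fc[OF s0(2)])
      obtain \<theta> where \<theta>: "slidable X (B s0) \<theta>" using Q[OF s0(2)] unfolding Q_def by blast
      have "movable n Xt p P A h T T'"
      proof (rule movable_step[OF cov \<theta> n h A hA])
        show "continuous_map P ?I T" "continuous_map P ?I T'"
          using T(1,2) T'c T'b ab by (auto simp: continuous_map_in_subtopology) (meson order_trans)+
        have "closedin P {s \<in> topspace P. f s0 s \<in> {..3/4}}"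
          by (rule closedin_continuous_map_preimage[OF fc[OF s0(2)]]) auto
        then show "closedin P {s \<in> topspace P. f s0 s \<le> 3/4}" by simp
        show "T' s = T s" if "s \<in> topspace P" "s \<notin> {s \<in> topspace P. f s0 s \<le> 3/4}" for s
        proof -
          have "\<mu> s = 0" using that by (auto simp: \<mu>_def)
          then show ?thesis using T(2) that(1) by (simp add: T'_def)
        qed
        show "p (h (s, t)) \<in> B s0" if "s \<in> {s \<in> topspace P. f s0 s \<le> 3/4}" "T s \<le> t" "t \<le> T' s" for s t
        proof -
          have sP: "s \<in> topspace P" "f s0 s \<le> 3/4" using that(1) by auto
          have t: "a \<le> t" "t \<le> b" using that(2,3) T(2) T'b[OF sP(1)] sP(1) by force+
          then have "\<bar>t - x\<bar> < d s0" using ab \<delta>(2)[OF s0(1)] by auto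
          moreover have "t \<in> {0..1}" using t ab by auto
          ultimately show ?thesis using Q[OF s0(2)] sP unfolding Q_def by blast
        qed
        show "T s \<le> T' s" for s by (simp add: T'_def)
      qed auto
      then have "movable n Xt p P A h (\<lambda>_. a) T'" using movable_trans[OF T(4)] by blast
      moreover have "T' s = b" if "s \<in> topspace P" "s1 \<in> insert s0 G" "f s1 s < 1/2" for s s1
      proof (cases "s1 = s0")
        case True
        then have "\<mu> s = 1" using that by (auto simp: \<mu>_def)
        then show ?thesis using T(2) that(1) by (auto simp: T'_def max_def)
      next
        case False
        then have "T s = b" using that T(3) by blast
        then show ?thesis using T'b[OF that(1)] by (simp add: T'_def)
      qed
      ultimately show ?case using T'c T'b by (intro exI[of _ T']) blast
    qed
    from this[OF F(2) order.refl] obtain T where T: "\<forall>s0\<in>F. \<forall>s\<in>topspace P. f s0 s < 1/2 \<longrightarrow> T s = b"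
      "movable n Xt p P A h (\<lambda>_. a) T" by blast
    have Tb: "T s = b" if s: "s \<in> topspace P" for s
    proof -
      obtain s0 where "s0 \<in> F" "s \<in> ?O s0" using s \<F>(3) unfolding F(3) by blast
      then show ?thesis using T(1) s by simp
    qed
    show "movable n Xt p P A h (\<lambda>_. a) (\<lambda>_. b)"
      by (rule movable_trans[OF T(2) movable_refl[OF Tb]])
  qed
qed

text \<open>Compactness of the time interval, in the form of the Bolzano principle, chains the short
  moves.\<close>

lemma movable_01:
  assumes cov: "covering_map Xt X p" and n: "n \<ge> 1"
    and slide: "\<And>x. x \<in> topspace X \<Longrightarrow> \<exists>B \<theta>. x \<in> B \<and> slidable X B \<theta>"
    and P: "compact_space P" "completely_regular_space P"
    and h: "continuous_map (prod_topology P (top_of_set {0..1::real})) Xt h"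
    and A: "A \<subseteq> topspace P" and hA: "\<And>s t. s \<in> A \<Longrightarrow> t \<in> {0..1} \<Longrightarrow> h (s, t) = h (s, 0)"
  shows "movable n Xt p P A h (\<lambda>_. 0) (\<lambda>_. 1)"
proof -
  define Pr where "Pr \<equiv> \<lambda>a b. 0 \<le> a \<longrightarrow> b \<le> 1 \<longrightarrow> movable n Xt p P A h (\<lambda>_. a) (\<lambda>_. b)"
  have "Pr 0 1"
    using zero_le_one
  proof (induction rule: Bolzano)
    case (trans a b c)
    then show ?case unfolding Pr_def using movable_trans[of n Xt p P A h "\<lambda>_. a" "\<lambda>_. b" "\<lambda>_. c"] by auto
  next
    case (local x)
    then have "x \<in> {0..1}" by simp
    then show ?case unfolding Pr_def
      using movable_local[OF cov n slide P h A hA, of x] by simp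
  qed
  then show ?thesis by (simp add: Pr_def)
qed

section \<open>Cubes as parameter spaces, and the inclusion of configurations with fixed first
  point\<close>

lemma compact_space_cube: "compact_space (cube k)"
  unfolding cube_def by (auto simp: compact_space_product_topology compact_space_subtopology)

lemma Hausdorff_space_cube: "Hausdorff_space (cube k)"
  unfolding cube_def by (auto simp: Hausdorff_space_product_topology Hausdorff_space_subtopology)

lemma normal_space_cube: "normal_space (cube k)"
  using compact_Hausdorff_or_regular_imp_normal_space compact_space_cube Hausdorff_space_cube by blast

lemma completely_regular_space_cube: "completely_regular_space (cube k)"
  using normal_imp_completely_regular_space normal_space_cube Hausdorff_space_cube
    Hausdorff_imp_t1_space by blast

lemma power_space_nonempty: "topspace Xt \<noteq> {} \<Longrightarrow> topspace (power_space n Xt) \<noteq> {}"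
  by (simp add: topspace_power_space PiE_eq_empty_iff)

lemma contractible_space_power_space:
  "contractible_space Xt \<Longrightarrow> contractible_space (power_space n Xt)"
  unfolding power_space_def by (simp add: contractible_space_product_topology)

definition insert_point :: "nat \<Rightarrow> 'b \<Rightarrow> (nat \<Rightarrow> 'b) \<Rightarrow> nat \<Rightarrow> 'b" where
  "insert_point m Q z = (\<lambda>i\<in>{1..Suc m}. if i = 1 then Q else z (i - 1))"

text \<open>The first points of a family of configurations are moved to \<open>Q\<close> along a contraction of \<open>Xt\<close>,
  dragging the other points along.\<close>

lemma compression_insert_point:
  assumes cov: "covering_map Xt X p" and Xt: "contractible_space Xt" and Q: "Q \<in> topspace Xt"
    and slide: "\<And>x. x \<in> topspace X \<Longrightarrow> \<exists>B \<theta>. x \<in> B \<and> slidable X B \<theta>"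
  shows "compression (config_cover m (subtopology Xt (p -` (topspace X - {p Q}))) p)
    (config_cover (Suc m) Xt p) (insert_point m Q)"
  unfolding compression_def
proof (intro conjI allI impI)
  let ?Xt' = "subtopology Xt (p -` (topspace X - {p Q}))"
  let ?C' = "config_cover m ?Xt' p" and ?C = "config_cover (Suc m) Xt p"
  let ?I = "top_of_set {0..1::real}"
  have C'1: "z \<in> extensional {1..m}" "\<And>i. i \<in> {1..m} \<Longrightarrow> p (z i) \<noteq> p Q"
    "\<And>i j. i \<in> {1..m} \<Longrightarrow> j \<in> {1..m} \<Longrightarrow> i \<noteq> j \<Longrightarrow> p (z i) \<noteq> p (z j)"
    if "z \<in> topspace ?C'" for z
    using that unfolding config_cover_def topspace_subtopology topspace_power_space distinct_points_def power_map_def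
    by (auto simp: PiE_iff)
  show "continuous_map ?C' ?C (insert_point m Q)"
    unfolding continuous_map_into_config_cover
  proof (intro conjI ballI impI)
    have id: "continuous_map ?C' (power_space m ?Xt') (\<lambda>z. z)"
      unfolding config_cover_def by (rule continuous_map_from_subtopology) simp
    show "continuous_map ?C' (power_space (Suc m) Xt) (insert_point m Q)"
      unfolding continuous_map_into_power_space
    proof (intro conjI ballI)
      fix i assume i: "i \<in> {1..Suc m}"
      show "continuous_map ?C' Xt (\<lambda>z. insert_point m Q z i)"
      proof (cases "i = 1")
        case True
        then show ?thesis using Q by (simp add: insert_point_def)
      next
        case False
        then have "i - 1 \<in> {1..m}" using i by auto
        from continuous_map_compose[OF id power_space_component[OF this]]
        have "continuous_map ?C' Xt (\<lambda>z. z (i - 1))"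
          by (simp add: continuous_map_in_subtopology o_def)
        then show ?thesis using False i by (simp add: insert_point_def)
      qed
    qed (auto simp: insert_point_def)
    fix z i j assume z: "z \<in> topspace ?C'" and ij: "i \<in> {1..Suc m}" "j \<in> {1..Suc m}" "i \<noteq> j"
    have "i = 1 \<or> i - 1 \<in> {1..m}" "j = 1 \<or> j - 1 \<in> {1..m}" using ij by auto
    moreover have "i - 1 \<noteq> j - 1" using ij by simp linarith
    ultimately show "p (insert_point m Q z i) \<noteq> p (insert_point m Q z j)"
      using C'1(2)[OF z, of "i - 1"] C'1(2)[OF z, of "j - 1"] C'1(3)[OF z, of "i - 1" "j - 1"] ij
      by (auto simp: insert_point_def)
  qed
  fix k b a
  assume b: "continuous_map (cube k) ?C b"
    and a: "continuous_map (subtopology (cube k) (cube_boundary k)) ?C' a"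
    and ab: "\<forall>s\<in>cube_boundary k. insert_point m Q (a s) = b s"
  have aC: "a s \<in> topspace ?C'" if "s \<in> cube_boundary k" for s
    using continuous_map_image_subset_topspace[OF a] that topspace_subtopology_cube_boundary by blast
  have bQ: "b s 1 = Q" if "s \<in> cube_boundary k" for s
    using ab[rule_format, OF that, symmetric] by (simp add: insert_point_def)
  have b1: "continuous_map (cube k) Xt (\<lambda>s. b s 1)"
  proof -
    have "continuous_map (cube k) (power_space (Suc m) Xt) b" using b by (simp add: continuous_map_into_config_cover)
    from continuous_map_compose[OF this power_space_component[of 1 "Suc m"]] show ?thesis by (simp add: o_def)
  qed
  \<comment> \<open>Boundary values for a homotopy of the first points to \<open>Q\<close> that
    rests at \<open>Q\<close> over the boundary of the cube; it exists because \<open>Xt\<close> is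
    contractible.\<close>
  obtain c where c: "continuous_map (subtopology (cube (Suc k)) (cube_boundary (Suc k))) Xt c"
    "\<And>s. s \<in> topspace (cube k) \<Longrightarrow> c (cube_join k (0, s)) = b s 1"
    "\<And>s. s \<in> topspace (cube k) \<Longrightarrow> c (cube_join k (1, s)) = Q"
    "\<And>r s. r \<in> {0..1} \<Longrightarrow> s \<in> cube_boundary k \<Longrightarrow> c (cube_join k (r, s)) = Q"
    by (rule cube_boundary_Suc_glue[OF b1, of "\<lambda>_. Q" "\<lambda>_. Q"]) (use Q bQ in auto)
  obtain C where C: "continuous_map (cube (Suc k)) Xt C" "\<And>s. s \<in> cube_boundary (Suc k) \<Longrightarrow> C s = c s"
    using contractible_space_fills[OF Xt] Q c(1) unfolding fills_def by blast
  define h where "h = (\<lambda>z. C (cube_join k (snd z, fst z)))"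
  have "continuous_map (prod_topology ?I (cube k)) Xt (C \<circ> cube_join k)"
    by (rule continuous_map_compose[OF continuous_map_cube_join C(1)])
  from continuous_map_swap_args[OF this] have h: "continuous_map (prod_topology (cube k) ?I) Xt h"
    by (simp add: h_def)
  have hc: "h (s, r) = c (cube_join k (r, s))"
    if "r \<in> {0..1}" "s \<in> topspace (cube k)" "r = 0 \<or> r = 1 \<or> s \<in> cube_boundary k" for r s
    using C(2) cube_join_boundary_iff[OF that(1,2)] that(3) by (simp add: h_def)
  have hQ: "h (s, r) = Q" if "s \<in> cube_boundary k" "r \<in> {0..1}" for s r
    using hc[OF that(2)] c(4)[OF that(2,1)] that(1) cube_boundary_subset by blast
  have "movable (Suc m) Xt p (cube k) (cube_boundary k) h (\<lambda>_. 0) (\<lambda>_. 1)"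
    by (rule movable_01[OF cov _ slide compact_space_cube completely_regular_space_cube h cube_boundary_subset])
      (use hQ in auto)
  moreover have "\<forall>s\<in>topspace (cube k). b s 1 = h (s, 0)" using hc[of 0] c(2) by auto
  ultimately obtain b' where b': "continuous_map (cube k) ?C b'" "\<forall>s\<in>topspace (cube k). b' s 1 = h (s, 1)"
    "homotopic_with (\<lambda>f. \<forall>s\<in>cube_boundary k. f s = b s) (cube k) ?C b b'"
    using b unfolding movable_def by blast
  have b'Q: "b' s 1 = Q" if "s \<in> topspace (cube k)" for s
    using b'(2) hc[of 1 s] c(3) that by auto
  have b'X: "continuous_map (cube k) (power_space (Suc m) Xt) b'"
    and b'd: "\<And>s i j. s \<in> topspace (cube k) \<Longrightarrow> i \<in> {1..Suc m} \<Longrightarrow> j \<in> {1..Suc m} \<Longrightarrow> i \<noteq> j \<Longrightarrow> p (b' s i) \<noteq> p (b' s j)"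
    using b'(1) unfolding continuous_map_into_config_cover by auto
  have b'b: "b' s = b s" if "s \<in> cube_boundary k" for s
    using homotopic_with_imp_property[OF b'(3)] that by blast
  \<comment> \<open>The first point is now \<open>Q\<close> for every parameter, so omitting it
    loses nothing, and the other points avoid the fibre through \<open>Q\<close>.\<close>
  define a' where "a' = (\<lambda>s. \<lambda>i\<in>{1..m}. b' s (Suc i))"
  have "continuous_map (cube k) ?C' a'"
    unfolding continuous_map_into_config_cover
  proof (intro conjI ballI impI)
    show "continuous_map (cube k) (power_space m ?Xt') a'"
      unfolding continuous_map_into_power_space
    proof (intro conjI ballI)
      fix i assume i: "i \<in> {1..m}"
      then have i': "Suc i \<in> {1..Suc m}" by auto
      have cs: "continuous_map (cube k) Xt (\<lambda>s. b' s (Suc i))"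
        using continuous_map_compose[OF b'X power_space_component[OF i']] by (simp add: o_def)
      have "p (b' s (Suc i)) \<in> topspace X - {p Q}" if s: "s \<in> topspace (cube k)" for s
      proof -
        have "b' s (Suc i) \<in> topspace Xt" using cs s by (auto simp: continuous_map_def)
        then have "p (b' s (Suc i)) \<in> topspace X" using covering_map_image[OF cov] by blast
        moreover have "p (b' s (Suc i)) \<noteq> p Q" using b'd[OF s i', of 1] b'Q[OF s] i by simp
        ultimately show ?thesis by simp
      qed
      then have "continuous_map (cube k) ?Xt' (\<lambda>s. b' s (Suc i))"
        using cs by (auto simp: continuous_map_in_subtopology)
      then show "continuous_map (cube k) ?Xt' (\<lambda>s. a' s i)" using i by (simp add: a'_def)
    qed (auto simp: a'_def)
    fix s i j assume "s \<in> topspace (cube k)" "i \<in> {1..m}" "j \<in> {1..m}" "i \<noteq> j"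
    then show "p (a' s i) \<noteq> p (a' s j)" using b'd[of s "Suc i" "Suc j"] by (simp add: a'_def)
  qed
  moreover have "a' s = a s" if s: "s \<in> cube_boundary k" for s
  proof
    fix i
    have "b' s = insert_point m Q (a s)" using ab s b'b[OF s] by simp
    then show "a' s i = a s i" using C'1(1)[OF aC[OF s]]
      by (cases "i \<in> {1..m}") (auto simp: a'_def insert_point_def extensional_def)
  qed
  moreover have "insert_point m Q (a' s) = b' s" if s: "s \<in> topspace (cube k)" for s
  proof
    fix i
    have "b' s \<in> extensional {1..Suc m}" using b'X s by (auto simp: continuous_map_into_power_space)
    then show "insert_point m Q (a' s) i = b' s i" using b'Q[OF s]
      by (cases "i \<in> {1..Suc m}") (auto simp: a'_def insert_point_def extensional_def)
  qed
  moreover obtain hh where "continuous_map (prod_topology ?I (cube k)) ?C hh"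
    "\<forall>s\<in>topspace (cube k). hh (0, s) = b s" "\<forall>s\<in>topspace (cube k). hh (1, s) = b' s"
    "\<forall>t\<in>{0..1}. \<forall>s\<in>cube_boundary k. hh (t, s) = b s"
    using b'(3) unfolding homotopic_rel_iff[OF cube_boundary_subset] by blast
  ultimately show "\<exists>a' h. continuous_map (cube k) ?C' a' \<and> (\<forall>s\<in>cube_boundary k. a' s = a s) \<and>
      continuous_map (prod_topology ?I (cube k)) ?C h \<and>
      (\<forall>s\<in>topspace (cube k). h (0, s) = b s \<and> h (1, s) = insert_point m Q (a' s)) \<and>
      (\<forall>t\<in>{0..1}. \<forall>s\<in>cube_boundary k. h (t, s) = b s)"
    by (intro exI[of _ a'] exI[of _ hh]) auto
qed

subsection \<open>General position\<close>

text \<open>Perturbations are vectors of the type \<open>real \<times> real \<times> real\<close>,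
  in which negligible sets make sense; they act on the first three of the \<open>d\<close>
  coordinates.\<close>

definition embed3 :: "real \<times> real \<times> real \<Rightarrow> nat \<Rightarrow> real" where
  "embed3 v i = (if i = 0 then fst v else if i = 1 then fst (snd v) else if i = 2 then snd (snd v) else 0)"

lemma embed3_0 [simp]: "embed3 0 i = 0"
  by (simp add: embed3_def)

lemma sum_abs_embed3_le:
  assumes "d \<ge> 3"
  shows "(\<Sum>i<d. \<bar>embed3 v i\<bar>) \<le> 3 * norm v"
proof -
  have "(\<Sum>i<d. \<bar>embed3 v i\<bar>) = (\<Sum>i\<in>{0, 1, 2}. \<bar>embed3 v i\<bar>)"
    by (rule sum.mono_neutral_right) (use assms in \<open>auto simp: embed3_def\<close>)
  also have "\<dots> = \<bar>fst v\<bar> + \<bar>fst (snd v)\<bar> + \<bar>snd (snd v)\<bar>" by (simp add: embed3_def)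
  also have "\<dots> \<le> norm v + norm (snd v) + norm (snd v)"
    using norm_fst_le[of "fst v" "snd v"] norm_fst_le[of "fst (snd v)" "snd (snd v)"]
      norm_snd_le[of "snd (snd v)" "fst (snd v)"] by simp
  also have "\<dots> \<le> 3 * norm v" using norm_snd_le[of "snd v" "fst v"] by simp
  finally show ?thesis .
qed

lemma continuous_map_embed3: "continuous_map euclidean euclideanreal (\<lambda>v. embed3 v i)"
  by (cases "i = 0"; cases "i = 1"; cases "i = 2") (auto simp: embed3_def intro!: continuous_intros)

text \<open>The inequality 2 < 3 enters here: the polynomial image of a plane in 3-space is
  negligible and cannot fill a ball. One half of \<open>e\<close> is spent on the approximation, the
  other on the translation \<open>v\<close>.\<close>

lemma polynomial_avoiding_0:
  fixes f :: "real \<times> real \<Rightarrow> real \<times> real \<times> real"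
  assumes S: "compact S" and f: "continuous_on S f" and e: "e > 0"
  obtains q where "continuous_on UNIV q" "\<And>x. x \<in> S \<Longrightarrow> norm (q x - f x) < e" "\<And>x. x \<in> S \<Longrightarrow> q x \<noteq> 0"
proof -
  obtain g where g: "polynomial_function g" "\<And>x. x \<in> S \<Longrightarrow> norm (f x - g x) < e / 2"
    using Stone_Weierstrass_polynomial_function[OF S f, of "e / 2"] e by auto
  have "negligible (g ` S)"
    by (rule negligible_differentiable_image_lowdim[OF _ differentiable_on_polynomial_function[OF g(1)]]) simp
  moreover have "\<not> negligible (ball (0 :: real \<times> real \<times> real) (e / 2))"
    by (rule open_not_negligible) (use e in auto)
  ultimately obtain v where v: "v \<in> ball 0 (e / 2)" "v \<notin> g ` S"
    using negligible_subset by blast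
  show ?thesis
  proof (rule that[of "\<lambda>x. g x - v"])
    show "continuous_on UNIV (\<lambda>x. g x - v)"
      by (intro continuous_intros continuous_on_polymonial_function g(1))
    show "norm ((g x - v) - f x) < e" if "x \<in> S" for x
    proof -
      have "(g x - v) - f x = (g x - f x) - v" by (simp add: algebra_simps)
      then have "norm ((g x - v) - f x) \<le> norm (g x - f x) + norm v"
        using norm_triangle_ineq4[of "g x - f x" v] by (simp only:)
      moreover have "norm v < e / 2" using v(1) by simp
      ultimately show ?thesis using g(2)[OF that] by (simp add: norm_minus_commute)
    qed
    show "g x - v \<noteq> 0" if "x \<in> S" for x using v(2) that by auto
  qed
qed

text \<open>The first three coordinates are approximated by polynomials in the two parameters; the image of
  these is negligible, so a small translation makes them avoid the origin.\<close>

lemma perturb_nonzero: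
  assumes k: "k \<le> 2" and d: "d \<ge> 3" and N: "closedin (cube k) N"
    and w: "\<And>i. i < d \<Longrightarrow> continuous_map (subtopology (cube k) N) euclideanreal (\<lambda>s. w s i)"
    and e: "e > 0"
  obtains u where "continuous_map (subtopology (cube k) N) euclidean u"
    "\<And>s. s \<in> N \<Longrightarrow> norm (u s) < e"
    "\<And>s. s \<in> N \<Longrightarrow> (\<Sum>i<d. \<bar>w s i\<bar>) \<ge> e \<Longrightarrow> u s = 0"
    "\<And>s. s \<in> N \<Longrightarrow> \<exists>i<d. w s i + embed3 (u s) i \<noteq> 0"
proof -
  let ?N = "subtopology (cube k) N"
  have Ntop: "topspace ?N = N" using closedin_subset[OF N] by auto
  \<comment> \<open>\<open>\<rho>\<close> embeds the cube of dimension at most 2 into the plane,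
    padding by zeros, and \<open>\<sigma>\<close> is a left inverse; so functions on
    \<open>N\<close> become functions on the compact plane set \<open>S\<close>.\<close>
  define \<rho> where "\<rho> = (\<lambda>t :: nat \<Rightarrow> real. (if 0 < k then t 0 else 0, if 1 < k then t 1 else 0))"
  define \<sigma> where "\<sigma> = (\<lambda>z :: real \<times> real. \<lambda>i\<in>{..<k}. if i = 0 then fst z else snd z)"
  let ?sq = "{0..1::real} \<times> {0..1::real}"
  have \<sigma>c: "continuous_map (top_of_set ?sq) (cube k) \<sigma>"
    unfolding continuous_map_into_cube
  proof (intro conjI allI impI ballI)
    fix i assume i: "i < k"
    show "continuous_map (top_of_set ?sq) euclideanreal (\<lambda>z. \<sigma> z i)"
      using i by (cases "i = 0") (auto simp: \<sigma>_def intro!: continuous_intros)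
    show "\<sigma> z i \<in> {0..1}" if "z \<in> topspace (top_of_set ?sq)" for z
      using i that by (auto simp: \<sigma>_def)
  qed (auto simp: \<sigma>_def)
  have \<sigma>\<rho>: "\<sigma> (\<rho> t) = t" if "t \<in> topspace (cube k)" for t
  proof
    fix i
    show "\<sigma> (\<rho> t) i = t i"
    proof (cases "i < k")
      case True
      then have "i = 0 \<or> i = 1" using k by auto
      then show ?thesis using True by (auto simp: \<sigma>_def \<rho>_def)
    next
      case False
      then show ?thesis using that by (auto simp: \<sigma>_def topspace_cube PiE_def extensional_def)
    qed
  qed
  have \<rho>sq: "\<rho> t \<in> ?sq" if "t \<in> topspace (cube k)" for t
    using that by (auto simp: \<rho>_def topspace_cube PiE_iff)
  define S where "S = {z \<in> ?sq. \<sigma> z \<in> N}"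
  have cS: "compact S"
  proof -
    have "closedin (top_of_set ?sq) {z \<in> topspace (top_of_set ?sq). \<sigma> z \<in> N}"
      by (rule closedin_continuous_map_preimage[OF \<sigma>c N])
    then have "closedin (top_of_set ?sq) S" by (simp add: S_def)
    moreover have "compact ?sq" by (intro compact_Times) auto
    ultimately show ?thesis using closedin_compact by blast
  qed
  define a where "a = (\<lambda>s. (w s 0, w s 1, w s 2))"
  have ac: "continuous_map ?N euclidean a"
    unfolding a_def using w[of 0] w[of 1] w[of 2] d
    by (auto simp: euclidean_product_topology simp flip: prod_topology_euclidean intro!: continuous_map_pairedI)
  have "continuous_map (top_of_set S) ?N \<sigma>"
    unfolding continuous_map_in_subtopology
    using continuous_map_from_subtopology[OF \<sigma>c, of S] by (auto simp: S_def subtopology_subtopology Int_absorb1)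
  from continuous_map_compose[OF this ac] have "continuous_on S (a \<circ> \<sigma>)" by simp
  \<comment> \<open>The bound \<open>e / 6\<close> comes from the factor 3 in
    \<open>sum_abs_embed3_le\<close>: the sum of the absolute values of the perturbation is then
    less than \<open>e / 2\<close>.\<close>
  then obtain q where q: "continuous_on UNIV q" "\<And>z. z \<in> S \<Longrightarrow> norm (q z - (a \<circ> \<sigma>) z) < e / 6"
    "\<And>z. z \<in> S \<Longrightarrow> q z \<noteq> 0"
    using polynomial_avoiding_0[OF cS, of "a \<circ> \<sigma>" "e / 6"] e by auto
  have \<rho>S: "\<rho> s \<in> S" "\<sigma> (\<rho> s) = s" if "s \<in> N" for s
  proof -
    have "s \<in> topspace (cube k)" using that closedin_subset[OF N] by blast
    then show "\<rho> s \<in> S" "\<sigma> (\<rho> s) = s" using \<sigma>\<rho> \<rho>sq that by (auto simp: S_def)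
  qed
  define l where "l = (\<lambda>s. \<Sum>i<d. \<bar>w s i\<bar>)"
  \<comment> \<open>Equal to 1 where \<open>l s \<le> e / 2\<close> and to 0 where
    \<open>l s \<ge> e\<close>.\<close>
  define cut where "cut = (\<lambda>s. max 0 (min 1 (2 - 2 * l s / e)))"
  define u where "u = (\<lambda>s. cut s *\<^sub>R (q (\<rho> s) - a s))"
  have lc: "continuous_map ?N euclideanreal l"
    unfolding l_def by (intro continuous_map_sum continuous_map_real_abs w) auto
  have cutc: "continuous_map ?N euclideanreal cut"
    unfolding cut_def by (intro continuous_intros lc) (use e in auto)
  have \<rho>c: "continuous_map ?N euclidean \<rho>"
  proof -
    have "continuous_map ?N euclideanreal (\<lambda>t. if 0 < k then t 0 else 0)"
      by (cases "0 < k") (auto intro: continuous_map_from_subtopology continuous_map_cube_component_real)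
    moreover have "continuous_map ?N euclideanreal (\<lambda>t. if 1 < k then t 1 else 0)"
      by (cases "1 < k") (auto intro: continuous_map_from_subtopology continuous_map_cube_component_real)
    ultimately show ?thesis unfolding \<rho>_def
      by (auto simp flip: prod_topology_euclidean intro!: continuous_map_pairedI)
  qed
  have qc: "continuous_map ?N euclidean (q \<circ> \<rho>)"
    by (rule continuous_map_compose[OF \<rho>c]) (use q(1) in simp)
  have uc: "continuous_map ?N euclidean u"
  proof -
    have "continuous_map ?N (prod_topology euclideanreal (prod_topology euclidean euclidean))
        (\<lambda>s. (cut s, (q \<circ> \<rho>) s, a s))"
      by (intro continuous_map_pairedI cutc qc ac)
    moreover have "continuous_map (prod_topology euclideanreal (prod_topology euclidean euclidean)) euclidean
        (\<lambda>z :: real \<times> (real \<times> real \<times> real) \<times> (real \<times> real \<times> real). fst z *\<^sub>R (fst (snd z) - snd (snd z)))"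
      by (auto intro!: continuous_intros)
    ultimately have "continuous_map ?N euclidean
        ((\<lambda>z. fst z *\<^sub>R (fst (snd z) - snd (snd z))) \<circ> (\<lambda>s. (cut s, (q \<circ> \<rho>) s, a s)))"
      by (rule continuous_map_compose)
    then show ?thesis by (simp add: u_def o_def)
  qed
  have cut01: "0 \<le> cut s" "cut s \<le> 1" for s by (auto simp: cut_def)
  have un: "norm (u s) < e / 6" if "s \<in> N" for s
  proof -
    have "norm (u s) = cut s * norm (q (\<rho> s) - a s)" using cut01 by (simp add: u_def)
    also have "\<dots> \<le> 1 * norm (q (\<rho> s) - a s)" by (rule mult_right_mono) (use cut01 in auto)
    also have "\<dots> < e / 6" using q(2)[OF \<rho>S(1)[OF that]] \<rho>S(2)[OF that] by simp
    finally show ?thesis .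
  qed
  show ?thesis
  proof (rule that[OF uc])
    fix s assume s: "s \<in> N"
    show "norm (u s) < e" using un[OF s] e by simp
    show "u s = 0" if "(\<Sum>i<d. \<bar>w s i\<bar>) \<ge> e"
    proof -
      have "l s / e \<ge> 1" using that e by (simp add: l_def)
      then have "cut s = 0" by (simp add: cut_def)
      then show ?thesis by (simp add: u_def)
    qed
    show "\<exists>i<d. w s i + embed3 (u s) i \<noteq> 0"
    proof (rule ccontr)
      assume "\<not> ?thesis"
      then have z: "w s i = - embed3 (u s) i" if "i < d" for i using that by (simp add: eq_neg_iff_add_eq_0)
      \<comment> \<open>If the perturbed vector vanished, \<open>w s\<close> would be as small as
        the perturbation, so \<open>l s < e / 2\<close>. There the cut-off is 1 and the first three
        perturbed coordinates form \<open>q (\<rho> s)\<close>, which is not 0.\<close>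
      have "l s = (\<Sum>i<d. \<bar>embed3 (u s) i\<bar>)" unfolding l_def by (rule sum.cong) (use z in auto)
      then have "l s \<le> 3 * norm (u s)" using sum_abs_embed3_le[OF d] by simp
      then have "l s < e / 2" using un[OF s] by simp
      then have "cut s = 1" using e by (simp add: cut_def field_simps)
      then have "a s + u s = q (\<rho> s)" by (simp add: u_def)
      moreover have "a s + u s = 0"
        using z[of 0] z[of 1] z[of 2] d by (auto simp: a_def embed3_def prod_eq_iff)
      ultimately show False using q(3)[OF \<rho>S(1)[OF s]] by simp
    qed
  qed
qed

text \<open>The condition \<open>G\<close> expresses closeness to \<open>f\<close>: it contains the graph of \<open>f\<close>, and that of \<open>f'\<close> has to stay inside.\<close>

lemma general_position_local:
  assumes k: "k \<le> 2" and d: "d \<ge> 3" and ch: "chart d X U V c c'"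
    and f: "continuous_map (cube k) X f" and g: "continuous_map (cube k) X g"
    and G: "openin (prod_topology (cube k) X) G" and fG: "\<And>s. s \<in> topspace (cube k) \<Longrightarrow> (s, f s) \<in> G"
    and K: "closedin (cube k) K" and KU: "\<And>s. s \<in> K \<Longrightarrow> f s \<in> U \<and> g s \<in> U"
    and A: "closedin (cube k) A" and fgA: "\<And>s. s \<in> A \<Longrightarrow> f s \<noteq> g s"
  obtains f' where "continuous_map (cube k) X f'"
    "homotopic_with (\<lambda>h. \<forall>s\<in>A. h s = f s) (cube k) X f f'"
    "\<And>s. s \<in> topspace (cube k) \<Longrightarrow> (s, f' s) \<in> G" "\<And>s. s \<in> K \<Longrightarrow> f' s \<noteq> g s"
proof -
  let ?P = "cube k" and ?E = "Euclidean_space d"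
  let ?I = "top_of_set {0..1::real}"
  have U: "openin X U" and V: "openin ?E V" and c: "continuous_map (subtopology X U) ?E c"
    and c': "continuous_map (subtopology ?E V) X c'"
    and cV: "\<And>x. x \<in> U \<Longrightarrow> c x \<in> V" and c'c: "\<And>x. x \<in> U \<Longrightarrow> c' (c x) = x"
    and c'U: "\<And>y. y \<in> V \<Longrightarrow> c' y \<in> U" and cc': "\<And>y. y \<in> V \<Longrightarrow> c (c' y) = y"
    using ch unfolding chart_def by auto
  have VE: "V \<subseteq> topspace ?E" using openin_subset[OF V] .
  have KP: "K \<subseteq> topspace ?P" and AP: "A \<subseteq> topspace ?P" using closedin_subset K A by blast+
  let ?N0 = "{s \<in> topspace ?P. f s \<in> U} \<inter> {s \<in> topspace ?P. g s \<in> U}"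
  have "openin ?P ?N0" using f g U by (intro openin_Int openin_continuous_map_preimage)
  then have "closedin ?P (topspace ?P - ?N0)" by blast
  moreover have "disjnt (topspace ?P - ?N0) K" using KU by (auto simp: disjnt_def)
  ultimately obtain lam where lam: "continuous_map ?P (top_of_set {0..1::real}) lam"
    "lam ` (topspace ?P - ?N0) \<subseteq> {0}" "lam ` K \<subseteq> {1}"
    by (rule Urysohn_lemma[OF normal_space_cube _ K _ zero_le_one])
  have lamc: "continuous_map ?P euclideanreal lam" using lam(1) by (simp add: continuous_map_in_subtopology)
  \<comment> \<open>\<open>N\<close> is a closed neighbourhood of \<open>K\<close> that carries the
    perturbation, and on \<open>N'\<close> the map stays as it is. They meet where
    \<open>lam\<close> is \<open>1/2\<close>; there the scaling factor \<open>\<eta>\<close> is 0,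
    whereas it is 1 on \<open>K\<close>.\<close>
  define N where "N = {s \<in> topspace ?P. lam s \<in> {1/2..}}"
  define N' where "N' = {s \<in> topspace ?P. lam s \<in> {..1/2}}"
  have N: "closedin ?P N" "closedin ?P N'"
    unfolding N_def N'_def by (rule closedin_continuous_map_preimage[OF lamc]; simp)+
  have NU: "f s \<in> U" "g s \<in> U" if "s \<in> N" for s
  proof -
    have "s \<in> ?N0" using that lam(2) unfolding N_def by (cases "s \<in> ?N0") auto
    then show "f s \<in> U" "g s \<in> U" by auto
  qed
  have NP: "N \<subseteq> topspace ?P" using closedin_subset[OF N(1)] .
  let ?N = "subtopology ?P N"
  have Ntop: "topspace ?N = N" using NP by auto
  define \<eta> where "\<eta> = (\<lambda>s. max 0 (2 * lam s - 1))"
  have \<eta>c: "continuous_map ?P euclideanreal \<eta>" unfolding \<eta>_def by (intro continuous_intros lamc)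
  have \<eta>01: "0 \<le> \<eta> s" "\<eta> s \<le> 1" if "s \<in> topspace ?P" for s
    using lam(1) that by (auto simp: \<eta>_def continuous_map_def Pi_iff)
  have fN: "continuous_map ?N (subtopology X U) f" "continuous_map ?N (subtopology X U) g"
    using NU Ntop by (auto simp: continuous_map_in_subtopology intro: continuous_map_from_subtopology f g)
  have cf: "continuous_map ?N ?E (\<lambda>s. c (f s))" "continuous_map ?N ?E (\<lambda>s. c (g s))"
    using continuous_map_compose[OF fN(1) c] continuous_map_compose[OF fN(2) c] by (simp_all add: o_def)
  let ?NR = "prod_topology ?N (euclidean :: (real \<times> real \<times> real) topology)"
  define m where "m = (\<lambda>z. \<lambda>i. c (f (fst z)) i + embed3 (snd z) i)"
  have mc: "continuous_map ?NR ?E m"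
  proof (rule continuous_map_into_Euclidean)
    fix i
    have "continuous_map ?NR euclideanreal ((\<lambda>s. c (f s) i) \<circ> fst)"
      by (rule continuous_map_compose[OF continuous_map_fst continuous_map_Euclidean_component[OF cf(1)]])
    moreover have "continuous_map ?NR euclideanreal ((\<lambda>v. embed3 v i) \<circ> snd)"
      by (rule continuous_map_compose[OF continuous_map_snd continuous_map_embed3])
    ultimately show "continuous_map ?NR euclideanreal (\<lambda>z. m z i)"
      unfolding m_def by (intro continuous_map_add) (simp_all add: o_def)
    fix z assume "z \<in> topspace ?NR"
    then have "c (f (fst z)) \<in> topspace ?E" using Ntop NU cV VE by auto
    then show "m z \<in> topspace ?E" using d by (simp add: m_def topspace_Euclidean_space embed3_def)
  qed
  \<comment> \<open>The perturbations that stay in the range of the chart, and in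
    \<open>\<Omega>'\<close> also those for which the graph stays in \<open>G\<close>. Both sets are
    open and contain \<open>N \<times> {0}\<close>; compactness of \<open>N\<close> gives a uniform
    bound \<open>e1\<close>.\<close>
  define \<Omega> where "\<Omega> = {z \<in> topspace ?NR. m z \<in> V}"
  have o\<Omega>: "openin ?NR \<Omega>" unfolding \<Omega>_def using mc V openin_continuous_map_preimage by blast
  have ec: "continuous_map (subtopology ?NR \<Omega>) X (c' \<circ> m)"
    by (rule continuous_map_compose[OF _ c'])
      (use mc in \<open>auto simp: continuous_map_in_subtopology \<Omega>_def intro: continuous_map_from_subtopology\<close>)
  define \<Omega>' where "\<Omega>' = {z \<in> topspace (subtopology ?NR \<Omega>). (fst z, (c' \<circ> m) z) \<in> G}"
  have "continuous_map ?NR ?N fst" by (rule continuous_map_fst)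
  then have fstc: "continuous_map ?NR ?P fst" by (simp add: continuous_map_in_subtopology)
  have "continuous_map (subtopology ?NR \<Omega>) (prod_topology ?P X) (\<lambda>z. (fst z, (c' \<circ> m) z))"
    by (rule continuous_map_pairedI[OF continuous_map_from_subtopology[OF fstc] ec])
  then have "openin (subtopology ?NR \<Omega>) \<Omega>'" unfolding \<Omega>'_def using G openin_continuous_map_preimage by blast
  then have o\<Omega>': "openin ?NR \<Omega>'" using o\<Omega> by (simp add: openin_open_subtopology)
  have m0: "m (s, 0) = c (f s)" for s by (simp add: m_def)
  have "N \<times> {0} \<subseteq> \<Omega>'"
  proof
    fix z :: "(nat \<Rightarrow> real) \<times> (real \<times> real \<times> real)" assume "z \<in> N \<times> {0}"
    then obtain s where s: "s \<in> N" "z = (s, 0)" by blast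
    then have "m z \<in> V" "c' (m z) = f s" using NU cV c'c m0 by auto
    then show "z \<in> \<Omega>'" using s Ntop fG NP by (auto simp: \<Omega>'_def \<Omega>_def)
  qed
  moreover have "compactin ?N N"
    using compact_space_cube N(1) closedin_compact_space NP by (auto simp: compactin_subtopology)
  ultimately obtain A' Vv where Vv: "openin euclidean Vv" "N \<subseteq> A'" "0 \<in> Vv" "A' \<times> Vv \<subseteq> \<Omega>'"
    using tube_lemma_left[OF o\<Omega>', of N 0] by auto
  have "open Vv" using Vv(1) by simp
  then have "\<exists>e>0. ball 0 e \<subseteq> Vv" using Vv(3) open_contains_ball[of Vv] by blast
  then obtain e1 where e1: "e1 > 0" "ball 0 e1 \<subseteq> Vv" by blast
  have in\<Omega>: "(s, v) \<in> \<Omega>'" if "s \<in> N" "norm v < e1" for s v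
  proof -
    have "v \<in> ball 0 e1" using that(2) by simp
    then have "(s, v) \<in> A' \<times> Vv" using Vv(2) e1(2) that(1) by blast
    then show ?thesis using Vv(4) by blast
  qed
  define w where "w = (\<lambda>s i. c (f s) i - c (g s) i)"
  define l where "l = (\<lambda>s. \<Sum>i<d. \<bar>w s i\<bar>)"
  have wc: "continuous_map ?N euclideanreal (\<lambda>s. w s i)" for i
    unfolding w_def by (intro continuous_map_diff continuous_map_Euclidean_component[OF cf(1)]
        continuous_map_Euclidean_component[OF cf(2)])
  have lc: "continuous_map ?N euclideanreal l"
    unfolding l_def by (intro continuous_map_sum continuous_map_real_abs wc) auto
  \<comment> \<open>A lower bound for the distance of \<open>f\<close> and \<open>g\<close> in the
    chart over \<open>A\<close>. A perturbation that vanishes at distance \<open>e2\<close> or more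
    leaves \<open>f\<close> unchanged there.\<close>
  obtain e2 where e2: "e2 > 0" "\<And>s. s \<in> A \<inter> N \<Longrightarrow> l s \<ge> e2"
  proof (cases "A \<inter> N = {}")
    case True
    then show ?thesis using that[of 1] by auto
  next
    case False
    have "closedin ?P (A \<inter> N)" using A N(1) by blast
    then have "compactin ?P (A \<inter> N)" using compact_space_cube closedin_compact_space by blast
    then have "compactin ?N (A \<inter> N)" by (simp add: compactin_subtopology)
    then have "compactin euclideanreal (l ` (A \<inter> N))" using image_compactin lc by blast
    then have "compact (l ` (A \<inter> N))" by simp
    then obtain s0 where s0: "s0 \<in> A \<inter> N" "\<And>s. s \<in> A \<inter> N \<Longrightarrow> l s0 \<le> l s"
      using compact_attains_inf[of "l ` (A \<inter> N)"] False by auto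
    have "l s0 > 0"
    proof (rule ccontr)
      assume "\<not> l s0 > 0"
      then have "l1_dist d (c (f s0)) (c (g s0)) \<le> 0" by (simp add: l_def w_def l1_dist_def)
      then have "c (f s0) = c (g s0)"
        by (rule l1_dist_le_0) (use s0(1) NU cV VE in blast)+
      then have "f s0 = g s0" using c'c NU s0(1) by (metis IntD2)
      then show False using fgA s0(1) by blast
    qed
    then show ?thesis using that[of "l s0"] s0(2) by blast
  qed
  obtain u where u: "continuous_map ?N euclidean u" "\<And>s. s \<in> N \<Longrightarrow> norm (u s) < min e1 e2"
    "\<And>s. s \<in> N \<Longrightarrow> (\<Sum>i<d. \<bar>w s i\<bar>) \<ge> min e1 e2 \<Longrightarrow> u s = 0"
    "\<And>s. s \<in> N \<Longrightarrow> \<exists>i<d. w s i + embed3 (u s) i \<noteq> 0"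
    by (rule perturb_nonzero[OF k d N(1), of w "min e1 e2"]) (use wc e1(1) e2(1) in auto)
  have uA: "u s = 0" if "s \<in> A" "s \<in> N" for s
    using u(3)[OF that(2)] e2(2)[of s] that by (simp add: l_def)
  define H where "H = (\<lambda>z. if snd z \<in> N then c' (m (snd z, (fst z * \<eta> (snd z)) *\<^sub>R u (snd z))) else f (snd z))"
  have sc: "norm ((t * \<eta> s) *\<^sub>R u s) < e1" if "t \<in> {0..1}" "s \<in> N" for t s
  proof -
    have sP: "s \<in> topspace ?P" using that(2) NP by blast
    have "\<bar>t * \<eta> s\<bar> \<le> 1 * 1" unfolding abs_mult by (rule mult_mono) (use that \<eta>01[OF sP] in auto)
    then have "\<bar>t * \<eta> s\<bar> * norm (u s) \<le> 1 * norm (u s)" by (intro mult_right_mono) auto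
    then show ?thesis using u(2)[OF that(2)] by simp
  qed
  have H\<Omega>: "(s, (t * \<eta> s) *\<^sub>R u s) \<in> \<Omega>'" if "t \<in> {0..1}" "s \<in> N" for t s
    by (rule in\<Omega>[OF that(2) sc[OF that]])
  have Hc: "continuous_map (prod_topology ?I ?P) X H"
  proof (rule continuous_map_paste_closed[where S = "{0..1} \<times> N" and T = "{0..1} \<times> N'"
        and f = "c' \<circ> m \<circ> (\<lambda>z. (snd z, (fst z * \<eta> (snd z)) *\<^sub>R u (snd z)))" and g = "f \<circ> snd"])
    show "closedin (prod_topology ?I ?P) ({0..1} \<times> N)" "closedin (prod_topology ?I ?P) ({0..1} \<times> N')"
      using N by (auto simp: closedin_prod_Times_iff)
    show "topspace (prod_topology ?I ?P) \<subseteq> {0..1} \<times> N \<union> {0..1} \<times> N'" by (auto simp: N_def N'_def)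
    have eq: "subtopology (prod_topology ?I ?P) ({0..1} \<times> N) = prod_topology ?I ?N"
      by (simp add: subtopology_Times subtopology_subtopology)
    have ft: "continuous_map (prod_topology ?I ?N) euclideanreal fst"
      using continuous_map_fst[of ?I ?N] by (simp add: continuous_map_in_subtopology)
    have \<eta>t: "continuous_map (prod_topology ?I ?N) euclideanreal (\<eta> \<circ> snd)"
      by (rule continuous_map_compose[OF continuous_map_snd continuous_map_from_subtopology[OF \<eta>c]])
    have ut: "continuous_map (prod_topology ?I ?N) euclidean (u \<circ> snd)"
      by (rule continuous_map_compose[OF continuous_map_snd u(1)])
    have "continuous_map (prod_topology ?I ?N) (prod_topology euclideanreal (prod_topology euclideanreal euclidean))
        (\<lambda>z. (fst z, (\<eta> \<circ> snd) z, (u \<circ> snd) z))"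
      by (intro continuous_map_pairedI ft \<eta>t ut)
    moreover have "continuous_map (prod_topology euclideanreal (prod_topology euclideanreal euclidean)) euclidean
        (\<lambda>z :: real \<times> real \<times> (real \<times> real \<times> real). (fst z * fst (snd z)) *\<^sub>R snd (snd z))"
      by (auto intro!: continuous_intros)
    ultimately have "continuous_map (prod_topology ?I ?N) euclidean
        ((\<lambda>z. (fst z * fst (snd z)) *\<^sub>R snd (snd z)) \<circ> (\<lambda>z. (fst z, (\<eta> \<circ> snd) z, (u \<circ> snd) z)))"
      by (rule continuous_map_compose)
    then have "continuous_map (prod_topology ?I ?N) euclidean (\<lambda>z. (fst z * \<eta> (snd z)) *\<^sub>R u (snd z))"
      by (simp add: o_def)
    then have "continuous_map (prod_topology ?I ?N) ?NR (\<lambda>z. (snd z, (fst z * \<eta> (snd z)) *\<^sub>R u (snd z)))"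
      by (intro continuous_map_pairedI continuous_map_snd)
    moreover have "(snd z, (fst z * \<eta> (snd z)) *\<^sub>R u (snd z)) \<in> \<Omega>" if "z \<in> topspace (prod_topology ?I ?N)" for z
      using H\<Omega>[of "fst z" "snd z"] that Ntop by (auto simp: \<Omega>'_def)
    ultimately have "continuous_map (prod_topology ?I ?N) (subtopology ?NR \<Omega>) (\<lambda>z. (snd z, (fst z * \<eta> (snd z)) *\<^sub>R u (snd z)))"
      by (auto simp: continuous_map_in_subtopology)
    from continuous_map_compose[OF this ec]
    show "continuous_map (subtopology (prod_topology ?I ?P) ({0..1} \<times> N)) X
        (c' \<circ> m \<circ> (\<lambda>z. (snd z, (fst z * \<eta> (snd z)) *\<^sub>R u (snd z))))" unfolding eq .
    show "continuous_map (subtopology (prod_topology ?I ?P) ({0..1} \<times> N')) X (f \<circ> snd)"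
      by (intro continuous_map_from_subtopology continuous_map_compose[OF continuous_map_snd f])
    fix z assume "z \<in> topspace (prod_topology ?I ?P)"
    show "H z = (c' \<circ> m \<circ> (\<lambda>z. (snd z, (fst z * \<eta> (snd z)) *\<^sub>R u (snd z)))) z" if "z \<in> {0..1} \<times> N"
      using that by (auto simp: H_def)
    show "H z = (f \<circ> snd) z" if z: "z \<in> {0..1} \<times> N'"
    proof (cases "snd z \<in> N")
      case True
      then have "\<eta> (snd z) = 0" using z by (auto simp: N_def N'_def \<eta>_def)
      then show ?thesis using True m0 c'c NU by (simp add: H_def)
    qed (simp add: H_def)
  qed
  have HA: "H (t, s) = f s" if "s \<in> A" for t s
    using uA[OF that] m0 c'c NU by (auto simp: H_def)
  have H0: "H (0, s) = f s" for s using m0 c'c NU by (auto simp: H_def)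
  show ?thesis
  proof (rule that[of "\<lambda>s. H (1, s)"])
    show "continuous_map ?P X (\<lambda>s. H (1, s))" by (rule continuous_map_slice_left[OF Hc]) simp
    show "homotopic_with (\<lambda>h. \<forall>s\<in>A. h s = f s) ?P X f (\<lambda>s. H (1, s))"
      unfolding homotopic_rel_iff[OF AP] using Hc H0 HA by blast
    show "(s, H (1, s)) \<in> G" if "s \<in> topspace ?P" for s
      using H\<Omega>[of 1 s] fG[OF that] by (auto simp: H_def \<Omega>'_def)
    show "H (1, s) \<noteq> g s" if s: "s \<in> K" for s
    proof
      assume eq: "H (1, s) = g s"
      have l1: "lam s = 1" using lam(3) s by blast
      then have sN: "s \<in> N" using s KP by (auto simp: N_def)
      have \<eta>1: "\<eta> s = 1" using l1 by (simp add: \<eta>_def)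
      have mV: "m (s, u s) \<in> V" using H\<Omega>[of 1 s] sN \<eta>1 by (simp add: \<Omega>'_def \<Omega>_def)
      have "c' (m (s, u s)) = g s" using eq sN \<eta>1 by (simp add: H_def)
      then have "m (s, u s) = c (g s)" using cc'[OF mV] by simp
      then have "m (s, u s) i = c (g s) i" for i by simp
      then have "w s i + embed3 (u s) i = 0" for i by (simp add: m_def w_def algebra_simps)
      then show False using u(4)[OF sN] by blast
    qed
  qed
qed

text \<open>Restricting an open condition to the parameters in a closed set keeps it open: outside
  \<open>K\<close> everything is allowed. In this way conditions over several closed pieces
  accumulate in one open set of graphs.\<close>

lemma openin_prod_outside:
  assumes "closedin P K" "openin (prod_topology P X) W"
  shows "openin (prod_topology P X) {z \<in> topspace (prod_topology P X). fst z \<in> K \<longrightarrow> z \<in> W}"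
proof -
  have "{z \<in> topspace (prod_topology P X). fst z \<in> K \<longrightarrow> z \<in> W} = (topspace P - K) \<times> topspace X \<union> W"
    using openin_subset[OF assms(2)] by auto
  moreover have "openin (prod_topology P X) ((topspace P - K) \<times> topspace X)"
    using assms(1) by (simp add: openin_prod_Times_iff openin_diff)
  ultimately show ?thesis using assms(2) by auto
qed

lemma openin_prod_graph_complement:
  assumes "Hausdorff_space X" "continuous_map P X g"
  shows "openin (prod_topology P X) {z \<in> topspace (prod_topology P X). snd z \<noteq> g (fst z)}"
proof -
  have "closedin (prod_topology P X) {z \<in> topspace (prod_topology P X). snd z = (g \<circ> fst) z}"
    by (rule closedin_continuous_maps_eq[OF assms(1) continuous_map_snd continuous_map_compose[OF continuous_map_fst assms(2)]])
  then have "openin (prod_topology P X) (topspace (prod_topology P X) - {z \<in> topspace (prod_topology P X). snd z = (g \<circ> fst) z})"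
    by blast
  moreover have "topspace (prod_topology P X) - {z \<in> topspace (prod_topology P X). snd z = (g \<circ> fst) z} =
    {z \<in> topspace (prod_topology P X). snd z \<noteq> g (fst z)}" by auto
  ultimately show ?thesis by simp
qed

text \<open>The cube is covered by finitely many closed pieces on each of which either
  \<open>f\<close> and \<open>g\<close> differ or both lie in one chart. The pieces are treated one
  after the other by \<open>general_position_local\<close>, with the perturbations so small that
  these alternatives, and the inequalities reached so far, persist.\<close>

lemma general_position_one:
  assumes k: "k \<le> 2" and d: "d \<ge> 3" and man: "topological_manifold d X"
    and f: "continuous_map (cube k) X f" and g: "continuous_map (cube k) X g"
    and G: "openin (prod_topology (cube k) X) G" and fG: "\<And>s. s \<in> topspace (cube k) \<Longrightarrow> (s, f s) \<in> G"
    and A: "closedin (cube k) A" and fgA: "\<And>s. s \<in> A \<Longrightarrow> f s \<noteq> g s"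
  obtains f' where "continuous_map (cube k) X f'"
    "homotopic_with (\<lambda>h. \<forall>s\<in>A. h s = f s) (cube k) X f f'"
    "\<And>s. s \<in> topspace (cube k) \<Longrightarrow> (s, f' s) \<in> G"
    "\<And>s. s \<in> topspace (cube k) \<Longrightarrow> f' s \<noteq> g s"
proof -
  let ?P = "cube k" and ?Q = "prod_topology (cube k) X"
  have haus: "Hausdorff_space X" using man by (simp add: topological_manifold_def)
  have reg: "neighbourhood_base_of (closedin ?P) ?P"
    unfolding neighbourhood_base_of_closedin
    using compact_Hausdorff_imp_regular_space compact_space_cube Hausdorff_space_cube by blast
  have fX: "f s \<in> topspace X" if "s \<in> topspace ?P" for s using f that by (auto simp: continuous_map_def)
  \<comment> \<open>\<open>R\<close> is an open condition on graphs that holds for \<open>f\<close>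
    and guarantees the alternative on \<open>K\<close> for every map with graph in \<open>R\<close>,
    so also for \<open>f\<close> after earlier perturbations.\<close>
  define good where "good K R \<longleftrightarrow> closedin ?P K \<and> openin ?Q R \<and> (\<forall>s\<in>topspace ?P. (s, f s) \<in> R) \<and>
    (\<forall>f1. (\<forall>s\<in>topspace ?P. (s, f1 s) \<in> R) \<longrightarrow> (\<forall>s\<in>K. f1 s \<noteq> g s) \<or>
       (\<exists>U V c c'. chart d X U V c c' \<and> (\<forall>s\<in>K. f1 s \<in> U \<and> g s \<in> U)))" for K R
  have "\<exists>W K R. openin ?P W \<and> s \<in> W \<and> W \<subseteq> K \<and> good K R" if s: "s \<in> topspace ?P" for s
  proof (cases "f s = g s")
    case True
    obtain U V c c' where ch: "f s \<in> U" "chart d X U V c c'"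
      by (rule topological_manifold_chart[OF man fX[OF s]])
    have U: "openin X U" using ch(2) by (simp add: chart_def)
    have "openin ?P ({s \<in> topspace ?P. f s \<in> U} \<inter> {s \<in> topspace ?P. g s \<in> U})"
      using f g U by (intro openin_Int openin_continuous_map_preimage)
    moreover have "s \<in> {s \<in> topspace ?P. f s \<in> U} \<inter> {s \<in> topspace ?P. g s \<in> U}" using s ch(1) True by simp
    ultimately obtain W K where W: "openin ?P W" "closedin ?P K" "s \<in> W" "W \<subseteq> K"
      "K \<subseteq> {s \<in> topspace ?P. f s \<in> U} \<inter> {s \<in> topspace ?P. g s \<in> U}"
      using reg unfolding neighbourhood_base_of by meson
    let ?R = "{z \<in> topspace ?Q. fst z \<in> K \<longrightarrow> z \<in> topspace ?P \<times> U}"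
    have "good K ?R" unfolding good_def
    proof (intro conjI allI impI ballI)
      show "openin ?Q ?R" by (rule openin_prod_outside[OF W(2)]) (use U in \<open>simp add: openin_prod_Times_iff\<close>)
      show "(s, f s) \<in> ?R" if "s \<in> topspace ?P" for s using that W(5) fX by auto
      fix f1 assume f1: "\<forall>s\<in>topspace ?P. (s, f1 s) \<in> ?R"
      have "\<forall>s\<in>K. f1 s \<in> U \<and> g s \<in> U"
      proof
        fix s assume "s \<in> K"
        moreover have "s \<in> topspace ?P" "g s \<in> U" using calculation W(5) by auto
        ultimately show "f1 s \<in> U \<and> g s \<in> U" using f1 by auto
      qed
      then show "(\<forall>s\<in>K. f1 s \<noteq> g s) \<or> (\<exists>U V c c'. chart d X U V c c' \<and> (\<forall>s\<in>K. f1 s \<in> U \<and> g s \<in> U))"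
        using ch(2) by blast
    qed (use W in auto)
    then show ?thesis using W by blast
  next
    case False
    have "closedin ?P {s \<in> topspace ?P. f s = g s}" by (rule closedin_continuous_maps_eq[OF haus f g])
    then have "openin ?P (topspace ?P - {s \<in> topspace ?P. f s = g s})" by blast
    moreover have "s \<in> topspace ?P - {s \<in> topspace ?P. f s = g s}" using s False by simp
    ultimately obtain W K where W: "openin ?P W" "closedin ?P K" "s \<in> W" "W \<subseteq> K"
      "K \<subseteq> topspace ?P - {s \<in> topspace ?P. f s = g s}"
      using reg unfolding neighbourhood_base_of by meson
    let ?R = "{z \<in> topspace ?Q. fst z \<in> K \<longrightarrow> z \<in> {z \<in> topspace ?Q. snd z \<noteq> g (fst z)}}"
    have "good K ?R" unfolding good_def
    proof (intro conjI allI impI ballI)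
      show "openin ?Q ?R" by (rule openin_prod_outside[OF W(2) openin_prod_graph_complement[OF haus g]])
      show "(s, f s) \<in> ?R" if "s \<in> topspace ?P" for s using that W(5) fX by auto
      fix f1 assume f1: "\<forall>s\<in>topspace ?P. (s, f1 s) \<in> ?R"
      have "f1 s \<noteq> g s" if "s \<in> K" for s
      proof -
        have "s \<in> topspace ?P" using that W(5) by blast
        then show ?thesis using f1 that by auto
      qed
      then show "(\<forall>s\<in>K. f1 s \<noteq> g s) \<or> (\<exists>U V c c'. chart d X U V c c' \<and> (\<forall>s\<in>K. f1 s \<in> U \<and> g s \<in> U))"
        by blast
    qed (use W in auto)
    then show ?thesis using W by blast
  qed
  then obtain W K R where WKR: "\<And>s. s \<in> topspace ?P \<Longrightarrow> openin ?P (W s) \<and> s \<in> W s \<and> W s \<subseteq> K s \<and> good (K s) (R s)"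
    by metis
  obtain \<F> where \<F>: "finite \<F>" "\<F> \<subseteq> W ` topspace ?P" "topspace ?P \<subseteq> \<Union>\<F>"
  proof -
    have "(\<forall>U\<in>W ` topspace ?P. openin ?P U) \<and> topspace ?P \<subseteq> \<Union>(W ` topspace ?P)" using WKR by blast
    then show ?thesis using compact_space_cube[of k] that unfolding compact_space_alt by meson
  qed
  obtain F where F: "F \<subseteq> topspace ?P" "finite F" "\<F> = W ` F" using finite_subset_image[OF \<F>(1,2)] by blast
  have "\<exists>f1. continuous_map ?P X f1 \<and> homotopic_with (\<lambda>h. \<forall>s\<in>A. h s = f s) ?P X f f1 \<and>
      (\<forall>s\<in>topspace ?P. (s, f1 s) \<in> G \<and> (\<forall>x\<in>F. (s, f1 s) \<in> R x)) \<and> (\<forall>x\<in>F'. \<forall>s\<in>K x. f1 s \<noteq> g s)"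
    if "finite F'" "F' \<subseteq> F" for F'
    using that
  proof (induction F' rule: finite_induct)
    case empty
    have "\<forall>s\<in>topspace ?P. (s, f s) \<in> G \<and> (\<forall>x\<in>F. (s, f s) \<in> R x)"
      using fG WKR F(1) unfolding good_def by blast
    then show ?case using f by (intro exI[of _ f]) auto
  next
    case (insert x F')
    then obtain f1 where f1: "continuous_map ?P X f1" "homotopic_with (\<lambda>h. \<forall>s\<in>A. h s = f s) ?P X f f1"
      "\<forall>s\<in>topspace ?P. (s, f1 s) \<in> G \<and> (\<forall>x\<in>F. (s, f1 s) \<in> R x)" "\<forall>x\<in>F'. \<forall>s\<in>K x. f1 s \<noteq> g s"
      by auto
    have xF: "x \<in> F" and xP: "x \<in> topspace ?P" using insert.prems F(1) by auto
    have gx: "good (K x) (R x)" using WKR[OF xP] by blast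
    have KP: "K y \<subseteq> topspace ?P" if "y \<in> F" for y
      using WKR[of y] that F(1) closedin_subset unfolding good_def by blast
    have "(\<forall>s\<in>topspace ?P. (s, f1 s) \<in> R x) \<longrightarrow> (\<forall>s\<in>K x. f1 s \<noteq> g s) \<or>
       (\<exists>U V c c'. chart d X U V c c' \<and> (\<forall>s\<in>K x. f1 s \<in> U \<and> g s \<in> U))"
      using gx unfolding good_def by (elim conjE allE[of _ f1])
    moreover have "\<forall>s\<in>topspace ?P. (s, f1 s) \<in> R x" using f1(3) xF by blast
    ultimately have "(\<forall>s\<in>K x. f1 s \<noteq> g s) \<or>
       (\<exists>U V c c'. chart d X U V c c' \<and> (\<forall>s\<in>K x. f1 s \<in> U \<and> g s \<in> U))" by (rule mp)
    then consider "\<forall>s\<in>K x. f1 s \<noteq> g s" | U V c c' where "chart d X U V c c'" "\<forall>s\<in>K x. f1 s \<in> U \<and> g s \<in> U"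
      by (elim disjE exE conjE)
    then show ?case
    proof cases
      case 1
      then show ?thesis using f1 by (intro exI[of _ f1]) auto
    next
      case 2
      \<comment> \<open>The new graph must stay in \<open>G\<close>, satisfy all conditions
        \<open>R y\<close>, and avoid the graph of \<open>g\<close> over the pieces already
        treated.\<close>
      define G1 where "G1 = (G \<inter> (\<Inter>y\<in>F. R y)) \<inter>
        {z \<in> topspace ?Q. fst z \<in> (\<Union>y\<in>F'. K y) \<longrightarrow> z \<in> {z \<in> topspace ?Q. snd z \<noteq> g (fst z)}}"
      have F'F: "F' \<subseteq> F" using insert.prems by auto
      have cK: "closedin ?P (\<Union>y\<in>F'. K y)"
        using WKR F(1) F'F insert.hyps(1) unfolding good_def by (intro closedin_Union) auto
      have "openin ?Q (\<Inter>y\<in>F. R y)"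
      proof (rule openin_Inter)
        show "finite (R ` F)" "R ` F \<noteq> {}" using F(2) xF by auto
        show "openin ?Q Z" if "Z \<in> R ` F" for Z using that WKR F(1) unfolding good_def by blast
      qed
      then have oG1: "openin ?Q G1" unfolding G1_def
        by (intro openin_Int G openin_prod_outside cK openin_prod_graph_complement haus g)
      have f1G1: "(s, f1 s) \<in> G1" if "s \<in> topspace ?P" for s
      proof -
        have "f1 s \<in> topspace X" using f1(1) that by (auto simp: continuous_map_def)
        then show ?thesis using f1(3,4) that unfolding G1_def by auto
      qed
      have f1A: "f1 s = f s" if "s \<in> A" for s using homotopic_with_imp_property[OF f1(2)] that by blast
      obtain f2 where f2: "continuous_map ?P X f2" "homotopic_with (\<lambda>h. \<forall>s\<in>A. h s = f1 s) ?P X f1 f2"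
        "\<And>s. s \<in> topspace ?P \<Longrightarrow> (s, f2 s) \<in> G1" "\<And>s. s \<in> K x \<Longrightarrow> f2 s \<noteq> g s"
      proof (rule general_position_local[OF k d 2(1) f1(1) g oG1 f1G1 _ _ A])
        show "closedin ?P (K x)" using gx by (simp add: good_def)
        show "f1 s \<in> U \<and> g s \<in> U" if "s \<in> K x" for s using 2(2) that by blast
        show "f1 s \<noteq> g s" if "s \<in> A" for s using f1A[OF that] fgA[OF that] by simp
      qed auto
      have "f2 s \<noteq> g s" if y: "y \<in> insert x F'" and s: "s \<in> K y" for y s
      proof (cases "y = x")
        case True
        then show ?thesis using f2(4) s by blast
      next
        case False
        then have yF': "y \<in> F'" using y by blast
        then have "s \<in> topspace ?P" using KP F'F s by blast
        from f2(3)[OF this] show ?thesis using yF' s unfolding G1_def by auto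
      qed
      moreover have "\<forall>s\<in>topspace ?P. (s, f2 s) \<in> G \<and> (\<forall>x\<in>F. (s, f2 s) \<in> R x)"
        using f2(3) unfolding G1_def by blast
      moreover have "homotopic_with (\<lambda>h. \<forall>s\<in>A. h s = f s) ?P X f f2"
        by (rule homotopic_rel_trans[OF f1(2) f2(2)])
      ultimately show ?thesis using f2(1) by blast
    qed
  qed
  from this[OF F(2) order.refl] obtain f1 where f1: "continuous_map ?P X f1"
    "homotopic_with (\<lambda>h. \<forall>s\<in>A. h s = f s) ?P X f f1"
    "\<forall>s\<in>topspace ?P. (s, f1 s) \<in> G \<and> (\<forall>x\<in>F. (s, f1 s) \<in> R x)" "\<forall>x\<in>F. \<forall>s\<in>K x. f1 s \<noteq> g s" by blast
  show ?thesis
  proof (rule that[OF f1(1,2)])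
    fix s assume s: "s \<in> topspace ?P"
    show "(s, f1 s) \<in> G" using f1(3) s by blast
    obtain x where x: "x \<in> F" "s \<in> W x" using s \<F>(3) unfolding F(3) by blast
    then have "s \<in> K x" using WKR[of x] F(1) by blast
    then show "f1 s \<noteq> g s" using f1(4) x(1) by blast
  qed
qed

text \<open>Disjointness from the graphs of the maps already treated is an open condition; it is
  handed to \<open>general_position_one\<close> as \<open>G\<close> when the next map is
  added.\<close>

lemma general_position_family:
  assumes k: "k \<le> 2" and d: "d \<ge> 3" and man: "topological_manifold d X"
    and f: "continuous_map (cube k) X f" and J: "finite J"
    and g: "\<And>j. j \<in> J \<Longrightarrow> continuous_map (cube k) X (g j)"
    and A: "closedin (cube k) A" and fgA: "\<And>s j. s \<in> A \<Longrightarrow> j \<in> J \<Longrightarrow> f s \<noteq> g j s"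
  shows "\<exists>f'. continuous_map (cube k) X f' \<and>
    homotopic_with (\<lambda>h. \<forall>s\<in>A. h s = f s) (cube k) X f f' \<and>
    (\<forall>s\<in>topspace (cube k). \<forall>j\<in>J. f' s \<noteq> g j s)"
  using J g fgA
proof (induction J rule: finite_induct)
  case empty
  then show ?case using f by (intro exI[of _ f]) auto
next
  case (insert i J)
  let ?P = "cube k" and ?Q = "prod_topology (cube k) X"
  have haus: "Hausdorff_space X" using man by (simp add: topological_manifold_def)
  obtain f1 where f1: "continuous_map ?P X f1" "homotopic_with (\<lambda>h. \<forall>s\<in>A. h s = f s) ?P X f f1"
    "\<forall>s\<in>topspace ?P. \<forall>j\<in>J. f1 s \<noteq> g j s" using insert by auto
  have f1A: "f1 s = f s" if "s \<in> A" for s using homotopic_with_imp_property[OF f1(2)] that by blast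
  define G where "G = topspace ?Q \<inter> (\<Inter>j\<in>J. {z \<in> topspace ?Q. snd z \<noteq> g j (fst z)})"
  have oG: "openin ?Q G"
  proof (cases "J = {}")
    case False
    then have "openin ?Q (\<Inter>j\<in>J. {z \<in> topspace ?Q. snd z \<noteq> g j (fst z)})"
      using insert.hyps(1) insert.prems(1)
      by (intro openin_Inter) (auto intro!: openin_prod_graph_complement[OF haus] simp del: topspace_prod_topology)
    then show ?thesis unfolding G_def by (rule openin_Int[OF openin_topspace])
  qed (simp add: G_def del: topspace_prod_topology)
  have f1X: "f1 s \<in> topspace X" if "s \<in> topspace ?P" for s
    using f1(1) that by (auto simp: continuous_map_def)
  have f1G: "(s, f1 s) \<in> G" if "s \<in> topspace ?P" for s
    using f1(3) that f1X[OF that] by (auto simp: G_def)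
  have gi: "continuous_map ?P X (g i)" using insert.prems(1) by simp
  have ne: "f1 s \<noteq> g i s" if "s \<in> A" for s using f1A[OF that] insert.prems(2)[OF that, of i] by simp
  obtain f2 where f2: "continuous_map ?P X f2" "homotopic_with (\<lambda>h. \<forall>s\<in>A. h s = f1 s) ?P X f1 f2"
    "\<And>s. s \<in> topspace ?P \<Longrightarrow> (s, f2 s) \<in> G" "\<And>s. s \<in> topspace ?P \<Longrightarrow> f2 s \<noteq> g i s"
    by (rule general_position_one[OF k d man f1(1) gi oG f1G A ne]) blast+
  have "homotopic_with (\<lambda>h. \<forall>s\<in>A. h s = f s) ?P X f f2"
    by (rule homotopic_rel_trans[OF f1(2) f2(2)])
  moreover have "f2 s \<noteq> g j s" if "s \<in> topspace ?P" "j \<in> insert i J" for s j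
    using f2(3)[OF that(1)] f2(4)[OF that(1)] that(2) by (auto simp: G_def)
  ultimately show ?case using f2(1) by blast
qed

text \<open>Induction on the number of coordinates that are pairwise distinct. The next coordinate
  is moved off the earlier ones, which stay fixed and so remain distinct.\<close>

lemma general_position_config:
  assumes k: "k \<le> 2" and d: "d \<ge> 3" and man: "topological_manifold d X"
    and b: "continuous_map (cube k) (power_space n X) b"
    and A: "closedin (cube k) A" and bA: "\<And>s. s \<in> A \<Longrightarrow> b s \<in> distinct_points n"
  obtains b' where "continuous_map (cube k) (power_space n X) b'"
    "homotopic_with (\<lambda>h. \<forall>s\<in>A. h s = b s) (cube k) (power_space n X) b b'"
    "\<And>s. s \<in> topspace (cube k) \<Longrightarrow> b' s \<in> distinct_points n"
proof -
  let ?P = "cube k" and ?Y = "power_space n X"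
  let ?I = "top_of_set {0..1::real}"
  have AP: "A \<subseteq> topspace ?P" using closedin_subset[OF A] .
  have "\<exists>b'. continuous_map ?P ?Y b' \<and> homotopic_with (\<lambda>h. \<forall>s\<in>A. h s = b s) ?P ?Y b b' \<and>
    (\<forall>s\<in>topspace ?P. b' s \<in> distinct_points m)" if "m \<le> n" for m
    using that
  proof (induction m)
    case 0
    then show ?case using b by (intro exI[of _ b]) (auto simp: distinct_points_def)
  next
    case (Suc m)
    then obtain b1 where b1: "continuous_map ?P ?Y b1" "homotopic_with (\<lambda>h. \<forall>s\<in>A. h s = b s) ?P ?Y b b1"
      "\<forall>s\<in>topspace ?P. b1 s \<in> distinct_points m" by auto
    have b1A: "b1 s = b s" if "s \<in> A" for s using homotopic_with_imp_property[OF b1(2)] that by blast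
    have b1i: "continuous_map ?P X (\<lambda>s. b1 s i)" if "i \<in> {1..n}" for i
      using continuous_map_compose[OF b1(1) power_space_component[OF that]] by (simp add: o_def)
    have m: "Suc m \<in> {1..n}" using Suc.prems by simp
    have "\<exists>f'. continuous_map ?P X f' \<and> homotopic_with (\<lambda>h. \<forall>s\<in>A. h s = b1 s (Suc m)) ?P X (\<lambda>s. b1 s (Suc m)) f' \<and>
      (\<forall>s\<in>topspace ?P. \<forall>j\<in>{1..m}. f' s \<noteq> b1 s j)"
    proof (rule general_position_family[OF k d man b1i[OF m] _ _ A, of "{1..m}" "\<lambda>j s. b1 s j"])
      show "continuous_map ?P X (\<lambda>s. b1 s j)" if "j \<in> {1..m}" for j using b1i[of j] that Suc.prems by simp
      show "b1 s (Suc m) \<noteq> b1 s j" if "s \<in> A" "j \<in> {1..m}" for s j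
        using bA[OF that(1)] b1A[OF that(1)] that(2) m Suc.prems unfolding distinct_points_def by auto
    qed simp
    then obtain f' where f': "continuous_map ?P X f'"
      "homotopic_with (\<lambda>h. \<forall>s\<in>A. h s = b1 s (Suc m)) ?P X (\<lambda>s. b1 s (Suc m)) f'"
      "\<forall>s\<in>topspace ?P. \<forall>j\<in>{1..m}. f' s \<noteq> b1 s j" by blast
    have hA: "homotopic_with (\<lambda>h. \<forall>s\<in>A. h s = (\<lambda>s. b1 s (Suc m)) s) ?P X (\<lambda>s. b1 s (Suc m)) f'"
      using f'(2) by simp
    obtain h where h: "continuous_map (prod_topology ?I ?P) X h"
      "\<forall>s\<in>topspace ?P. h (0, s) = b1 s (Suc m)" "\<forall>s\<in>topspace ?P. h (1, s) = f' s"
      "\<forall>t\<in>{0..1}. \<forall>s\<in>A. h (t, s) = b1 s (Suc m)"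
      using hA unfolding homotopic_rel_iff[OF AP] by blast
    define b2 where "b2 = (\<lambda>s. (b1 s)(Suc m := f' s))"
    define H where "H = (\<lambda>z. (b1 (snd z))(Suc m := h z))"
    have b1e: "b1 s \<in> extensional {1..n}" if "s \<in> topspace ?P" for s
      using b1(1) that unfolding continuous_map_into_power_space by blast
    have Hc: "continuous_map (prod_topology ?I ?P) ?Y H"
      unfolding continuous_map_into_power_space
    proof (intro conjI ballI)
      fix i assume i: "i \<in> {1..n}"
      have "continuous_map (prod_topology ?I ?P) X ((\<lambda>s. b1 s i) \<circ> snd)"
        by (rule continuous_map_compose[OF continuous_map_snd b1i[OF i]])
      then show "continuous_map (prod_topology ?I ?P) X (\<lambda>z. H z i)"
        using h(1) by (cases "i = Suc m") (auto simp: H_def o_def)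
    next
      show "H ` topspace (prod_topology ?I ?P) \<subseteq> extensional {1..n}"
        using b1e m by (auto simp: H_def extensional_def)
    qed
    have b2c: "continuous_map ?P ?Y b2"
      unfolding continuous_map_into_power_space
    proof (intro conjI ballI)
      fix i assume i: "i \<in> {1..n}"
      show "continuous_map ?P X (\<lambda>s. b2 s i)"
        using f'(1) b1i[OF i] by (cases "i = Suc m") (auto simp: b2_def)
    next
      show "b2 ` topspace ?P \<subseteq> extensional {1..n}" using b1e m by (auto simp: b2_def extensional_def)
    qed
    have "homotopic_with (\<lambda>h. \<forall>s\<in>A. h s = b1 s) ?P ?Y b1 b2"
      unfolding homotopic_rel_iff[OF AP] using Hc h(2-4) by (intro exI[of _ H]) (auto simp: H_def b2_def)
    then have "homotopic_with (\<lambda>h. \<forall>s\<in>A. h s = b s) ?P ?Y b b2" by (rule homotopic_rel_trans[OF b1(2)])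
    moreover have "b2 s \<in> distinct_points (Suc m)" if s: "s \<in> topspace ?P" for s
    proof -
      have D: "b1 s i \<noteq> b1 s j" if "i \<in> {1..m}" "j \<in> {1..m}" "i \<noteq> j" for i j
        using b1(3) s that unfolding distinct_points_def by blast
      have E: "f' s \<noteq> b1 s j" if "j \<in> {1..m}" for j using f'(3) s that by blast
      show ?thesis unfolding distinct_points_def
      proof (intro CollectI ballI impI)
        fix i j assume "i \<in> {1..Suc m}" "j \<in> {1..Suc m}" "i \<noteq> j"
        then show "b2 s i \<noteq> b2 s j"
          using D[of i j] E[of i] E[of j] by (cases "i = Suc m"; cases "j = Suc m") (auto simp: b2_def)
      qed
    qed
    ultimately show ?case using b2c by blast
  qed
  from this[OF order.refl] show ?thesis using that by blast
qed

text \<open>The boundary values extend to the contractible power of \<open>Xt\<close>. The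
  projection of the extension is put in general position relative to the boundary, and the homotopy
  that does so is lifted; the end of the lift is the required filling.\<close>

lemma fills_config_cover:
  assumes k: "k \<le> 2" and d: "d \<ge> 3" and man: "topological_manifold d X"
    and cov: "covering_map Xt X p" and Xt: "contractible_space Xt" "topspace Xt \<noteq> {}"
  shows "fills k (config_cover n Xt p)"
  unfolding fills_def
proof (intro allI impI)
  let ?C = "config_cover n Xt p" and ?B = "cube_boundary k"
  let ?I = "top_of_set {0..1::real}"
  fix a assume a: "continuous_map (subtopology (cube k) ?B) ?C a"
  then have aX: "continuous_map (subtopology (cube k) ?B) (power_space n Xt) a"
    by (simp add: continuous_map_into_config_cover)
  obtain b where b: "continuous_map (cube k) (power_space n Xt) b" "\<forall>s\<in>?B. b s = a s"
    using contractible_space_fills[OF contractible_space_power_space[OF Xt(1)] power_space_nonempty[OF Xt(2)]] aX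
    unfolding fills_def by blast
  have pc: "continuous_map (power_space n Xt) (power_space n X) (power_map n p)"
    by (rule continuous_map_power_map[OF covering_map_continuous[OF cov]])
  have covn: "covering_map (power_space n Xt) (power_space n X) (power_map n p)"
    by (rule covering_map_power_map[OF cov])
  have bd: "(power_map n p \<circ> b) s \<in> distinct_points n" if "s \<in> ?B" for s
  proof -
    have "a s \<in> topspace ?C"
      using continuous_map_image_subset_topspace[OF a] that topspace_subtopology_cube_boundary by blast
    then show ?thesis using b(2) that by (simp add: config_cover_def)
  qed
  obtain b' where b': "continuous_map (cube k) (power_space n X) b'"
    "homotopic_with (\<lambda>h. \<forall>s\<in>?B. h s = (power_map n p \<circ> b) s) (cube k) (power_space n X) (power_map n p \<circ> b) b'"
    "\<And>s. s \<in> topspace (cube k) \<Longrightarrow> b' s \<in> distinct_points n"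
    by (rule general_position_config[OF k d man continuous_map_compose[OF b(1) pc] closedin_cube_boundary bd]) blast+
  obtain h where h: "continuous_map (prod_topology ?I (cube k)) (power_space n X) h"
    "\<forall>s\<in>topspace (cube k). h (0, s) = (power_map n p \<circ> b) s" "\<forall>s\<in>topspace (cube k). h (1, s) = b' s"
    "\<forall>t\<in>{0..1}. \<forall>s\<in>?B. h (t, s) = (power_map n p \<circ> b) s"
    using b'(2) unfolding homotopic_rel_iff[OF cube_boundary_subset] by blast
  obtain H where H: "continuous_map (prod_topology (cube k) ?I) (power_space n Xt) H"
    "\<And>s t. s \<in> topspace (cube k) \<Longrightarrow> t \<in> {0..1} \<Longrightarrow> power_map n p (H (s, t)) = h (t, s)"
    "\<And>s. s \<in> topspace (cube k) \<Longrightarrow> H (s, 0) = b s"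
    using covering_map_lift_homotopy[OF covn continuous_map_swap_args[OF h(1)] b(1)] h(2) by auto
  \<comment> \<open>The homotopy in the power of \<open>X\<close> is stationary over the boundary,
    hence so is its lift.\<close>
  have "H (s, 1) = a s" if s: "s \<in> ?B" for s
  proof -
    have sc: "s \<in> topspace (cube k)" using s cube_boundary_subset by blast
    have ps: "pathin (power_space n Xt) (\<lambda>t. H (s, t))" unfolding pathin_def by (rule continuous_map_slice_left[OF H(1) sc])
    then have ps0: "pathin (power_space n Xt) (\<lambda>t. H (s, 0))" by (auto simp: pathin_def continuous_map_def)
    have "H (s, 1) = H (s, 0)"
      by (rule covering_map_lift_path_unique[OF covn ps ps0, of 0 1]) (use H(2)[OF sc] h(4) s in auto)
    then show ?thesis using H(3)[OF sc] b(2) s by simp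
  qed
  moreover have "continuous_map (cube k) ?C (\<lambda>s. H (s, 1))"
    unfolding config_cover_def continuous_map_in_subtopology
    using continuous_map_slice_right[OF H(1), of 1] H(2)[of _ 1] h(3) b'(3) by auto
  ultimately show "\<exists>b. continuous_map (cube k) ?C b \<and> (\<forall>s\<in>?B. b s = a s)"
    by (intro exI[of _ "\<lambda>s. H (s, 1)"]) auto
qed

section \<open>Simple connectedness from fillings\<close>

lemma cube_boundary_0: "cube_boundary 0 = {}"
  by (auto simp: cube_boundary_def)

text \<open>Filling a 1-cube joins two points. Filling a square with the loop on one side and its
  base point on the other three gives a null-homotopy.\<close>

lemma fills_simply_connected_space:
  assumes "fills 1 C" "fills 2 C"
  shows "simply_connected_space C"
  unfolding simply_connected_space_def
proof (intro conjI ballI)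
  let ?I = "top_of_set {0..1::real}"
  have sfc: "continuous_map ?I (cube 1) (\<lambda>t. \<lambda>i\<in>{..<1}. t)"
    unfolding continuous_map_into_cube by auto
  show "path_connected_space C"
    unfolding path_connected_space_def
  proof (intro ballI)
    fix x y assume x: "x \<in> topspace C" and y: "y \<in> topspace C"
    obtain c where c: "continuous_map (subtopology (cube (Suc 0)) (cube_boundary (Suc 0))) C c"
      "\<And>s. s \<in> topspace (cube 0) \<Longrightarrow> c (cube_join 0 (0, s)) = x"
      "\<And>s. s \<in> topspace (cube 0) \<Longrightarrow> c (cube_join 0 (1, s)) = y"
      by (rule cube_boundary_Suc_glue[of 0 C "\<lambda>_. x" "\<lambda>_. y" "\<lambda>_. x"]) (use x y cube_boundary_0 in auto)
    obtain b where b: "continuous_map (cube (Suc 0)) C b" "\<forall>s\<in>cube_boundary (Suc 0). b s = c s"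
      using assms(1) c(1) unfolding fills_def by auto
    \<comment> \<open>The only point of the 0-cube: the function that is undefined
      everywhere.\<close>
    let ?s = "(\<lambda>_. undefined) :: nat \<Rightarrow> real"
    have s: "?s \<in> topspace (cube 0)" by (simp add: topspace_cube)
    have "pathin C (\<lambda>t. (b \<circ> cube_join 0) (t, ?s))" unfolding pathin_def
      by (rule continuous_map_slice_right[OF continuous_map_compose[OF continuous_map_cube_join b(1)] s])
    moreover have "b (cube_join 0 (0, ?s)) = x" "b (cube_join 0 (1, ?s)) = y"
      using b(2) c(2,3)[OF s] cube_join_boundary_iff[OF _ s, of 0] cube_join_boundary_iff[OF _ s, of 1] by auto
    ultimately show "\<exists>g. pathin C g \<and> g 0 = x \<and> g 1 = y" by (intro exI[of _ "\<lambda>t. (b \<circ> cube_join 0) (t, ?s)"]) auto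
  qed
  fix x assume x: "x \<in> topspace C"
  have hom: "rel_homotopic ?I {0, 1} C x \<alpha> (\<lambda>_. x)"
    if \<alpha>: "continuous_map ?I C \<alpha>" "\<alpha> ` {0, 1} \<subseteq> {x}" for \<alpha>
  proof -
    have u: "continuous_map (cube 1) C (\<lambda>s. \<alpha> (s 0))"
      using continuous_map_compose[OF continuous_map_cube_component[of 0 1] \<alpha>(1)] by (simp add: o_def)
    have ux: "\<alpha> (s 0) = x" if "s \<in> cube_boundary 1" for s
      using that \<alpha>(2) by (auto simp: cube_boundary_def)
    obtain c where c: "continuous_map (subtopology (cube (Suc 1)) (cube_boundary (Suc 1))) C c"
      "\<And>s. s \<in> topspace (cube 1) \<Longrightarrow> c (cube_join 1 (0, s)) = \<alpha> (s 0)"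
      "\<And>s. s \<in> topspace (cube 1) \<Longrightarrow> c (cube_join 1 (1, s)) = x"
      "\<And>r s. r \<in> {0..1} \<Longrightarrow> s \<in> cube_boundary 1 \<Longrightarrow> c (cube_join 1 (r, s)) = x"
      by (rule cube_boundary_Suc_glue[OF u, of "\<lambda>_. x" "\<lambda>_. x"]) (use x ux in auto)
    obtain b where b: "continuous_map (cube (Suc 1)) C b" "\<forall>s\<in>cube_boundary (Suc 1). b s = c s"
      using assms(2) c(1) unfolding fills_def by (auto simp: numeral_2_eq_2)
    let ?f = "\<lambda>t. \<lambda>i\<in>{..<1::nat}. t :: real"
    have fin: "?f t \<in> topspace (cube 1)" if "t \<in> {0..1}" for t using that by (auto simp: topspace_cube)
    have fb: "?f t \<in> cube_boundary 1" if "t = 0 \<or> t = 1" for t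
      using that fin[of t] by (auto simp: cube_boundary_def)
    have bc: "b (cube_join 1 (r, s)) = c (cube_join 1 (r, s))"
      if "r \<in> {0..1}" "s \<in> topspace (cube 1)" "r = 0 \<or> r = 1 \<or> s \<in> cube_boundary 1" for r s
      using b(2) cube_join_boundary_iff[OF that(1,2)] that(3) by simp
    define h where "h = (\<lambda>z. (b \<circ> cube_join 1) (fst z, ?f (snd z)))"
    have hc: "continuous_map (prod_topology ?I ?I) C h"
    proof -
      have "continuous_map (prod_topology ?I ?I) (prod_topology ?I (cube 1)) (\<lambda>z. (fst z, (?f \<circ> snd) z))"
        by (intro continuous_map_pairedI continuous_map_fst continuous_map_compose[OF continuous_map_snd sfc])
      from continuous_map_compose[OF this continuous_map_compose[OF continuous_map_cube_join b(1)]]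
      show ?thesis by (simp add: h_def o_def)
    qed
    have h0: "h (0, t) = \<alpha> t" if "t \<in> {0..1}" for t
      using bc[of 0 "?f t"] fin[OF that] c(2)[OF fin[OF that]] by (simp add: h_def)
    have h1: "h (1, t) = x" if "t \<in> {0..1}" for t
      using bc[of 1 "?f t"] fin[OF that] c(3)[OF fin[OF that]] by (simp add: h_def)
    have hx: "h (r, t) = x" if "r \<in> {0..1}" "t \<in> {0, 1}" for r t
    proof -
      have t: "t \<in> {0..1}" "t = 0 \<or> t = 1" using that(2) by auto
      show ?thesis using bc[OF that(1) fin[OF t(1)]] c(4)[OF that(1) fb[OF t(2)]] fb[OF t(2)] by (simp add: h_def)
    qed
    show ?thesis unfolding rel_homotopic_def
    proof (subst homotopic_with)
      fix h k :: "real \<Rightarrow> 'a" assume "\<And>t. t \<in> topspace ?I \<Longrightarrow> h t = k t"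
      then have "h 0 = k 0" "h 1 = k 1" by auto
      then show "(h ` {0, 1} \<subseteq> {x}) = (k ` {0, 1} \<subseteq> {x})" by simp
    next
      show "\<exists>h. continuous_map (prod_topology ?I ?I) C h \<and> (\<forall>t\<in>topspace ?I. h (0, t) = \<alpha> t) \<and>
        (\<forall>t\<in>topspace ?I. h (1, t) = x) \<and> (\<forall>r\<in>{0..1}. (\<lambda>t. h (r, t)) ` {0, 1} \<subseteq> {x})"
        using hc h0 h1 hx by (intro exI[of _ h]) auto
    qed
  qed
  have "rel_class ?I {0, 1} C x \<alpha> = rel_class ?I {0, 1} C x (\<lambda>_. x)"
    if "continuous_map ?I C \<alpha>" "\<alpha> ` {0, 1} \<subseteq> {x}" for \<alpha>
    using rel_class_eq_iff[OF that] hom[OF that] by blast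
  then have "rel_classes ?I {0, 1} C x \<subseteq> {rel_class ?I {0, 1} C x (\<lambda>_. x)}"
    unfolding rel_classes_def by blast
  moreover have "continuous_map ?I C (\<lambda>_. x) \<and> (\<lambda>_. x) ` {0, 1} \<subseteq> {x}" using x by simp
  then have "rel_class ?I {0, 1} C x (\<lambda>_. x) \<in> rel_classes ?I {0, 1} C x"
    unfolding rel_classes_def by (intro imageI CollectI)
  ultimately show "carrier (fundamental_group C x) = {one (fundamental_group C x)}"
    unfolding fundamental_group_def by (simp only: partial_object.select_convs monoid.select_convs) blast
qed

subsection \<open>Orbits of the deck transformations\<close>

lemma topological_manifold_locally_path_connected:
  assumes man: "topological_manifold d X"
  shows "locally_path_connected_space X"
  unfolding locally_path_connected_space
proof (intro allI impI, elim conjE)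
  fix W x assume W: "openin X W" "x \<in> W"
  let ?E = "Euclidean_space d"
  have x: "x \<in> topspace X" using W openin_subset by blast
  obtain U V c c' where ch: "x \<in> U" "chart d X U V c c'" by (rule topological_manifold_chart[OF man x])
  have U: "openin X U" and V: "openin ?E V" and c: "continuous_map (subtopology X U) ?E c"
    and c': "continuous_map (subtopology ?E V) X c'"
    and cV: "\<And>x. x \<in> U \<Longrightarrow> c x \<in> V" and c'c: "\<And>x. x \<in> U \<Longrightarrow> c' (c x) = x"
    and c'U: "\<And>y. y \<in> V \<Longrightarrow> c' y \<in> U" and cc': "\<And>y. y \<in> V \<Longrightarrow> c (c' y) = y"
    using ch(2) unfolding chart_def by auto
  have tV: "topspace (subtopology ?E V) = V" using openin_subset[OF V] by auto
  have tU: "topspace (subtopology X U) = U" using openin_subset[OF U] by auto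
  have "openin (subtopology ?E V) {y \<in> topspace (subtopology ?E V). c' y \<in> W}"
    using c' W(1) openin_continuous_map_preimage by blast
  then have "openin ?E {y \<in> V. c' y \<in> W}" unfolding tV using V by (simp add: openin_open_subtopology)
  moreover have "c x \<in> {y \<in> V. c' y \<in> W}" using cV c'c ch(1) W(2) by simp
  ultimately obtain N where N: "openin ?E N" "path_connectedin ?E N" "c x \<in> N" "N \<subseteq> {y \<in> V. c' y \<in> W}"
    using locally_path_connected_Euclidean_space unfolding locally_path_connected_space by meson
  have eq: "c' ` N = {y \<in> U. c y \<in> N}"
  proof
    show "c' ` N \<subseteq> {y \<in> U. c y \<in> N}"
    proof clarify
      fix y assume y: "y \<in> N"
      then have "y \<in> V" using N(4) by blast
      then show "c' y \<in> U \<and> c (c' y) \<in> N" using y c'U cc' by simp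
    qed
    show "{y \<in> U. c y \<in> N} \<subseteq> c' ` N"
    proof clarify
      fix y assume "y \<in> U" "c y \<in> N"
      then show "y \<in> c' ` N" using c'c[of y] by (metis imageI)
    qed
  qed
  have "openin (subtopology X U) {y \<in> topspace (subtopology X U). c y \<in> N}"
    using c N(1) openin_continuous_map_preimage by blast
  then have "openin X (c' ` N)" unfolding eq tU using U by (simp add: openin_open_subtopology)
  moreover have "path_connectedin X (c' ` N)"
  proof (rule path_connectedin_continuous_map_image[OF c'])
    show "path_connectedin (subtopology ?E V) N" using N by (auto simp: path_connectedin_subtopology)
  qed
  moreover have "x \<in> c' ` N" unfolding eq using ch(1) N(3) by simp
  moreover have "c' ` N \<subseteq> W" using N(4) by auto
  ultimately show "\<exists>U. openin X U \<and> path_connectedin X U \<and> x \<in> U \<and> U \<subseteq> W" by blast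
qed

text \<open>Both are lifts of \<open>p\<close> through itself; being extensional, they are then
  equal as functions.\<close>

lemma deck_transformation_unique:
  assumes cov: "covering_map E X p" and conn: "connected_space E" and e: "e \<in> topspace E"
    and g: "g \<in> deck_transformations E p" and g': "g' \<in> deck_transformations E p" and eq: "g e = g' e"
  shows "g = g'"
proof
  fix z
  show "g z = g' z"
  proof (cases "z \<in> topspace E")
    case True
    have "continuous_map E E g" "continuous_map E E g'"
      using g g' unfolding deck_transformations_def by (auto intro: homeomorphic_imp_continuous_map)
    then show ?thesis
      using covering_map_lift_unique[OF cov conn, of g g' e z] g g' e eq True
      by (simp add: deck_transformations_def)
  next
    case False
    then show ?thesis using g g' by (simp add: deck_transformations_def extensional_def)
  qed
qed

text \<open>Uniqueness of the universal covering, applied to \<open>E\<close> with two points of the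
  same fibre, gives a homeomorphism, which is then made extensional.\<close>

lemma deck_transformation_exists:
  assumes E: "universal_covering E X p" and lpc: "locally_path_connected_space X"
    and ab: "a \<in> topspace E" "b \<in> topspace E" "p a = p b"
  obtains g where "g \<in> deck_transformations E p" "g a = b"
proof -
  obtain g where g: "homeomorphic_map E E g" "\<And>z. z \<in> topspace E \<Longrightarrow> p (g z) = p z" "g a = b"
    using universal_covering_homeomorphic[OF E E lpc ab] by metis
  have "homeomorphic_map E E (restrict g (topspace E))"
    by (rule homeomorphic_map_eq[OF g(1)]) simp
  then have "restrict g (topspace E) \<in> deck_transformations E p"
    using g(2) by (simp add: deck_transformations_def)
  then show ?thesis by (rule that) (use ab(1) g(3) in simp)
qed

text \<open>This evaluates the definite description in \<open>deck_action\<close>: lifts of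
  homotopic loops end at the same point, and a deck transformation is determined by its value at
  \<open>e\<close>.\<close>

lemma deck_action_loop_class:
  assumes E: "universal_covering E X p" and e: "e \<in> topspace E"
    and \<alpha>: "continuous_map (top_of_set {0..1}) X \<alpha>" "\<alpha> ` {0, 1} \<subseteq> {p e}"
    and \<delta>: "pathin E \<delta>" "\<And>t. t \<in> {0..1} \<Longrightarrow> p (\<delta> t) = \<alpha> t" "\<delta> 0 = e"
    and g: "g \<in> deck_transformations E p" "g e = \<delta> 1"
  shows "deck_action E p e (loop_class X (p e) \<alpha>) = g"
  unfolding deck_action_def
proof (rule the_equality)
  have cov: "covering_map E X p" and conn: "connected_space E"
    using E by (auto simp: universal_covering_def simply_connected_space_def path_connected_imp_connected_space)
  let ?C = "loop_class X (p e) \<alpha>"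
  show "g \<in> deck_transformations E p \<and>
      (\<forall>\<alpha>\<in>?C. \<exists>\<delta>. pathin E \<delta> \<and> (\<forall>t\<in>{0..1}. p (\<delta> t) = \<alpha> t) \<and> \<delta> 0 = e \<and> \<delta> 1 = g e)"
  proof (intro conjI ballI g(1))
    fix \<beta> assume "\<beta> \<in> ?C"
    then have hom: "rel_homotopic (top_of_set {0..1}) {0, 1} X (p e) \<alpha> \<beta>" by (simp add: rel_class_def)
    then have hw: "homotopic_with (\<lambda>h. h ` {0, 1} \<subseteq> {p e}) (top_of_set {0..1}) X \<alpha> \<beta>"
      by (simp only: rel_homotopic_def)
    have \<beta>: "pathin X \<beta>" unfolding pathin_def by (rule conjunct2[OF homotopic_with_imp_continuous_maps[OF hw]])
    have \<beta>0: "p e = \<beta> 0" using homotopic_with_imp_property[OF hw] by auto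
    obtain \<epsilon> where eps: "pathin E \<epsilon>" "\<And>t. t \<in> {0..1} \<Longrightarrow> p (\<epsilon> t) = \<beta> t" "\<epsilon> 0 = e"
      by (rule covering_map_lift_path[OF cov \<beta> e \<beta>0]) blast
    have "\<delta> 1 = \<epsilon> 1"
      by (rule covering_map_lift_rel_homotopic[OF cov hom \<delta>(1,2) eps(1,2)]) (use \<delta>(3) eps(3) in auto)
    then show "\<exists>\<delta>. pathin E \<delta> \<and> (\<forall>t\<in>{0..1}. p (\<delta> t) = \<beta> t) \<and> \<delta> 0 = e \<and> \<delta> 1 = g e"
      using eps g(2) by (intro exI[of _ \<epsilon>]) auto
  qed
  fix g' assume g': "g' \<in> deck_transformations E p \<and>
      (\<forall>\<alpha>\<in>?C. \<exists>\<delta>. pathin E \<delta> \<and> (\<forall>t\<in>{0..1}. p (\<delta> t) = \<alpha> t) \<and> \<delta> 0 = e \<and> \<delta> 1 = g' e)"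
  have "\<alpha> \<in> ?C" by (rule rel_class_self[OF \<alpha>])
  then obtain \<epsilon> where eps: "pathin E \<epsilon>" "\<forall>t\<in>{0..1}. p (\<epsilon> t) = \<alpha> t" "\<epsilon> 0 = e" "\<epsilon> 1 = g' e"
    using g' by blast
  have "\<epsilon> 1 = \<delta> 1"
    by (rule covering_map_lift_path_unique[OF cov eps(1) \<delta>(1), of 0 1]) (use eps(2,3) \<delta>(2,3) in auto)
  then have "g' e = g e" using eps(4) g(2) by simp
  then show "g' = g" using deck_transformation_unique[OF cov conn e] g' g(1) by blast
qed

text \<open>The deck transformations preserve the fibres and are transitive on them. Each of them,
  \<open>g\<close>, arises from a loop, the image of a path from \<open>e\<close> to
  \<open>g e\<close>. So the orbits do not depend on the choice of \<open>e\<close>.\<close>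

lemma orbit_deck_action:
  assumes E: "universal_covering E X p" and lpc: "locally_path_connected_space X"
    and e: "e \<in> topspace E" and x: "x \<in> topspace E"
  shows "orbit (fundamental_group X (p e)) (deck_action E p e) x = {z \<in> topspace E. p z = p x}"
proof
  have cov: "covering_map E X p" and pc: "path_connected_space E"
    using E by (auto simp: universal_covering_def simply_connected_space_def)
  have carr: "carrier (fundamental_group X (p e)) = rel_classes (top_of_set {0..1}) {0, 1} X (p e)"
    by (simp add: fundamental_group_def)
  show "orbit (fundamental_group X (p e)) (deck_action E p e) x \<subseteq> {z \<in> topspace E. p z = p x}"
  proof
    fix z assume "z \<in> orbit (fundamental_group X (p e)) (deck_action E p e) x"
    then obtain \<alpha> where \<alpha>: "continuous_map (top_of_set {0..1}) X \<alpha>" "\<alpha> ` {0, 1} \<subseteq> {p e}"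
      "z = deck_action E p e (loop_class X (p e) \<alpha>) x"
      unfolding orbit_def carr rel_classes_def by blast
    have pe: "p e = \<alpha> 0" "\<alpha> 1 = p e" using \<alpha>(2) by auto
    have pa: "pathin X \<alpha>" using \<alpha>(1) by (simp add: pathin_def)
    obtain \<delta> where \<delta>: "pathin E \<delta>" "\<And>t. t \<in> {0..1} \<Longrightarrow> p (\<delta> t) = \<alpha> t" "\<delta> 0 = e"
      by (rule covering_map_lift_path[OF cov pa e pe(1)]) blast
    have d1: "\<delta> 1 \<in> topspace E" using \<delta>(1) by (auto simp: pathin_def continuous_map_def)
    have pd1: "p e = p (\<delta> 1)" using \<delta>(2)[of 1] pe by simp
    obtain g where g: "g \<in> deck_transformations E p" "g e = \<delta> 1"
      by (rule deck_transformation_exists[OF E lpc e d1 pd1])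
    have "z = g x" using deck_action_loop_class[OF E e \<alpha>(1,2) \<delta> g] \<alpha>(3) by simp
    moreover have "g x \<in> topspace E"
      using g(1) x homeomorphic_imp_surjective_map unfolding deck_transformations_def by blast
    ultimately show "z \<in> {z \<in> topspace E. p z = p x}" using g(1) x by (simp add: deck_transformations_def)
  qed
  show "{z \<in> topspace E. p z = p x} \<subseteq> orbit (fundamental_group X (p e)) (deck_action E p e) x"
  proof clarify
    fix z assume z: "z \<in> topspace E" "p z = p x"
    obtain g where g: "g \<in> deck_transformations E p" "g x = z"
      by (rule deck_transformation_exists[OF E lpc x z(1) z(2)[symmetric]])
    have ge: "g e \<in> topspace E"
      using g(1) e homeomorphic_imp_surjective_map unfolding deck_transformations_def by blast
    obtain \<delta> where \<delta>: "pathin E \<delta>" "\<delta> 0 = e" "\<delta> 1 = g e"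
      using pc e ge unfolding path_connected_space_def by metis
    have \<alpha>: "continuous_map (top_of_set {0..1}) X (p \<circ> \<delta>)"
      using pathin_compose[OF \<delta>(1) covering_map_continuous[OF cov]] by (simp add: pathin_def)
    have \<alpha>01: "(p \<circ> \<delta>) ` {0, 1} \<subseteq> {p e}" using \<delta>(2,3) g(1) e by (simp add: deck_transformations_def)
    have "deck_action E p e (loop_class X (p e) (p \<circ> \<delta>)) = g"
      by (rule deck_action_loop_class[OF E e \<alpha> \<alpha>01 \<delta>(1) _ \<delta>(2) g(1) \<delta>(3)[symmetric]]) simp
    then have "z = deck_action E p e (loop_class X (p e) (p \<circ> \<delta>)) x" using g(2) by simp
    moreover have "loop_class X (p e) (p \<circ> \<delta>) \<in> carrier (fundamental_group X (p e))"
      unfolding carr rel_classes_def using \<alpha> \<alpha>01 by blast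
    ultimately show "z \<in> orbit (fundamental_group X (p e)) (deck_action E p e) x"
      unfolding orbit_def by blast
  qed
qed

text \<open>The image of the boundary values is filled in \<open>B\<close>, and the filling is
  compressed. This serves for \<open>C'\<close>: a fibre has been removed from \<open>Xt\<close>
  there, so its fillings are not obtained from a contraction but from those of
  \<open>C\<close>.\<close>

lemma compression_fills:
  assumes "compression A B f" "fills k B"
  shows "fills k A"
  unfolding fills_def
proof (intro allI impI)
  fix a assume a: "continuous_map (subtopology (cube k) (cube_boundary k)) A a"
  have f: "continuous_map A B f" using assms(1) by (simp add: compression_def)
  obtain b where b: "continuous_map (cube k) B b" "\<forall>s\<in>cube_boundary k. b s = (f \<circ> a) s"
    using assms(2) continuous_map_compose[OF a f] unfolding fills_def by blast
  obtain a' h where "continuous_map (cube k) A a'" "\<And>s. s \<in> cube_boundary k \<Longrightarrow> a' s = a s"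
    "continuous_map (prod_topology (top_of_set {0..1::real}) (cube k)) B h"
    by (rule compressionD[OF assms(1) b(1) a]) (use b(2) in auto)
  then show "\<exists>b. continuous_map (cube k) A b \<and> (\<forall>s\<in>cube_boundary k. b s = a s)" by blast
qed

lemma fills_0_nonempty:
  assumes "fills 0 A" shows "topspace A \<noteq> {}"
proof -
  have "continuous_map (subtopology (cube 0) (cube_boundary 0)) A undefined"
    by (simp add: cube_boundary_0 continuous_map_def)
  then obtain b where "continuous_map (cube 0) A b" using assms unfolding fills_def by blast
  then show ?thesis by (auto simp: continuous_map_def topspace_cube)
qed

section \<open>Configuration spaces as bases of coverings; pull-backs and orbit configuration
  spaces\<close>

lemma locally_path_connected_power_space:
  "locally_path_connected_space X \<Longrightarrow> locally_path_connected_space (power_space n X)"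
  unfolding power_space_def by (simp add: locally_path_connected_space_product_topology)

lemma openin_distinct_points:
  assumes "Hausdorff_space X"
  shows "openin (power_space n X) (topspace (power_space n X) \<inter> distinct_points n)"
proof -
  let ?Y = "power_space n X"
  have cl: "closedin ?Y {x \<in> topspace ?Y. x (fst ij) = x (snd ij)}"
    if "ij \<in> {ij \<in> {1..n} \<times> {1..n}. fst ij \<noteq> snd ij}" for ij
    using that by (intro closedin_continuous_maps_eq[OF assms] power_space_component) auto
  have "closedin ?Y (\<Union>ij\<in>{ij \<in> {1..n} \<times> {1..n}. fst ij \<noteq> snd ij}. {x \<in> topspace ?Y. x (fst ij) = x (snd ij)})"
    by (rule closedin_Union) (use cl in auto)
  then have "openin ?Y (topspace ?Y -
      (\<Union>ij\<in>{ij \<in> {1..n} \<times> {1..n}. fst ij \<noteq> snd ij}. {x \<in> topspace ?Y. x (fst ij) = x (snd ij)}))" by blast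
  moreover have "topspace ?Y -
      (\<Union>ij\<in>{ij \<in> {1..n} \<times> {1..n}. fst ij \<noteq> snd ij}. {x \<in> topspace ?Y. x (fst ij) = x (snd ij)})
    = topspace ?Y \<inter> distinct_points n"
    unfolding distinct_points_def by fastforce
  ultimately show ?thesis by simp
qed

lemma locally_path_connected_config_space:
  assumes "Hausdorff_space X" "locally_path_connected_space X"
  shows "locally_path_connected_space (config_space n X)"
proof -
  have "config_space n X = subtopology (power_space n X) (topspace (power_space n X) \<inter> distinct_points n)"
    unfolding config_space_eq by (rule subtopology_restrict[symmetric])
  then show ?thesis
    using locally_path_connected_space_open_subset[OF locally_path_connected_power_space[OF assms(2)] openin_distinct_points[OF assms(1)]]
    by simp
qed

text \<open>A strict pull-back along an inclusion is the graph of \<open>f\<close> over the preimage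
  of the subspace; the second projection inverts the graph map.\<close>

lemma homeomorphic_map_pullback_space:
  assumes f: "continuous_map (subtopology Z T) D f"
    and T: "\<And>z. z \<in> topspace Z \<Longrightarrow> z \<in> T \<longleftrightarrow> f z \<in> topspace D"
  shows "homeomorphic_map (subtopology Z T) (pullback_space D (\<lambda>x. x) Z f) (\<lambda>z. (f z, z))"
proof -
  let ?W = "pullback_space D (\<lambda>x. x) Z f"
  have "continuous_map (subtopology Z T) Z (\<lambda>z. z)" by (rule continuous_map_from_subtopology) simp
  then have 1: "continuous_map (subtopology Z T) ?W (\<lambda>z. (f z, z))"
    unfolding pullback_space_def continuous_map_in_subtopology using f by (auto intro: continuous_map_pairedI)
  have "continuous_map ?W Z snd" unfolding pullback_space_def
    by (intro continuous_map_from_subtopology continuous_map_snd)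
  moreover have W: "snd w \<in> T" "(f (snd w), snd w) = w" if "w \<in> topspace ?W" for w
    using that T[of "snd w"] by (auto simp: pullback_space_def)
  ultimately have 2: "continuous_map ?W (subtopology Z T) snd" by (auto simp: continuous_map_in_subtopology)
  have "homeomorphic_maps (subtopology Z T) ?W (\<lambda>z. (f z, z)) snd"
    unfolding homeomorphic_maps_def using 1 2 W(2) by auto
  then show ?thesis unfolding homeomorphic_map_maps by auto
qed

text \<open>The orbits are fibres of \<open>p\<close>, so they are disjoint exactly if the images
  differ. They are taken in \<open>E\<close>, and \<open>Y\<close> may be smaller; this covers both
  \<open>Xt\<close> and the complement of an orbit.\<close>

lemma orbit_config_space_eq:
  assumes "\<And>x. x \<in> topspace Y \<Longrightarrow> orbit G \<phi> x = {z \<in> topspace E. p z = p x}" "topspace Y \<subseteq> topspace E"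
  shows "orbit_config_space G \<phi> n Y = config_cover n Y p"
proof -
  let ?S = "{x. \<forall>i \<in> {1..n}. \<forall>j \<in> {1..n}. i \<noteq> j \<longrightarrow> orbit G \<phi> (x i) \<inter> orbit G \<phi> (x j) = {}}"
  have *: "orbit G \<phi> x \<inter> orbit G \<phi> y = {} \<longleftrightarrow> p x \<noteq> p y" if "x \<in> topspace Y" "y \<in> topspace Y" for x y
    using assms(1)[OF that(1)] assms(1)[OF that(2)] assms(2) that by auto
  have "z \<in> ?S \<longleftrightarrow> z \<in> power_map n p -` distinct_points n" if "z \<in> topspace (power_space n Y)" for z
  proof -
    have "z i \<in> topspace Y" if "i \<in> {1..n}" for i
      using that \<open>z \<in> topspace (power_space n Y)\<close> by (auto simp: topspace_power_space)
    then show ?thesis using * by (auto simp: distinct_points_def power_map_def)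
  qed
  then have eq: "topspace (power_space n Y) \<inter> ?S = topspace (power_space n Y) \<inter> power_map n p -` distinct_points n"
    by blast
  have "orbit_config_space G \<phi> n Y = subtopology (power_space n Y) (topspace (power_space n Y) \<inter> ?S)"
    unfolding orbit_config_space_def by (rule subtopology_restrict[symmetric])
  also have "\<dots> = config_cover n Y p"
    unfolding eq config_cover_def by (rule subtopology_restrict)
  finally show ?thesis .
qed

lemma inj_on_insert_point: "inj_on (insert_point m Q) (extensional {1..m})"
proof (rule inj_onI)
  fix z z' assume z: "z \<in> extensional {1..m}" "z' \<in> extensional {1..m}" "insert_point m Q z = insert_point m Q z'"
  show "z = z'"
  proof
    fix i
    show "z i = z' i"
    proof (cases "i \<in> {1..m}")
      case True
      then show ?thesis using fun_cong[OF z(3), of "Suc i"] by (simp add: insert_point_def)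
    qed (use z in \<open>auto simp: extensional_def\<close>)
  qed
qed

subsection \<open>The equivalences\<close>

lemma universal_covering_config_cover:
  assumes "covering_map Xt X p" "\<And>k. k \<le> 2 \<Longrightarrow> fills k (config_cover n Xt p)"
  shows "universal_covering (config_cover n Xt p) (config_space n X) (power_map n p)"
  unfolding universal_covering_def
  using covering_map_config_cover[OF assms(1)] fills_simply_connected_space assms(2)[of 1] assms(2)[of 2] by auto

lemma universal_covering_config_cover_homeomorphic:
  assumes C: "universal_covering (config_cover n Xt p) (config_space n X) (power_map n p)"
    and E: "universal_covering E (config_space n X) q"
    and X: "Hausdorff_space X" "locally_path_connected_space X"
    and ne: "topspace (config_cover n Xt p) \<noteq> {}"
  obtains g where "homeomorphic_map (config_cover n Xt p) E g"
proof -
  let ?C = "config_cover n Xt p" and ?B = "config_space n X"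
  have cC: "covering_map ?C ?B (power_map n p)" and cE: "covering_map E ?B q"
    using C E by (auto simp: universal_covering_def)
  obtain c where c: "c \<in> topspace ?C" using ne by blast
  then have "power_map n p c \<in> q ` topspace E" using covering_map_image[OF cC] covering_map_image[OF cE] by blast
  then obtain e where e: "e \<in> topspace E" "power_map n p c = q e" by blast
  obtain g where "homeomorphic_map ?C E g" "\<And>z. z \<in> topspace ?C \<Longrightarrow> q (g z) = power_map n p z" "g c = e"
    by (rule universal_covering_homeomorphic[of ?C ?B "power_map n p" E q c e,
          OF C E locally_path_connected_config_space[OF X] c e]) blast
  then show ?thesis by (intro that)
qed

lemma config_cover_pullback:
  assumes cov: "covering_map Xt X p" and S: "S \<subseteq> topspace X"
  shows "homeomorphic_map (config_cover n (subtopology Xt (p -` S)) p)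
    (pullback_space (config_space n (subtopology X S)) (\<lambda>x. x) (power_space n Xt) (power_map n p))
    (\<lambda>z. (power_map n p z, z))"
proof -
  let ?Xt' = "subtopology Xt (p -` S)" and ?X' = "subtopology X S"
  define T where "T = ({1..n} \<rightarrow>\<^sub>E p -` S) \<inter> power_map n p -` distinct_points n"
  have "power_space n ?Xt' = subtopology (power_space n Xt) ({1..n} \<rightarrow>\<^sub>E p -` S)"
    unfolding power_space_def by (rule subtopology_product_topology[symmetric])
  then have eq: "config_cover n ?Xt' p = subtopology (power_space n Xt) T"
    unfolding config_cover_def T_def by (simp add: subtopology_subtopology)
  have cont: "continuous_map (subtopology (power_space n Xt) T) (config_space n ?X') (power_map n p)"
    unfolding eq[symmetric]
    by (rule covering_map_continuous[OF covering_map_config_cover[OF covering_map_subtopology[OF cov]]])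
  have T: "z \<in> T \<longleftrightarrow> power_map n p z \<in> topspace (config_space n ?X')" if "z \<in> topspace (power_space n Xt)" for z
    using that S by (auto simp: T_def config_space_eq topspace_power_space power_map_def PiE_iff)
  show ?thesis unfolding eq by (rule homeomorphic_map_pullback_space[OF cont T])
qed

theorem proposition2p7:
  fixes n d :: nat
    and X :: "'a topology" and Xt :: "'b topology" and p :: "'b \<Rightarrow> 'a"
    and Q1 e :: 'b and y0 :: "nat \<Rightarrow> 'a"
    and E :: "'c topology" and q :: "'c \<Rightarrow> nat \<Rightarrow> 'a"
    and E' :: "'d topology" and q' :: "'d \<Rightarrow> nat \<Rightarrow> 'a"
  defines "I \<equiv> homotopy_fibre (config_space n X) (power_space n X) y0 (\<lambda>x. x)"
    and "X' \<equiv> subtopology X (topspace X - {p Q1})"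
    and "G \<equiv> fundamental_group X (p e)"
    and "\<phi> \<equiv> deck_action Xt p e"
  assumes "n \<ge> 2"
    and "topological_manifold d X" and "d \<ge> 3" and "connected_space X"
    and "universal_covering Xt X p" and "contractible_space Xt"
    and "Q1 \<in> topspace Xt" and "e \<in> topspace Xt"
    and "y0 \<in> topspace (power_space n X)"
    and "universal_covering E (config_space (n - 1) X') q"
    and "universal_covering E' (config_space n X) q'"
  shows "weakly_homotopy_equivalent_space I E \<and>
    weakly_homotopy_equivalent_space I
      (pullback_space (config_space n X) (\<lambda>x. x) (power_space n Xt) (power_map n p)) \<and>
    weakly_homotopy_equivalent_space I E' \<and>
    weakly_homotopy_equivalent_space I (orbit_config_space G \<phi> n Xt) \<and>
    weakly_homotopy_equivalent_space I
      (pullback_space (config_space (n - 1) X') (\<lambda>x. x)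
         (power_space (n - 1) Xt) (power_map (n - 1) p)) \<and>
    weakly_homotopy_equivalent_space I
      (orbit_config_space G \<phi> (n - 1)
         (subtopology Xt (topspace Xt - orbit G \<phi> Q1)))"
proof -
  note man = \<open>topological_manifold d X\<close>
  have cov: "covering_map Xt X p" using \<open>universal_covering Xt X p\<close> by (simp add: universal_covering_def)
  have haus: "Hausdorff_space X" using man by (simp add: topological_manifold_def)
  have lpc: "locally_path_connected_space X" by (rule topological_manifold_locally_path_connected[OF man])
  define m where "m = n - 1"
  have n: "n = Suc m" using \<open>n \<ge> 2\<close> by (simp add: m_def)
  define S where "S = topspace X - {p Q1}"
  define Xt' where "Xt' = subtopology Xt (p -` S)"
  define C where "C = config_cover n Xt p"
  define C' where "C' = config_cover m Xt' p"
  define j where "j = insert_point m Q1"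
  have cov': "covering_map Xt' X' p"
    unfolding Xt'_def X'_def S_def by (rule covering_map_subtopology[OF cov])
  have slide: "\<exists>B \<theta>. x \<in> B \<and> slidable X B \<theta>" if x: "x \<in> topspace X" for x
  proof -
    obtain B \<theta> where "x \<in> B" "slidable X B \<theta>" by (rule topological_manifold_slidable[OF man x])
    then show ?thesis by blast
  qed
  have comp_j: "compression C' C j"
    unfolding C'_def C_def j_def n Xt'_def S_def
    by (rule compression_insert_point[OF cov \<open>contractible_space Xt\<close> \<open>Q1 \<in> topspace Xt\<close> slide])
  have fillsC: "fills k C" if "k \<le> 2" for k
    unfolding C_def using fills_config_cover[OF that \<open>d \<ge> 3\<close> man cov \<open>contractible_space Xt\<close>] \<open>e \<in> topspace Xt\<close> by blast
  have fillsC': "fills k C'" if "k \<le> 2" for k by (rule compression_fills[OF comp_j fillsC[OF that]])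

  define Y where "Y = power_space n Xt"
  have covY: "covering_map Y (power_space n X) (power_map n p)"
    unfolding Y_def by (rule covering_map_power_map[OF cov])
  have cY: "contractible_space Y" unfolding Y_def by (rule contractible_space_power_space[OF \<open>contractible_space Xt\<close>])
  have "y0 \<in> power_map n p ` topspace Y"
    using covering_map_image[OF covY] \<open>y0 \<in> topspace (power_space n X)\<close> by simp
  \<comment> \<open>Upstairs the paths have to end at this lift of \<open>y0\<close>, the same for
    all of them.\<close>
  then obtain y where y: "y \<in> topspace Y" "power_map n p y = y0" by blast
  have C_Y: "continuous_map C Y (\<lambda>z. z)"
    unfolding C_def Y_def config_cover_def by (rule continuous_map_from_subtopology) simp
  have cj: "continuous_map C' C j" using comp_j by (simp add: compression_def)
  have C'_Y: "continuous_map C' Y j" using continuous_map_compose[OF cj C_Y] by (simp add: o_def)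
  define F where "F = homotopy_fibre C Y y (\<lambda>z. z)"
  \<comment> \<open>The common source of all equivalences. It is formed with \<open>C'\<close> and
    not with \<open>C\<close>, so that it maps to \<open>C'\<close> as well as, through
    \<open>j\<close>, to \<open>C\<close>.\<close>
  define F' where "F' = homotopy_fibre C' Y y j"
  have F'_C': "weak_homotopy_equivalence F' C' fst"
    unfolding F'_def by (intro compression_weak_homotopy_equivalence compression_homotopy_fibre_fst C'_Y cY y(1))
  have F_C: "weak_homotopy_equivalence F C fst"
    unfolding F_def by (intro compression_weak_homotopy_equivalence compression_homotopy_fibre_fst C_Y cY y(1))
  have C'_C: "weak_homotopy_equivalence C' C j" by (rule compression_weak_homotopy_equivalence[OF comp_j])
  define l where "l = (\<lambda>z :: (nat \<Rightarrow> 'b) \<times> (real \<Rightarrow> nat \<Rightarrow> 'b). (j (fst z), snd z))"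
  have "continuous_map F' C (j \<circ> fst)"
    unfolding F'_def by (rule continuous_map_compose[OF continuous_map_homotopy_fibre_fst cj])
  then have lc: "continuous_map F' F l"
    unfolding F_def continuous_map_into_homotopy_fibre
    using continuous_map_homotopy_fibre_snd[of C' Y y j] topspace_homotopy_fibre[of _ C' Y y j]
    by (simp add: l_def o_def F'_def)
  have "fst \<circ> l = j \<circ> fst" by (rule ext) (simp add: l_def)
  \<comment> \<open>Both projections to the configurations are weak equivalences, and so is
    \<open>j\<close>; hence \<open>l\<close> is one by cancellation in
    \<open>fst \<circ> l = j \<circ> fst\<close>.\<close>
  then have F'_F: "weak_homotopy_equivalence F' F l"
    using weak_homotopy_equivalence_cancel_left[OF lc F_C] weak_homotopy_equivalence_compose[OF F'_C' C'_C] by simp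
  define r where "r = (\<lambda>z :: (nat \<Rightarrow> 'b) \<times> (real \<Rightarrow> nat \<Rightarrow> 'b).
    (power_map n p (fst z), \<lambda>t\<in>{0..1::real}. power_map n p (snd z t)))"
  have F_I: "weak_homotopy_equivalence F I r"
    unfolding F_def I_def r_def C_def config_cover_def Y_def[symmetric] config_space_eq y(2)[symmetric]
    by (rule compression_weak_homotopy_equivalence[OF compression_homotopy_fibre_covering[OF covY y(1)]])
  have F'_I: "weak_homotopy_equivalence F' I (r \<circ> l)"
    by (rule weak_homotopy_equivalence_compose[OF F'_F F_I])
  \<comment> \<open>Two points with the same image give paths in \<open>Y\<close> with the same
    projection and the same end \<open>y\<close>, so the paths agree; their starting points
    determine the configurations because \<open>j\<close> is injective. This is what allows the
    change of the type of the points.\<close>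
  have inj: "inj_on (r \<circ> l) (topspace F')"
  proof (rule inj_onI)
    fix z z' assume z: "z \<in> topspace F'" and z': "z' \<in> topspace F'" and eq: "(r \<circ> l) z = (r \<circ> l) z'"
    have pz: "pathin Y (snd z)" "snd z \<in> extensional {0..1}" "snd z 0 = j (fst z)" "snd z 1 = y" "fst z \<in> topspace C'"
      using z by (auto simp: F'_def topspace_homotopy_fibre pathin_def)
    have pz': "pathin Y (snd z')" "snd z' \<in> extensional {0..1}" "snd z' 0 = j (fst z')" "snd z' 1 = y" "fst z' \<in> topspace C'"
      using z' by (auto simp: F'_def topspace_homotopy_fibre pathin_def)
    have pp: "power_map n p (snd z t) = power_map n p (snd z' t)" if "t \<in> {0..1}" for t
      using fun_cong[OF arg_cong[OF eq, of snd], of t] that by (simp add: r_def l_def)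
    have sn: "snd z t = snd z' t" if "t \<in> {0..1}" for t
      by (rule covering_map_lift_path_unique[OF covY pz(1) pz'(1), of 1]) (use pp that pz(4) pz'(4) in auto)
    have "snd z = snd z'" by (rule extensionalityI[OF pz(2) pz'(2)]) (use sn in auto)
    moreover have "j (fst z) = j (fst z')" using sn[of 0] pz(3) pz'(3) by simp
    then have "fst z = fst z'"
      using inj_on_insert_point[of m Q1] pz(5) pz'(5)
      unfolding j_def C'_def config_cover_def by (auto simp: topspace_power_space PiE_iff dest: inj_onD)
    ultimately show "z = z'" by (simp add: prod_eq_iff)
  qed
  \<comment> \<open>From here on it is enough to give a weak equivalence from \<open>C'\<close> or
    from \<open>C\<close> to each of the six spaces.\<close>
  have via_C': "weakly_homotopy_equivalent_space I Z" if "weak_homotopy_equivalence C' Z g" for Z :: "'z topology" and g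
    by (rule weakly_homotopy_equivalent_spaceI[OF inj F'_I weak_homotopy_equivalence_compose[OF F'_C' that]])
  have via_C: "weakly_homotopy_equivalent_space I Z" if "weak_homotopy_equivalence C Z g" for Z :: "'z topology" and g
    by (rule via_C'[OF weak_homotopy_equivalence_compose[OF C'_C that]])

  have 1: "weakly_homotopy_equivalent_space I E"
  proof -
    have "closedin X {p Q1}"
      using closedin_Hausdorff_singleton[OF haus] covering_map_image[OF cov] \<open>Q1 \<in> topspace Xt\<close> by blast
    then have "openin X S" unfolding S_def by blast
    then have "locally_path_connected_space X'"
      unfolding X'_def S_def[symmetric] by (rule locally_path_connected_space_open_subset[OF lpc])
    moreover have "Hausdorff_space X'" unfolding X'_def by (rule Hausdorff_space_subtopology[OF haus])
    moreover have "universal_covering C' (config_space m X') (power_map m p)"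
      unfolding C'_def by (rule universal_covering_config_cover[OF cov' fillsC'[unfolded C'_def]])
    moreover have "topspace C' \<noteq> {}" by (rule fills_0_nonempty[OF fillsC']) simp
    ultimately obtain g where "homeomorphic_map C' E g"
      using universal_covering_config_cover_homeomorphic[of m Xt' p X' E q]
        \<open>universal_covering E (config_space (n - 1) X') q\<close> unfolding C'_def m_def by blast
    from via_C'[OF homeomorphic_map_weak_homotopy_equivalence[OF this]] show ?thesis .
  qed
  have 2: "weakly_homotopy_equivalent_space I
      (pullback_space (config_space n X) (\<lambda>x. x) (power_space n Xt) (power_map n p))"
  proof -
    \<comment> \<open>The unpunctured pull-back is the case \<open>S = topspace X\<close> of
      \<open>config_cover_pullback\<close>.\<close>
    have "subtopology Xt (p -` topspace X) = Xt"
      using covering_map_image[OF cov] by (intro subtopology_superset) auto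
    then have "homeomorphic_map C (pullback_space (config_space n X) (\<lambda>x. x) (power_space n Xt) (power_map n p))
        (\<lambda>z. (power_map n p z, z))"
      using config_cover_pullback[OF cov order.refl, of n] by (simp add: C_def)
    from via_C[OF homeomorphic_map_weak_homotopy_equivalence[OF this]] show ?thesis .
  qed
  have 3: "weakly_homotopy_equivalent_space I E'"
  proof -
    have "universal_covering C (config_space n X) (power_map n p)"
      unfolding C_def by (rule universal_covering_config_cover[OF cov fillsC[unfolded C_def]])
    moreover have "topspace C \<noteq> {}" by (rule fills_0_nonempty[OF fillsC]) simp
    ultimately obtain g where "homeomorphic_map C E' g"
      using universal_covering_config_cover_homeomorphic[of n Xt p X E' q'] haus lpc
        \<open>universal_covering E' (config_space n X) q'\<close> unfolding C_def by blast
    from via_C[OF homeomorphic_map_weak_homotopy_equivalence[OF this]] show ?thesis .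
  qed
  have orb: "orbit G \<phi> x = {z \<in> topspace Xt. p z = p x}" if "x \<in> topspace Xt" for x
    unfolding G_def \<phi>_def
    by (rule orbit_deck_action[OF \<open>universal_covering Xt X p\<close> lpc \<open>e \<in> topspace Xt\<close> that])
  have id: "weak_homotopy_equivalence Z Z id" for Z :: "(nat \<Rightarrow> 'b) topology"
    by (rule homeomorphic_map_weak_homotopy_equivalence) simp
  have 4: "weakly_homotopy_equivalent_space I (orbit_config_space G \<phi> n Xt)"
    using via_C[OF id] orbit_config_space_eq[OF orb, of Xt n] by (simp add: C_def)
  have 5: "weakly_homotopy_equivalent_space I
      (pullback_space (config_space (n - 1) X') (\<lambda>x. x) (power_space (n - 1) Xt) (power_map (n - 1) p))"
    using via_C'[OF homeomorphic_map_weak_homotopy_equivalence[OF config_cover_pullback[OF cov, of S m, folded Xt'_def C'_def]]]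
    by (simp add: S_def X'_def m_def Diff_subset)
  have 6: "weakly_homotopy_equivalent_space I
      (orbit_config_space G \<phi> (n - 1) (subtopology Xt (topspace Xt - orbit G \<phi> Q1)))"
  proof -
    \<comment> \<open>The orbit of \<open>Q1\<close> is its fibre, so removing it from
      \<open>Xt\<close> leaves the preimage of \<open>X\<close> without the image of
      \<open>Q1\<close>.\<close>
    have "topspace Xt \<inter> (topspace Xt - orbit G \<phi> Q1) = topspace Xt \<inter> p -` S"
      using orb[OF \<open>Q1 \<in> topspace Xt\<close>] covering_map_image[OF cov] by (auto simp: S_def)
    then have eq: "subtopology Xt (topspace Xt - orbit G \<phi> Q1) = Xt'"
      unfolding Xt'_def using subtopology_restrict[of Xt "topspace Xt - orbit G \<phi> Q1"]
        subtopology_restrict[of Xt "p -` S"] by simp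
    have sub: "topspace Xt' \<subseteq> topspace Xt" by (simp add: Xt'_def)
    have "orbit_config_space G \<phi> m Xt' = C'"
      unfolding C'_def by (rule orbit_config_space_eq[OF orb sub]) (use sub in blast)
    then show ?thesis unfolding eq m_def[symmetric] using via_C'[OF id] by simp
  qed
  show ?thesis using 1 2 3 4 5 6 by blast
qed

end
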